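(* Let $\mathbb{K}$ be an algebraically closed field with $\operatorname{char}(\mathbb{K})\neq 2$. Let $G$ be a simple graph on $[n]$ obtained by attaching a path of length at least $1$ to each vertex of a triangle, and let $R=\mathbb{K}[x_1,\dots,x_n,y_1,\dots,y_n]$. Then $\mathrm{v}(\mathcal{I}_G)\leq \operatorname{reg}(R/\mathcal{I}_G)$.
   Context: Attaching a path of length $\ell\ge 1$ to a vertex $v$ means identifying $v$ with an end vertex of a path having $\ell$ edges; the three attached paths are pairwise vertex-disjoint and each meets the triangle only in its attachment vertex. $R$ has the standard grading. The parity binomial edge ideal is $\mathcal{I}_G=(x_ix_j-y_iy_j:\{i,j\}\in E(G))\subseteq R$. For a graded ideal $I\subset R$, the $\mathrm{v}$-number is $\mathrm{v}(I)=\min\{d\ge 0:\exists f\in R_d \text{ and } \mathfrak p\in\mathrm{Ass}(I) \text{ with } I:f=\mathfrak p\}$, and $\operatorname{reg}(R/I)=\max\{j-i:\beta_{i,j}(R/I)\neq 0\}$ is the Castelnuovo–Mumford regularity. *)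

theory Defs
  imports
    "HOL-Library.Poly_Mapping"
    "HOL-Algebra.Algebraic_Closure_Type"
    "Jordan_Normal_Form.Matrix_Kernel"
begin

section \<open>Polynomial rings, graded pieces, ideals\<close>

text \<open>
  The type \<open>('v, 'k) mpoly\<close> is the polynomial ring over \<open>'k\<close> with one variable for each
  element of \<open>'v\<close>: finitely supported functions from exponent vectors to coefficients,
  multiplied by convolution.
\<close>

type_synonym ('v, 'k) mpoly = "('v \<Rightarrow>\<^sub>0 nat) \<Rightarrow>\<^sub>0 'k"

definition mvar :: "'v \<Rightarrow> ('v, 'k :: comm_ring_1) mpoly" where
  "mvar v = Poly_Mapping.single (Poly_Mapping.single v 1) 1"

definition mono_deg :: "('v \<Rightarrow>\<^sub>0 nat) \<Rightarrow> nat" where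
  "mono_deg m = (\<Sum>v \<in> Poly_Mapping.keys m. Poly_Mapping.lookup m v)"

text \<open>As usual, the zero polynomial is homogeneous of every degree.\<close>

definition homogeneous :: "nat \<Rightarrow> ('v, 'k :: comm_ring_1) mpoly \<Rightarrow> bool" where
  "homogeneous d f \<longleftrightarrow> (\<forall>m \<in> Poly_Mapping.keys f. mono_deg m = d)"

text \<open>
  The constant \<open>ring_of_type_algebra\<close> views a type of class \<open>comm_ring_1\<close> as a ring (with
  carrier \<open>UNIV\<close>) in the sense of \<open>HOL-Algebra\<close>.
\<close>

definition ideal_colon :: "'a :: comm_ring_1 set \<Rightarrow> 'a \<Rightarrow> 'a set" where
  "ideal_colon I f = {g. g * f \<in> I}"

text \<open>
  \<open>associated_primes I\<close> is the set of associated primes of the module \<open>R/I\<close>; the annihilator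
  of the class of \<open>g\<close> in \<open>R/I\<close> is \<open>I : g\<close>.
\<close>

definition associated_primes :: "'a :: comm_ring_1 set \<Rightarrow> 'a set set" where
  "associated_primes I = {P. primeideal P ring_of_type_algebra \<and> (\<exists>g. P = ideal_colon I g)}"

definition v_number :: "('v, 'k :: comm_ring_1) mpoly set \<Rightarrow> nat" where
  "v_number I =
     (LEAST d. \<exists>f P. homogeneous d f \<and> P \<in> associated_primes I \<and> ideal_colon I f = P)"

section \<open>Graded Betti numbers and regularity\<close>

text \<open>
  \<open>minimal_graded_free_resolution I d A\<close> says that
  \<open>\<dots> \<rightarrow> F\<^sub>2 \<rightarrow> F\<^sub>1 \<rightarrow> F\<^sub>0 = R \<rightarrow> R/I \<rightarrow> 0\<close> is a minimal graded free resolution of \<open>R/I\<close>, for a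
  proper graded ideal \<open>I\<close>.  The list \<open>d i\<close> contains the degrees of the elements of a
  homogeneous basis of \<open>F\<^sub>i\<close>, that is, \<open>F\<^sub>i\<close> is the direct sum of the \<open>R(-j)\<close> for \<open>j\<close> in
  \<open>d i\<close>, and \<open>A i\<close> is the matrix of the map from \<open>F\<^sub>i\<^sub>+\<^sub>1\<close> to \<open>F\<^sub>i\<close>, acting on column vectors.
  The conditions are, in this order: the sizes of the matrices; \<open>F\<^sub>0 = R\<close>; the maps are
  homogeneous of degree \<open>0\<close>; the image of \<open>F\<^sub>i\<^sub>+\<^sub>1\<close> lies in \<open>\<mm> F\<^sub>i\<close>, where \<open>\<mm>\<close> is the ideal
  generated by the variables (no matrix entry has a constant term); exactness at \<open>R/I\<close> and
  \<open>F\<^sub>0\<close>; exactness at \<open>F\<^sub>i\<^sub>+\<^sub>1\<close>.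
\<close>

definition minimal_graded_free_resolution ::
  "('v, 'k :: comm_ring_1) mpoly set \<Rightarrow> (nat \<Rightarrow> nat list) \<Rightarrow> (nat \<Rightarrow> ('v, 'k) mpoly mat) \<Rightarrow> bool"
where
  "minimal_graded_free_resolution I d A \<longleftrightarrow>
     (\<forall>i. A i \<in> carrier_mat (length (d i)) (length (d (Suc i)))) \<and>
     d 0 = [0] \<and>
     (\<forall>i. \<forall>a < length (d i). \<forall>b < length (d (Suc i)).
        \<forall>m \<in> Poly_Mapping.keys (A i $$ (a, b)). mono_deg m + d i ! a = d (Suc i) ! b) \<and>
     (\<forall>i. \<forall>a < length (d i). \<forall>b < length (d (Suc i)).
        Poly_Mapping.lookup (A i $$ (a, b)) 0 = 0) \<and>
     {(A 0 *\<^sub>v w) $ 0 | w. w \<in> carrier_vec (length (d 1))} = I \<and>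
     (\<forall>i. mat_kernel (A i) =
        {A (Suc i) *\<^sub>v w | w. w \<in> carrier_vec (length (d (Suc (Suc i))))})"

text \<open>
  \<open>graded_betti I i j\<close> is the graded Betti number \<open>\<beta>\<^sub>i\<^sub>,\<^sub>j(R/I)\<close>, the multiplicity of \<open>R(-j)\<close> in
  the \<open>i\<close>-th module of the minimal graded free resolution of \<open>R/I\<close>.  That resolution is unique
  up to isomorphism, so the choice does not matter.
\<close>

definition graded_betti :: "('v, 'k :: comm_ring_1) mpoly set \<Rightarrow> nat \<Rightarrow> nat \<Rightarrow> nat" where
  "graded_betti I i j =
     count_list ((SOME d. \<exists>A. minimal_graded_free_resolution I d A) i) j"

definition regularity :: "('v, 'k :: comm_ring_1) mpoly set \<Rightarrow> int" where
  "regularity I = Max {int j - int i | i j. graded_betti I i j \<noteq> 0}"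

section \<open>Parity binomial edge ideals\<close>

text \<open>
  Graphs have the elements of a finite type \<open>'n\<close>, in place of \<open>[n]\<close>, as vertices and are given by their
  sets of edges.  The variables are indexed by \<open>'n + 'n\<close>: \<open>x\<^sub>i\<close> belongs to \<open>Inl i\<close> and
  \<open>y\<^sub>i\<close> to \<open>Inr i\<close>.
\<close>

definition parity_edge_ideal :: "'n set set \<Rightarrow> ('n + 'n, 'k :: comm_ring_1) mpoly set" where
  "parity_edge_ideal E =
     genideal ring_of_type_algebra
       {mvar (Inl i) * mvar (Inl j) - mvar (Inr i) * mvar (Inr j) | i j. {i, j} \<in> E}"

definition path_edges :: "'n list \<Rightarrow> 'n set set" where
  "path_edges p = {{p ! k, p ! Suc k} | k. Suc k < length p}"

text \<open>
  The lists \<open>p\<close>, \<open>q\<close>, \<open>r\<close> are the vertex sequences of the three attached paths, starting at the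
  vertices of the triangle; a path with \<open>l\<close> edges has \<open>l + 1\<close> vertices.
\<close>

definition triangle_with_paths :: "'n set set \<Rightarrow> bool" where
  "triangle_with_paths E \<longleftrightarrow>
     (\<exists>p q r. 2 \<le> length p \<and> 2 \<le> length q \<and> 2 \<le> length r \<and>
        distinct (p @ q @ r) \<and> set (p @ q @ r) = UNIV \<and>
        E = {{hd p, hd q}, {hd q, hd r}, {hd r, hd p}}
            \<union> path_edges p \<union> path_edges q \<union> path_edges r)"

end

theory Submission
  imports Defs
begin

text \<open>
  Let \<open>m = n - 3\<close>; the theorem follows from \<open>v \<le> m \<le> reg\<close>.

  Upper bound: with \<open>1, 2, 3\<close> the vertices of the triangle, \<open>f\<close> is \<open>(x\<^sub>1 + y\<^sub>1) x\<^sub>2 x\<^sub>3\<close> times the product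
  of the \<open>x\<^sub>v\<close> over the inner vertices \<open>v\<close> of the attached paths. It has degree \<open>m\<close>, and \<open>I : f\<close> is the prime
  ideal generated by all \<open>x\<^sub>v - y\<^sub>v\<close>.

  Lower bound: deleting one vertex of the triangle leaves two disjoint paths with \<open>m\<close> edges altogether. A linear
  section maps the binomials \<open>f\<^sub>1, \<dots>, f\<^sub>m\<close> of these edges to \<open>a\<^sub>k\<^sup>2 - a\<^sub>k\<^sub>-\<^sub>1 a\<^sub>k\<^sub>+\<^sub>1\<close>, and \<open>a\<^sub>1 \<cdots> a\<^sub>m\<close> is not in
  the ideal generated by these quadrics. In a free resolution \<open>F\<close> of \<open>R/I\<close>, multiplication by \<open>f\<^sub>k\<close> is
  null-homotopic by some \<open>h\<^sub>k\<close>, and \<open>w = h\<^sub>m \<cdots> h\<^sub>1 1\<close> is an element of \<open>F\<^sub>m\<close> of degree \<open>2m\<close>. If \<open>w\<close> were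
  in \<open>\<mm> F\<^sub>m\<close>, then cancelling \<open>a\<^sub>m, \<dots>, a\<^sub>1\<close> one after the other would put \<open>a\<^sub>1 \<cdots> a\<^sub>m\<close> into the ideal; so \<open>F\<^sub>m\<close>
  has a generator of degree \<open>2m\<close>. The same kind of argument, killing the variables one at a time, shows that
  a minimal resolution is finite, so that the maximum defining the regularity is attained.
\<close>

text \<open>The graph has as many edges as vertices and each triangle vertex has degree three, so
  \<open>n - 3\<close> edges survive a deletion; on the other side \<open>f\<close> has three linear
  factors from the triangle and \<open>n - 6\<close> from inner vertices, the three leaves
  contributing none. The element \<open>w\<close> plays the role of the image of the top generator
  of the Koszul complex on \<open>f_1, ..., f_m\<close> under a comparison map to \<open>F\<close>.
  Once \<open>a_1, ..., a_(k-1)\<close> are set to zero, \<open>f_k\<close> becomes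
  \<open>a_k * a_k\<close>, so the matrix that writes the quadrics in terms of the
  \<open>a_k\<close> is triangular with determinant \<open>a_1 ... a_m\<close>; that determinant
  detects whether \<open>w\<close> survives modulo the maximal ideal. A generator of degree
  \<open>2m\<close> in homological degree \<open>m\<close> contributes \<open>2m - m\<close> to the
  regularity. The Betti numbers come from a resolution selected by choice, so statements about them
  have content only after a minimal resolution is shown to exist; this is the reason for the
  Noetherianity part.\<close>

no_notation fps_nth (infixl \<open>$\<close> 75)

section \<open>Polynomial rings\<close>

lemma poly_mapping_sum_single:
  fixes f :: "'a \<Rightarrow>\<^sub>0 'b :: comm_monoid_add"
  shows "(\<Sum>m\<in>Poly_Mapping.keys f. Poly_Mapping.single m (Poly_Mapping.lookup f m)) = f"
  by (rule poly_mapping_eqI)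
    (auto simp: lookup_sum lookup_single when_def in_keys_iff)

lemma poly_mapping_single_induct [case_names zero add]:
  fixes f :: "'a \<Rightarrow>\<^sub>0 'b :: comm_monoid_add"
  assumes "P 0" and "\<And>m c f. P f \<Longrightarrow> P (Poly_Mapping.single m c + f)"
  shows "P f"
proof -
  have "P (\<Sum>m\<in>S. Poly_Mapping.single m (Poly_Mapping.lookup f m))" if "finite S" for S
    using that by (induction S rule: finite_induct) (auto intro: assms)
  from this[of "Poly_Mapping.keys f"] show ?thesis
    by (simp add: poly_mapping_sum_single)
qed

lemma lookup_single_mult:
  fixes f :: "('v, 'k :: comm_ring_1) mpoly"
  shows "Poly_Mapping.lookup (Poly_Mapping.single a c * f) (a + m) = c * Poly_Mapping.lookup f m"
proof (induction f rule: poly_mapping_single_induct)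
  case (add b x f)
  then show ?case
    by (simp add: distrib_left lookup_add mult_single lookup_single when_def)
qed simp

subsection \<open>Degrees\<close>

lemma mono_deg_superset:
  "finite V \<Longrightarrow> Poly_Mapping.keys m \<subseteq> V \<Longrightarrow> mono_deg m = (\<Sum>v\<in>V. Poly_Mapping.lookup m v)"
  unfolding mono_deg_def by (rule sum.mono_neutral_left) (auto simp: in_keys_iff)

lemma mono_deg_add: "mono_deg (a + b) = mono_deg a + mono_deg b"
proof -
  let ?V = "Poly_Mapping.keys a \<union> Poly_Mapping.keys b"
  have *: "mono_deg (a + b) = (\<Sum>v\<in>?V. Poly_Mapping.lookup (a + b) v)"
    "mono_deg a = (\<Sum>v\<in>?V. Poly_Mapping.lookup a v)"
    "mono_deg b = (\<Sum>v\<in>?V. Poly_Mapping.lookup b v)"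
    using keys_add[of a b] by (auto intro!: mono_deg_superset)
  show ?thesis unfolding * by (simp add: lookup_add sum.distrib)
qed

lemma mono_deg_zero [simp]: "mono_deg 0 = 0"
  by (simp add: mono_deg_def)

lemma mono_deg_single [simp]: "mono_deg (Poly_Mapping.single v n) = n"
  by (simp add: mono_deg_def)

text \<open>Each exponent is bounded by the degree. This finiteness makes division of homogeneous
  vectors terminate.\<close>

lemma finite_mono_deg: "finite {m :: 'v :: finite \<Rightarrow>\<^sub>0 nat. mono_deg m = e}"
proof (rule finite_imageD)
  show "inj_on Poly_Mapping.lookup {m :: 'v \<Rightarrow>\<^sub>0 nat. mono_deg m = e}"
    by (rule inj_onI) (simp only: poly_mapping_eq_iff)
  have le: "Poly_Mapping.lookup m v \<le> mono_deg m" for m :: "'v \<Rightarrow>\<^sub>0 nat" and v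
    unfolding mono_deg_superset[OF finite_UNIV subset_UNIV]
    by (rule member_le_sum) simp_all
  have "Poly_Mapping.lookup ` {m :: 'v \<Rightarrow>\<^sub>0 nat. mono_deg m = e} \<subseteq> PiE UNIV (\<lambda>_. {..e})"
    using le by (fastforce simp: PiE_UNIV_domain)
  moreover have "finite (PiE (UNIV :: 'v set) (\<lambda>_. {..e}))"
    by (rule finite_PiE) simp_all
  ultimately show "finite (Poly_Mapping.lookup ` {m :: 'v \<Rightarrow>\<^sub>0 nat. mono_deg m = e})"
    by (rule finite_subset)
qed

definition hcomp :: "nat \<Rightarrow> ('v, 'k :: comm_ring_1) mpoly \<Rightarrow> ('v, 'k) mpoly" where
  "hcomp e = Poly_Mapping.mapp (\<lambda>m c. c when mono_deg m = e)"

lemma lookup_hcomp: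
  "Poly_Mapping.lookup (hcomp e f) m = (Poly_Mapping.lookup f m when mono_deg m = e)"
  by (auto simp: hcomp_def lookup_mapp when_def in_keys_iff)

lemma hcomp_zero [simp]: "hcomp e 0 = 0"
  by (rule poly_mapping_eqI) (simp add: lookup_hcomp)

lemma hcomp_add: "hcomp e (f + g) = hcomp e f + hcomp e g"
  by (rule poly_mapping_eqI) (simp add: lookup_hcomp lookup_add when_def)

lemma hcomp_diff: "hcomp e (f - g) = hcomp e f - hcomp e g"
  by (rule poly_mapping_eqI) (simp add: lookup_hcomp lookup_minus when_def)

lemma hcomp_sum: "hcomp e (\<Sum>i\<in>S. f i) = (\<Sum>i\<in>S. hcomp e (f i))"
  by (induction S rule: infinite_finite_induct) (auto simp: hcomp_add)

lemma hcomp_single: "hcomp e (Poly_Mapping.single m c) = (Poly_Mapping.single m c when mono_deg m = e)"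
  by (rule poly_mapping_eqI) (auto simp: lookup_hcomp lookup_single when_def)

lemma homogeneous_hcomp: "homogeneous e (hcomp e f)"
  by (auto simp: homogeneous_def in_keys_iff lookup_hcomp)

lemma hcomp_homogeneous: "homogeneous d f \<Longrightarrow> hcomp e f = (f when d = e)"
  by (rule poly_mapping_eqI) (auto simp: lookup_hcomp homogeneous_def when_def in_keys_iff)

lemma homogeneous_iff_hcomp: "homogeneous d f \<longleftrightarrow> hcomp d f = f"
  by (metis homogeneous_hcomp hcomp_homogeneous when_simps(1))

lemma hcomp_single_mult:
  "hcomp e (Poly_Mapping.single m c * f) =
     (if mono_deg m \<le> e then Poly_Mapping.single m c * hcomp (e - mono_deg m) f else 0)"
proof (induction f rule: poly_mapping_single_induct)
  case (add b x f)
  then show ?case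
    by (auto simp: distrib_left hcomp_add mult_single hcomp_single mono_deg_add when_def)
qed auto

lemma hcomp_mult_homogeneous:
  assumes "homogeneous s g"
  shows "hcomp e (g * f) = (if s \<le> e then g * hcomp (e - s) f else 0)"
proof -
  have "hcomp e (g * f) = (\<Sum>m\<in>Poly_Mapping.keys g.
      hcomp e (Poly_Mapping.single m (Poly_Mapping.lookup g m) * f))"
    by (subst poly_mapping_sum_single[of g, symmetric])
      (simp only: sum_distrib_right hcomp_sum)
  also have "\<dots> = (\<Sum>m\<in>Poly_Mapping.keys g. if s \<le> e
      then Poly_Mapping.single m (Poly_Mapping.lookup g m) * hcomp (e - s) f else 0)"
    using assms by (intro sum.cong) (auto simp: hcomp_single_mult homogeneous_def)
  also have "\<dots> = (if s \<le> e then g * hcomp (e - s) f else 0)"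
    by (auto simp: sum_distrib_right[symmetric] poly_mapping_sum_single)
  finally show ?thesis .
qed

lemma homogeneous_zero [simp]: "homogeneous e 0"
  by (simp add: homogeneous_def)

lemma homogeneous_one [simp]: "homogeneous 0 1"
  by (simp add: homogeneous_def)

lemma homogeneous_add: "homogeneous e f \<Longrightarrow> homogeneous e g \<Longrightarrow> homogeneous e (f + g)"
  by (simp add: homogeneous_iff_hcomp hcomp_add)

lemma homogeneous_diff: "homogeneous e f \<Longrightarrow> homogeneous e g \<Longrightarrow> homogeneous e (f - g)"
  by (simp add: homogeneous_iff_hcomp hcomp_diff)

lemma homogeneous_uminus: "homogeneous e f \<Longrightarrow> homogeneous e (- f)"
  using homogeneous_diff[of e 0 f] by simp

lemma homogeneous_mult: "homogeneous a f \<Longrightarrow> homogeneous b g \<Longrightarrow> homogeneous (a + b) (f * g)"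
  using hcomp_mult_homogeneous[of a f "a + b" g] by (simp add: homogeneous_iff_hcomp[of _ g] homogeneous_iff_hcomp[of "a + b"])

lemma homogeneous_mvar: "homogeneous 1 (mvar v)"
  by (auto simp: homogeneous_def mvar_def)

lemma homogeneous_prod_mvar:
  "finite S \<Longrightarrow> homogeneous (card S) (\<Prod>v\<in>S. mvar (h v) :: ('v, 'k :: comm_ring_1) mpoly)"
proof (induction S rule: finite_induct)
  case (insert x F)
  then show ?case using homogeneous_mult[OF homogeneous_mvar[of "h x"] insert.IH] by simp
qed simp

lemma mono_deg_eq_0_iff: "mono_deg m = 0 \<longleftrightarrow> m = 0"
proof -
  have "mono_deg m = 0 \<longleftrightarrow> (\<forall>v\<in>Poly_Mapping.keys m. Poly_Mapping.lookup m v = 0)"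
    unfolding mono_deg_def by (rule sum_eq_0_iff) simp
  also have "\<dots> \<longleftrightarrow> Poly_Mapping.keys m = {}"
    by (auto simp only: in_keys_iff)
  also have "\<dots> \<longleftrightarrow> m = 0"
    by (auto simp: poly_mapping_eq_iff fun_eq_iff in_keys_iff set_eq_iff)
  finally show ?thesis .
qed

lemma homogeneous_zero_iff:
  "homogeneous 0 f \<longleftrightarrow> f = Poly_Mapping.single 0 (Poly_Mapping.lookup f 0)"
proof -
  have "hcomp 0 f = Poly_Mapping.single 0 (Poly_Mapping.lookup f 0)"
    by (rule poly_mapping_eqI) (auto simp: lookup_hcomp lookup_single mono_deg_eq_0_iff when_def)
  then show ?thesis unfolding homogeneous_iff_hcomp by auto
qed

subsection \<open>Substitution\<close>

definition mono_subst :: "('v \<Rightarrow> ('w, 'k :: comm_ring_1) mpoly) \<Rightarrow> ('v \<Rightarrow>\<^sub>0 nat) \<Rightarrow> ('w, 'k) mpoly" where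
  "mono_subst \<sigma> m = (\<Prod>v\<in>Poly_Mapping.keys m. \<sigma> v ^ Poly_Mapping.lookup m v)"

definition subst :: "('v \<Rightarrow> ('w, 'k :: comm_ring_1) mpoly) \<Rightarrow> ('v, 'k) mpoly \<Rightarrow> ('w, 'k) mpoly" where
  "subst \<sigma> f = (\<Sum>m\<in>Poly_Mapping.keys f. Poly_Mapping.single 0 (Poly_Mapping.lookup f m) * mono_subst \<sigma> m)"

lemma mono_subst_superset:
  "finite V \<Longrightarrow> Poly_Mapping.keys m \<subseteq> V \<Longrightarrow> mono_subst \<sigma> m = (\<Prod>v\<in>V. \<sigma> v ^ Poly_Mapping.lookup m v)"
  unfolding mono_subst_def by (rule prod.mono_neutral_left) (auto simp: in_keys_iff)

lemma mono_subst_add: "mono_subst \<sigma> (a + b) = mono_subst \<sigma> a * mono_subst \<sigma> b"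
proof -
  let ?V = "Poly_Mapping.keys a \<union> Poly_Mapping.keys b"
  have *: "mono_subst \<sigma> (a + b) = (\<Prod>v\<in>?V. \<sigma> v ^ Poly_Mapping.lookup (a + b) v)"
    "mono_subst \<sigma> a = (\<Prod>v\<in>?V. \<sigma> v ^ Poly_Mapping.lookup a v)"
    "mono_subst \<sigma> b = (\<Prod>v\<in>?V. \<sigma> v ^ Poly_Mapping.lookup b v)"
    using keys_add[of a b] by (auto intro!: mono_subst_superset)
  show ?thesis unfolding * by (simp add: lookup_add power_add prod.distrib)
qed

lemma subst_superset:
  "finite S \<Longrightarrow> Poly_Mapping.keys f \<subseteq> S \<Longrightarrow>
     subst \<sigma> f = (\<Sum>m\<in>S. Poly_Mapping.single 0 (Poly_Mapping.lookup f m) * mono_subst \<sigma> m)"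
  unfolding subst_def by (rule sum.mono_neutral_left) (auto simp: in_keys_iff)

lemma subst_zero [simp]: "subst \<sigma> 0 = 0"
  by (simp add: subst_def)

lemma subst_single: "subst \<sigma> (Poly_Mapping.single m c) = Poly_Mapping.single 0 c * mono_subst \<sigma> m"
  by (subst subst_superset[of "{m}"]) auto

lemma subst_one [simp]: "subst \<sigma> 1 = 1"
  by (simp only: single_one[symmetric] subst_single) (simp add: mono_subst_def)

lemma subst_add: "subst \<sigma> (f + g) = subst \<sigma> f + subst \<sigma> g"
proof -
  let ?S = "Poly_Mapping.keys f \<union> Poly_Mapping.keys g"
  have *: "subst \<sigma> (f + g) = (\<Sum>m\<in>?S. Poly_Mapping.single 0 (Poly_Mapping.lookup (f + g) m) * mono_subst \<sigma> m)"
    "subst \<sigma> f = (\<Sum>m\<in>?S. Poly_Mapping.single 0 (Poly_Mapping.lookup f m) * mono_subst \<sigma> m)"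
    "subst \<sigma> g = (\<Sum>m\<in>?S. Poly_Mapping.single 0 (Poly_Mapping.lookup g m) * mono_subst \<sigma> m)"
    using keys_add[of f g] by (auto intro!: subst_superset)
  show ?thesis
    unfolding * by (simp add: lookup_add single_add distrib_right sum.distrib)
qed

lemma subst_diff: "subst \<sigma> (f - g) = subst \<sigma> f - subst \<sigma> g"
  using subst_add[of \<sigma> "f - g" g] by simp

lemma subst_uminus: "subst \<sigma> (- f) = - subst \<sigma> f"
  using subst_diff[of \<sigma> 0 f] by simp

lemma subst_mult:
  fixes \<sigma> :: "'v \<Rightarrow> ('w, 'k :: comm_ring_1) mpoly"
  shows "subst \<sigma> (f * g) = subst \<sigma> f * subst \<sigma> g"
proof (induction f rule: poly_mapping_single_induct)
  case (add a x f)
  have "subst \<sigma> (Poly_Mapping.single a x * g) = subst \<sigma> (Poly_Mapping.single a x) * subst \<sigma> g"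
  proof (induction g rule: poly_mapping_single_induct)
    case (add b y g)
    have "Poly_Mapping.single 0 (x * y) = (Poly_Mapping.single 0 x :: ('w, 'k) mpoly) * Poly_Mapping.single 0 y"
      by (simp add: mult_single)
    then show ?case using add
      by (simp add: distrib_left subst_add subst_single mult_single[of a] mono_subst_add mult_ac)
  qed simp
  then show ?case using add by (simp add: distrib_right subst_add)
qed simp

lemma subst_prod: "subst \<sigma> (\<Prod>i\<in>S. f i) = (\<Prod>i\<in>S. subst \<sigma> (f i))"
  by (induction S rule: infinite_finite_induct) (auto simp: subst_mult)

lemma subst_power: "subst \<sigma> (f ^ n) = subst \<sigma> f ^ n"
  by (induction n) (auto simp: subst_mult)

lemma subst_mvar [simp]: "subst \<sigma> (mvar v) = \<sigma> v"
  by (simp add: mvar_def subst_single mono_subst_def)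

lemma mono_subst_mvar: "mono_subst mvar m = Poly_Mapping.single m (1 :: 'k :: comm_ring_1)"
proof -
  have pw: "mvar v ^ n = Poly_Mapping.single (Poly_Mapping.single v n) (1 :: 'k)"
    for v :: 'v and n
    by (induction n) (auto simp: mvar_def mult_single single_add[symmetric])
  have *: "(\<Prod>v\<in>S. mvar v ^ f v) =
      Poly_Mapping.single (\<Sum>v\<in>S. Poly_Mapping.single v (f v)) (1 :: 'k)" for S :: "'v set" and f
    by (induction S rule: infinite_finite_induct) (auto simp: pw mult_single)
  show ?thesis
    by (simp add: mono_subst_def * poly_mapping_sum_single)
qed

lemma subst_mvar_id [simp]: "subst mvar f = f"
  by (simp add: subst_def mono_subst_mvar mult_single poly_mapping_sum_single)

lemma subst_subst: "subst \<sigma> (subst \<tau> f) = subst (\<lambda>v. subst \<sigma> (\<tau> v)) f"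
proof (induction f rule: poly_mapping_single_induct)
  case (add m c f)
  have "subst \<sigma> (mono_subst \<tau> m) = mono_subst (\<lambda>v. subst \<sigma> (\<tau> v)) m"
    by (simp add: mono_subst_def subst_prod subst_power)
  moreover have "subst \<sigma> (Poly_Mapping.single 0 c) = Poly_Mapping.single 0 c"
    by (simp add: subst_single mono_subst_def)
  ultimately show ?case
    using add by (simp add: subst_add subst_mult subst_single)
qed simp

lemma subst_kill:
  fixes f :: "('v, 'k :: comm_ring_1) mpoly"
  shows "(subst (\<lambda>_. 0) f :: ('v, 'k) mpoly) = Poly_Mapping.single 0 (Poly_Mapping.lookup f 0)"
proof (induction f rule: poly_mapping_single_induct)
  case (add m c f)
  have "mono_subst (\<lambda>_ :: 'v. 0 :: ('v, 'k) mpoly) m = (1 when m = 0)"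
  proof (cases "m = 0")
    case False
    then obtain v where "Poly_Mapping.lookup m v \<noteq> 0"
      by (auto simp: poly_mapping_eq_iff fun_eq_iff)
    then show ?thesis using False
      unfolding mono_subst_def
      by (subst prod_zero[OF finite_keys]) (auto simp: in_keys_iff zero_power intro!: bexI[of _ v])
  qed (simp add: mono_subst_def)
  with add show ?case
    by (auto simp: subst_add subst_single lookup_add lookup_single when_def single_add)
qed simp

text \<open>Renaming the variables to natural numbers makes the exponent vectors linearly ordered,
  and there a product of nonzero polynomials is nonzero. The renaming is injective because renaming
  back is a left inverse.\<close>

lemma mpoly_no_zero_divisors:
  fixes f g :: "('v :: finite, 'k :: idom) mpoly"
  assumes "f * g = 0"
  shows "f = 0 \<or> g = 0"
proof -
  obtain b :: "'v \<Rightarrow> nat" where "inj b"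
    using finite_imp_inj_to_nat_seg[of "UNIV :: 'v set"] by auto
  let ?h = "subst (\<lambda>v. mvar (b v)) :: ('v, 'k) mpoly \<Rightarrow> (nat, 'k) mpoly"
  have inverse: "subst (\<lambda>n. mvar (the_inv b n)) (?h u) = u" for u
    using \<open>inj b\<close> by (simp add: subst_subst the_inv_f_f)
  have "?h f * ?h g = 0"
    using assms by (metis subst_mult subst_zero)
  then have "?h f = 0 \<or> ?h g = 0" by simp
  then show ?thesis using inverse by (metis subst_zero)
qed

section \<open>Ideals\<close>

text \<open>Bare closure conditions on a set of ring elements; \<open>is_ideal_iff_ideal\<close>
  ties them to the ideals behind \<open>genideal\<close> and \<open>primeideal\<close>.\<close>

definition is_ideal :: "'a :: comm_ring_1 set \<Rightarrow> bool" where
  "is_ideal N \<longleftrightarrow> 0 \<in> N \<and> (\<forall>a\<in>N. \<forall>b\<in>N. a + b \<in> N) \<and> (\<forall>a\<in>N. \<forall>r. r * a \<in> N)"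

lemma is_idealD:
  assumes "is_ideal N"
  shows "0 \<in> N" "a \<in> N \<Longrightarrow> b \<in> N \<Longrightarrow> a + b \<in> N" "a \<in> N \<Longrightarrow> r * a \<in> N" "a \<in> N \<Longrightarrow> a * r \<in> N"
    "a \<in> N \<Longrightarrow> - a \<in> N" "a \<in> N \<Longrightarrow> b \<in> N \<Longrightarrow> a - b \<in> N"
proof -
  show mult: "r * a \<in> N" if "a \<in> N" for a r
    using assms that by (auto simp: is_ideal_def)
  then show "a * r \<in> N" if "a \<in> N" using that by (simp add: mult.commute)
  show minus: "- a \<in> N" if "a \<in> N" for a using mult[OF that, of "-1"] by simp
  show add: "a + b \<in> N" if "a \<in> N" "b \<in> N" for a b
    using assms that by (auto simp: is_ideal_def)
  show "a - b \<in> N" if "a \<in> N" "b \<in> N" using add[OF that(1) minus[OF that(2)]] by simp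
qed (use assms in \<open>auto simp: is_ideal_def\<close>)

lemma is_ideal_sum: "is_ideal N \<Longrightarrow> (\<And>i. i \<in> S \<Longrightarrow> f i \<in> N) \<Longrightarrow> (\<Sum>i\<in>S. f i) \<in> N"
  by (induction S rule: infinite_finite_induct) (auto simp: is_ideal_def)

lemma is_ideal_iff_ideal: "is_ideal N \<longleftrightarrow> ideal N (ring_of_type_algebra :: 'a :: comm_ring_1 ring)"
proof -
  interpret R: cring "ring_of_type_algebra :: 'a ring" by (rule cring_from_type_algebra)
  have [simp]: "carrier (ring_of_type_algebra :: 'a ring) = UNIV"
    "\<And>a b. a \<oplus>\<^bsub>ring_of_type_algebra\<^esub> b = a + (b :: 'a)"
    "\<And>a b. a \<otimes>\<^bsub>ring_of_type_algebra\<^esub> b = a * (b :: 'a)"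
    "\<zero>\<^bsub>ring_of_type_algebra\<^esub> = (0 :: 'a)"
    by (simp_all add: ring_of_type_algebra_def)
  show ?thesis
  proof
    assume N: "is_ideal N"
    have inv: "\<ominus>\<^bsub>ring_of_type_algebra\<^esub> a = - (a :: 'a)" for a
      by (rule R.add.inv_equality) auto
    show "ideal N (ring_of_type_algebra :: 'a ring)"
    proof (rule idealI)
      show "ring (ring_of_type_algebra :: 'a ring)" by (rule R.ring_axioms)
      show "subgroup N (add_monoid (ring_of_type_algebra :: 'a ring))"
        by (rule R.add.subgroupI)
          (use is_idealD[OF N] inv in \<open>auto simp: a_inv_def[symmetric]\<close>)
    qed (use is_idealD[OF N] in auto)
  next
    assume "ideal N (ring_of_type_algebra :: 'a ring)"
    then interpret I: ideal N "ring_of_type_algebra :: 'a ring" .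
    show "is_ideal N"
      unfolding is_ideal_def
      using I.a_closed I.I_l_closed I.zero_closed by auto
  qed
qed

lemma genideal_type_algebra:
  fixes S :: "'a :: comm_ring_1 set"
  shows "genideal ring_of_type_algebra S = \<Inter> {N. is_ideal N \<and> S \<subseteq> N}"
  by (simp add: genideal_def is_ideal_iff_ideal)

lemma is_ideal_genideal: "is_ideal (genideal ring_of_type_algebra (S :: 'a :: comm_ring_1 set))"
  unfolding genideal_type_algebra by (auto simp: is_ideal_def)

lemma genideal_type_algebra_subset:
  "S \<subseteq> genideal ring_of_type_algebra (S :: 'a :: comm_ring_1 set)"
  unfolding genideal_type_algebra by auto

lemma genideal_type_algebra_minimal:
  "is_ideal N \<Longrightarrow> S \<subseteq> N \<Longrightarrow> genideal ring_of_type_algebra (S :: 'a :: comm_ring_1 set) \<subseteq> N"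
  unfolding genideal_type_algebra by auto

lemma is_ideal_colon: "is_ideal I \<Longrightarrow> is_ideal (ideal_colon I f)"
  unfolding is_ideal_def ideal_colon_def by (auto simp: distrib_right mult.assoc)

lemma primeideal_type_algebraI:
  fixes P :: "'a :: comm_ring_1 set"
  assumes "is_ideal P" "1 \<notin> P" "\<And>a b. a * b \<in> P \<Longrightarrow> a \<in> P \<or> b \<in> P"
  shows "primeideal P ring_of_type_algebra"
proof -
  interpret cring "ring_of_type_algebra :: 'a ring" by (rule cring_from_type_algebra)
  show ?thesis
    by (rule primeidealI)
      (use assms is_ideal_iff_ideal cring_from_type_algebra in \<open>auto simp: ring_of_type_algebra_def\<close>)
qed

lemma is_ideal_subst_kernel: "is_ideal {f. subst \<sigma> f = 0}"
  by (auto simp: is_ideal_def subst_add subst_mult)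

text \<open>Products are congruent factor by factor, so substitution respects congruence modulo
  \<open>N\<close>. It yields divisibility by a variable and, for the v-number, the inclusion of the
  prime ideal in a colon ideal from its generators.\<close>

lemma diff_subst_in_ideal:
  assumes N: "is_ideal N" and gen: "\<And>v. mvar v - \<sigma> v \<in> N"
  shows "f - subst \<sigma> f \<in> N"
proof (induction f rule: poly_mapping_single_induct)
  case zero
  show ?case using is_idealD(1)[OF N] by simp
next
  case (add m c f)
  have mult: "a * b - a' * b' \<in> N" if "a - a' \<in> N" "b - b' \<in> N" for a b a' b'
  proof -
    have "a * b - a' * b' = (a - a') * b + a' * (b - b')" by (simp add: algebra_simps)
    then show ?thesis using is_idealD[OF N] that by metis
  qed
  have pw: "mvar v ^ n - \<sigma> v ^ n \<in> N" for v n
    by (induction n) (auto intro: mult gen simp: is_idealD[OF N])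
  have "(\<Prod>v\<in>S. mvar v ^ h v) - (\<Prod>v\<in>S. \<sigma> v ^ h v) \<in> N" for S and h :: "'a \<Rightarrow> nat"
    by (induction S rule: infinite_finite_induct) (auto intro: mult pw simp: is_idealD[OF N])
  from is_idealD(3)[OF N this, of "Poly_Mapping.single 0 c"]
  have "Poly_Mapping.single 0 c * mono_subst mvar m - Poly_Mapping.single 0 c * mono_subst \<sigma> m \<in> N"
    by (simp add: mono_subst_def right_diff_distrib)
  then have "Poly_Mapping.single m c - subst \<sigma> (Poly_Mapping.single m c) \<in> N"
    by (simp add: subst_single mono_subst_mvar mult_single)
  from is_idealD(2)[OF N this add] show ?case
    by (simp add: subst_add algebra_simps)
qed

section \<open>Graded submodules of free modules\<close>

definition submod :: "nat \<Rightarrow> 'a :: comm_ring_1 vec set \<Rightarrow> bool" where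
  "submod k M \<longleftrightarrow> M \<subseteq> carrier_vec k \<and> 0\<^sub>v k \<in> M \<and>
     (\<forall>u\<in>M. \<forall>v\<in>M. u + v \<in> M) \<and> (\<forall>u\<in>M. \<forall>r. r \<cdot>\<^sub>v u \<in> M)"

lemma submodD:
  assumes "submod k M"
  shows "u \<in> M \<Longrightarrow> u \<in> carrier_vec k" "0\<^sub>v k \<in> M" "u \<in> M \<Longrightarrow> v \<in> M \<Longrightarrow> u + v \<in> M"
    "u \<in> M \<Longrightarrow> r \<cdot>\<^sub>v u \<in> M" "u \<in> M \<Longrightarrow> v \<in> M \<Longrightarrow> u - v \<in> M"
proof -
  show *: "u \<in> carrier_vec k" if "u \<in> M" for u
    using assms that by (auto simp: submod_def)
  show "u - v \<in> M" if "u \<in> M" "v \<in> M"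
  proof -
    have "u - v = u + (-1) \<cdot>\<^sub>v v"
      using *[OF that(1)] *[OF that(2)] by auto
    then show ?thesis using assms that by (auto simp: submod_def)
  qed
qed (use assms in \<open>auto simp: submod_def\<close>)

lemma index_mult_mat_vec_sum:
  "A \<in> carrier_mat k l \<Longrightarrow> u \<in> carrier_vec l \<Longrightarrow> i < k \<Longrightarrow> (A *\<^sub>v u) $ i = (\<Sum>j<l. A $$ (i, j) * u $ j)"
  by (auto simp: scalar_prod_def lessThan_atLeast0)

lemma mult_mat_vec_in_submod:
  assumes A: "A \<in> carrier_mat k l" and u: "u \<in> carrier_vec l" and M: "submod k M"
    and col: "\<And>j. j < l \<Longrightarrow> u $ j \<cdot>\<^sub>v col A j \<in> M"
  shows "A *\<^sub>v u \<in> M"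
proof -
  have "vec k (\<lambda>i. \<Sum>j<t. A $$ (i, j) * u $ j) \<in> M" if "t \<le> l" for t
    using that
  proof (induction t)
    case 0
    have "vec k (\<lambda>i. \<Sum>j<0. A $$ (i, j) * u $ j) = 0\<^sub>v k" by auto
    then show ?case using submodD(2)[OF M] by metis
  next
    case (Suc t)
    have "vec k (\<lambda>i. \<Sum>j<Suc t. A $$ (i, j) * u $ j) =
        vec k (\<lambda>i. \<Sum>j<t. A $$ (i, j) * u $ j) + u $ t \<cdot>\<^sub>v col A t"
      using A Suc.prems by (auto simp: mult.commute)
    then show ?case using Suc submodD(3)[OF M] col by simp
  qed
  moreover have "A *\<^sub>v u = vec k (\<lambda>i. \<Sum>j<l. A $$ (i, j) * u $ j)"
    using index_mult_mat_vec_sum[OF A u] A by auto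
  ultimately show ?thesis by simp
qed

lemma mult_mat_vec_smult:
  fixes A :: "'a :: comm_ring_1 mat"
  assumes "A \<in> carrier_mat k l" "u \<in> carrier_vec l"
  shows "A *\<^sub>v (r \<cdot>\<^sub>v u) = r \<cdot>\<^sub>v (A *\<^sub>v u)"
  using assms by (intro eq_vecI) auto

lemma submod_image:
  assumes A: "A \<in> carrier_mat k l"
  shows "submod k {A *\<^sub>v u | u. u \<in> carrier_vec l}"
  unfolding submod_def
proof (intro conjI ballI allI)
  show "{A *\<^sub>v u | u. u \<in> carrier_vec l} \<subseteq> carrier_vec k" using A by auto
  show "0\<^sub>v k \<in> {A *\<^sub>v u | u. u \<in> carrier_vec l}"
    using A by (auto intro!: exI[of _ "0\<^sub>v l"])
next
  fix u v assume "u \<in> {A *\<^sub>v u | u. u \<in> carrier_vec l}" "v \<in> {A *\<^sub>v u | u. u \<in> carrier_vec l}"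
  then obtain u' v' where *: "u' \<in> carrier_vec l" "u = A *\<^sub>v u'" "v' \<in> carrier_vec l" "v = A *\<^sub>v v'"
    by auto
  then have "u + v = A *\<^sub>v (u' + v')" using mult_add_distrib_mat_vec[OF A] by simp
  then show "u + v \<in> {A *\<^sub>v u | u. u \<in> carrier_vec l}" using * by auto
next
  fix u r assume "u \<in> {A *\<^sub>v u | u. u \<in> carrier_vec l}"
  then obtain u' where *: "u' \<in> carrier_vec l" "u = A *\<^sub>v u'" by auto
  then have "r \<cdot>\<^sub>v u = A *\<^sub>v (r \<cdot>\<^sub>v u')" using mult_mat_vec_smult[OF A] by simp
  then show "r \<cdot>\<^sub>v u \<in> {A *\<^sub>v u | u. u \<in> carrier_vec l}" using * by auto
qed

lemma submod_kernel:
  assumes A: "A \<in> carrier_mat k l"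
  shows "submod l (mat_kernel A)"
proof -
  have "A *\<^sub>v (u + v) = 0\<^sub>v k" if "u \<in> carrier_vec l" "v \<in> carrier_vec l" "A *\<^sub>v u = 0\<^sub>v k" "A *\<^sub>v v = 0\<^sub>v k" for u v
    using that mult_add_distrib_mat_vec[OF A] by simp
  moreover have "A *\<^sub>v (r \<cdot>\<^sub>v u) = 0\<^sub>v k" if "u \<in> carrier_vec l" "A *\<^sub>v u = 0\<^sub>v k" for r u
    using that mult_mat_vec_smult[OF A] by auto
  ultimately show ?thesis using A by (auto simp: submod_def mat_kernel_def)
qed

subsection \<open>Homogeneous vectors\<close>

text \<open>Homogeneous elements of degree \<open>e\<close> in the direct sum of the
  \<open>R(-d ! b)\<close>. The additive form of the degree condition forces an entry with
  \<open>d ! b > e\<close> to be zero.\<close>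

definition hvec :: "nat list \<Rightarrow> nat \<Rightarrow> ('v, 'k :: comm_ring_1) mpoly vec \<Rightarrow> bool" where
  "hvec d e w \<longleftrightarrow> w \<in> carrier_vec (length d) \<and>
     (\<forall>b<length d. \<forall>m\<in>Poly_Mapping.keys (w $ b). mono_deg m + d ! b = e)"

text \<open>The guard matters: for \<open>d ! b > e\<close> the truncated difference
  \<open>e - d ! b\<close> is \<open>0\<close> and would select the constant term.\<close>

definition gcomp :: "nat list \<Rightarrow> nat \<Rightarrow> ('v, 'k :: comm_ring_1) mpoly vec \<Rightarrow> ('v, 'k) mpoly vec" where
  "gcomp d e w = vec (length d) (\<lambda>b. if d ! b \<le> e then hcomp (e - d ! b) (w $ b) else 0)"

definition graded_mat :: "nat list \<Rightarrow> nat list \<Rightarrow> ('v, 'k :: comm_ring_1) mpoly mat \<Rightarrow> bool" where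
  "graded_mat d d' A \<longleftrightarrow> A \<in> carrier_mat (length d) (length d') \<and>
     (\<forall>a<length d. \<forall>b<length d'. \<forall>m\<in>Poly_Mapping.keys (A $$ (a, b)). mono_deg m + d ! a = d' ! b)"

lemma gcomp_carrier [simp]: "gcomp d e w \<in> carrier_vec (length d)" "dim_vec (gcomp d e w) = length d"
  by (simp_all add: gcomp_def)

lemma lookup_gcomp:
  "b < length d \<Longrightarrow>
     Poly_Mapping.lookup (gcomp d e w $ b) m = (Poly_Mapping.lookup (w $ b) m when mono_deg m + d ! b = e)"
  by (auto simp: gcomp_def lookup_hcomp when_def)

lemma hvec_gcomp: "hvec d e (gcomp d e w)"
  by (auto simp: hvec_def in_keys_iff lookup_gcomp)

lemma vec_lookup_eqI:
  assumes "u \<in> carrier_vec k" "v \<in> carrier_vec k"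
    and "\<And>b m. b < k \<Longrightarrow> Poly_Mapping.lookup (u $ b) m = Poly_Mapping.lookup (v $ b) m"
  shows "u = v"
  using assms by (intro eq_vecI poly_mapping_eqI) auto

lemma hvec_iff_gcomp: "w \<in> carrier_vec (length d) \<Longrightarrow> hvec d e w \<longleftrightarrow> gcomp d e w = w"
proof
  assume "w \<in> carrier_vec (length d)" "hvec d e w"
  then show "gcomp d e w = w"
    by (intro vec_lookup_eqI[of _ "length d"])
      (auto simp: hvec_def lookup_gcomp when_def, metis in_keys_iff)
qed (metis hvec_gcomp)

lemma hvec_diff: "hvec d e u \<Longrightarrow> hvec d e v \<Longrightarrow> hvec d e (u - v)"
  unfolding hvec_def using keys_diff by fastforce

lemma hvec_smult:
  assumes "homogeneous s r" "hvec d e u"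
  shows "hvec d (s + e) (r \<cdot>\<^sub>v u)"
  unfolding hvec_def
proof (intro conjI allI impI ballI)
  show "r \<cdot>\<^sub>v u \<in> carrier_vec (length d)" using assms by (auto simp: hvec_def)
  fix b m assume b: "b < length d" "m \<in> Poly_Mapping.keys ((r \<cdot>\<^sub>v u) $ b)"
  then have "m \<in> Poly_Mapping.keys (r * u $ b)" using assms by (auto simp: hvec_def)
  then obtain m1 m2 where "m = m1 + m2" "m1 \<in> Poly_Mapping.keys r" "m2 \<in> Poly_Mapping.keys (u $ b)"
    using keys_mult[of r "u $ b"] by auto
  then show "mono_deg m + d ! b = s + e"
    using assms b(1) by (auto simp: homogeneous_def hvec_def mono_deg_add add.assoc)
qed

text \<open>For nonzero \<open>a\<close> the hypothesis gives \<open>p \<le> q\<close> and makes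
  \<open>a\<close> homogeneous of degree \<open>q - p\<close>; this reconciles the two
  guards.\<close>

lemma hcomp_mult_shift:
  assumes "\<forall>m\<in>Poly_Mapping.keys a. mono_deg m + p = q"
  shows "(if p \<le> e then hcomp (e - p) (a * u) else 0) = a * (if q \<le> e then hcomp (e - q) u else 0)"
proof (cases "a = 0")
  case False
  then obtain m where m: "m \<in> Poly_Mapping.keys a"
    by (auto simp: poly_mapping_eq_iff[of a] fun_eq_iff in_keys_iff)
  have "p \<le> q" using assms m le_add2 by metis
  moreover have "homogeneous (q - p) a"
    using assms by (auto simp: homogeneous_def)
  ultimately show ?thesis by (auto simp: hcomp_mult_homogeneous)
qed simp

lemma gcomp_mult_mat_vec:
  assumes A: "graded_mat d d' A" and u: "u \<in> carrier_vec (length d')"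
  shows "gcomp d e (A *\<^sub>v u) = A *\<^sub>v gcomp d' e u"
proof (rule eq_vecI)
  have Ac: "A \<in> carrier_mat (length d) (length d')" using A by (simp add: graded_mat_def)
  show "dim_vec (gcomp d e (A *\<^sub>v u)) = dim_vec (A *\<^sub>v gcomp d' e u)" using Ac by auto
  fix a assume "a < dim_vec (A *\<^sub>v gcomp d' e u)"
  then have a: "a < length d" using Ac by auto
  have "gcomp d e (A *\<^sub>v u) $ a =
      (\<Sum>b<length d'. if d ! a \<le> e then hcomp (e - d ! a) (A $$ (a, b) * u $ b) else 0)"
    using a by (simp add: gcomp_def index_mult_mat_vec_sum[OF Ac u] hcomp_sum del: index_mult_mat_vec)
  also have "\<dots> = (\<Sum>b<length d'. A $$ (a, b) * (if d' ! b \<le> e then hcomp (e - d' ! b) (u $ b) else 0))"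
    using A a by (intro sum.cong refl hcomp_mult_shift) (auto simp: graded_mat_def)
  also have "\<dots> = (A *\<^sub>v gcomp d' e u) $ a"
    using index_mult_mat_vec_sum[OF Ac, of "gcomp d' e u", OF _ a]
    by (simp del: index_mult_mat_vec) (simp add: gcomp_def)
  finally show "gcomp d e (A *\<^sub>v u) $ a = (A *\<^sub>v gcomp d' e u) $ a" .
qed

subsection \<open>Noetherianity\<close>

text \<open>Induction on \<open>V\<close>. A finite set \<open>T0\<close> that handles the old
  coordinates also handles every \<open>t\<close> whose new coordinate is at least all those in
  \<open>T0\<close>; the remaining \<open>t\<close> fall into finitely many slices with fixed new
  coordinate, each covered by the induction hypothesis.\<close>

lemma dickson:
  fixes T :: "('a \<Rightarrow> nat) set"
  assumes "finite V"
  shows "\<exists>T0. finite T0 \<and> T0 \<subseteq> T \<and> (\<forall>t\<in>T. \<exists>s\<in>T0. \<forall>v\<in>V. s v \<le> t v)"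
  using assms
proof (induction V arbitrary: T rule: finite_induct)
  case empty
  show ?case by (cases "T = {}") (auto intro: exI[of _ "{_}"])
next
  case (insert a V)
  from insert.IH[of T] obtain T0 where T0: "finite T0" "T0 \<subseteq> T" "\<forall>t\<in>T. \<exists>s\<in>T0. \<forall>v\<in>V. s v \<le> t v"
    by blast
  from insert.IH have "\<exists>S. finite S \<and> S \<subseteq> {t\<in>T. t a = c} \<and>
      (\<forall>t\<in>{t\<in>T. t a = c}. \<exists>s\<in>S. \<forall>v\<in>V. s v \<le> t v)" for c by blast
  then have "\<forall>c. \<exists>S. finite S \<and> S \<subseteq> {t\<in>T. t a = c} \<and>
      (\<forall>t\<in>{t\<in>T. t a = c}. \<exists>s\<in>S. \<forall>v\<in>V. s v \<le> t v)" by blast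
  from choice[OF this] obtain S where S: "\<forall>c. finite (S c) \<and> S c \<subseteq> {t\<in>T. t a = c} \<and>
      (\<forall>t\<in>{t\<in>T. t a = c}. \<exists>s\<in>S c. \<forall>v\<in>V. s v \<le> t v)" ..
  have S3: "\<exists>s\<in>S (t a). \<forall>v\<in>V. s v \<le> t v" if "t \<in> T" for t
    using S[rule_format, of "t a"] that by simp
  \<comment> \<open>The sum is a convenient bound for all values at \<open>a\<close> in
    \<open>T0\<close>, also when \<open>T0\<close> is empty.\<close>
  define N where "N = (\<Sum>s\<in>T0. s a)"
  have N: "s a \<le> N" if "s \<in> T0" for s
    unfolding N_def using that T0(1) by (intro member_le_sum) auto
  show ?case
  proof (intro exI conjI ballI)
    show "finite (T0 \<union> (\<Union>c<N. S c))" using T0 S by auto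
    show "T0 \<union> (\<Union>c<N. S c) \<subseteq> T" using T0 S by blast
    fix t assume t: "t \<in> T"
    show "\<exists>s\<in>T0 \<union> (\<Union>c<N. S c). \<forall>v\<in>insert a V. s v \<le> t v"
    proof (cases "t a < N")
      case True
      from S3[OF t] obtain s where "s \<in> S (t a)" "\<forall>v\<in>V. s v \<le> t v" by blast
      moreover have "s a = t a" using \<open>s \<in> S (t a)\<close> S by blast
      ultimately show ?thesis using True by (intro bexI[of _ s]) auto
    next
      case False
      from T0(3) t obtain s where "s \<in> T0" "\<forall>v\<in>V. s v \<le> t v" by blast
      then show ?thesis using N[of s] False by (intro bexI[of _ s]) auto
    qed
  qed
qed

text \<open>An additive injection into linearly ordered exponents pulls back a term order:
  comparison of keys is invariant under multiplication by a monomial.\<close>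

lemma monomial_key:
  obtains key :: "('v :: finite \<Rightarrow>\<^sub>0 nat) \<Rightarrow> (nat \<Rightarrow>\<^sub>0 nat)"
  where "inj key" "\<And>a b. key (a + b) = key a + key b"
proof -
  obtain b :: "'v \<Rightarrow> nat" where b: "inj b"
    using finite_imp_inj_to_nat_seg[of "UNIV :: 'v set"] by auto
  define key where "key m = (\<Sum>v\<in>UNIV. Poly_Mapping.single (b v) (Poly_Mapping.lookup m v))" for m :: "'v \<Rightarrow>\<^sub>0 nat"
  have "Poly_Mapping.lookup (key m) (b v) = Poly_Mapping.lookup m v" for m v
    using b by (simp add: key_def lookup_sum lookup_single when_def inj_eq)
  then have "inj key" by (metis injI poly_mapping_eqI)
  moreover have "key (x + y) = key x + key y" for x y
    by (simp add: key_def lookup_add single_add sum.distrib)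
  ultimately show thesis using that by blast
qed

text \<open>Position-over-term leading term: the last nonzero position decides first, the key only
  within it.\<close>

definition lead_term ::
  "(('v \<Rightarrow>\<^sub>0 nat) \<Rightarrow> 'o :: linorder) \<Rightarrow> nat \<Rightarrow> ('v, 'k :: comm_ring_1) mpoly vec \<Rightarrow> nat \<Rightarrow> ('v \<Rightarrow>\<^sub>0 nat) \<Rightarrow> bool"
where
  "lead_term key k w b m \<longleftrightarrow> b < k \<and> m \<in> Poly_Mapping.keys (w $ b) \<and>
     (\<forall>b'. b < b' \<and> b' < k \<longrightarrow> w $ b' = 0) \<and> (\<forall>m'\<in>Poly_Mapping.keys (w $ b). key m' \<le> key m)"

lemma ex_lead_term:
  assumes w: "w \<in> carrier_vec k" "w \<noteq> 0\<^sub>v k"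
  shows "\<exists>b m. lead_term key k w b m"
proof -
  let ?B = "{b. b < k \<and> w $ b \<noteq> 0}"
  have "?B \<noteq> {}" using w by (auto simp: vec_eq_iff)
  define b where "b = Max ?B"
  have b: "b \<in> ?B"
    unfolding b_def using \<open>?B \<noteq> {}\<close> by (intro Max_in) simp_all
  have max: "b' \<le> b" if "b' \<in> ?B" for b'
    unfolding b_def using that by (intro Max_ge) simp_all
  let ?K = "Poly_Mapping.keys (w $ b)"
  have "?K \<noteq> {}"
    using b by (auto simp: poly_mapping_eq_iff[of "w $ b"] fun_eq_iff in_keys_iff)
  then have "Max (key ` ?K) \<in> key ` ?K" by (intro Max_in) auto
  then obtain m where m: "m \<in> ?K" "key m = Max (key ` ?K)" by auto
  have "key m' \<le> key m" if "m' \<in> ?K" for m'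
    unfolding m(2) using that by simp
  then show ?thesis
    using b m(1) max unfolding lead_term_def by (intro exI[of _ b] exI[of _ m]) (auto simp: not_less[symmetric])
qed

text \<open>One division step: a monomial multiple of \<open>g\<close> cancels the leading term of
  \<open>w\<close>. The multiplier has degree \<open>e - e0\<close>, so the remainder stays
  homogeneous of degree \<open>e\<close>.\<close>

lemma lead_term_reduce:
  fixes w g :: "('v :: finite, 'k :: field) mpoly vec"
    and key :: "('v \<Rightarrow>\<^sub>0 nat) \<Rightarrow> (nat \<Rightarrow>\<^sub>0 nat)"
  assumes key: "inj key" "\<And>a b. key (a + b) = key a + key b"
    and w: "hvec d e w" "lead_term key (length d) w b m"
    and g: "hvec d e0 g" "lead_term key (length d) g b m0"
    and m: "m = t + m0"
  obtains c where "hvec d e (w - Poly_Mapping.single t c \<cdot>\<^sub>v g)"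
    and "\<And>b1 m1. lead_term key (length d) (w - Poly_Mapping.single t c \<cdot>\<^sub>v g) b1 m1 \<Longrightarrow>
           b1 < b \<or> b1 = b \<and> key m1 < key m"
proof -
  define c where "c = Poly_Mapping.lookup (w $ b) m / Poly_Mapping.lookup (g $ b) m0"
  define w' where "w' = w - Poly_Mapping.single t c \<cdot>\<^sub>v g"
  have b: "b < length d" and dim: "dim_vec w = length d" "dim_vec g = length d"
    using w g by (auto simp: lead_term_def hvec_def)
  have deg: "mono_deg m + d ! b = e" "mono_deg m0 + d ! b = e0"
    using w g by (auto simp: lead_term_def hvec_def)
  then have "e = mono_deg t + e0" using m by (simp add: mono_deg_add)
  moreover have "homogeneous (mono_deg t) (Poly_Mapping.single t c)"
    by (simp add: homogeneous_def)
  ultimately have hom: "hvec d e w'"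
    unfolding w'_def using hvec_diff[OF w(1)] hvec_smult[OF _ g(1)] by metis
  have ent: "w' $ b' = w $ b' - Poly_Mapping.single t c * g $ b'" if "b' < length d" for b'
    using that dim by (simp add: w'_def)
  have "b1 < b \<or> b1 = b \<and> key m1 < key m" if l: "lead_term key (length d) w' b1 m1" for b1 m1
  proof -
    have b1: "b1 < length d" "m1 \<in> Poly_Mapping.keys (w' $ b1)"
      using l by (auto simp: lead_term_def)
    have "\<not> b < b1"
    proof
      assume "b < b1"
      then have "w $ b1 = 0" "g $ b1 = 0" using b1 w(2) g(2) by (auto simp: lead_term_def)
      then show False using b1 ent[of b1] by simp
    qed
    moreover have "key m1 < key m" if "b1 = b"
    proof -
      have "m1 \<noteq> m"
      proof
        assume "m1 = m"
        have "Poly_Mapping.lookup (g $ b) m0 \<noteq> 0"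
          using g(2) by (simp add: lead_term_def in_keys_iff)
        then have "Poly_Mapping.lookup (w' $ b) m = 0"
          unfolding ent[OF b] by (simp add: lookup_minus m lookup_single_mult c_def)
        then show False using b1 that \<open>m1 = m\<close> by (simp add: in_keys_iff)
      qed
      moreover have "key m1 \<le> key m"
      proof -
        have "m1 \<in> Poly_Mapping.keys (w $ b) \<or> m1 \<in> Poly_Mapping.keys (Poly_Mapping.single t c * g $ b)"
          using b1(2) ent[OF b] that keys_diff[of "w $ b" "Poly_Mapping.single t c * g $ b"] by auto
        then show ?thesis
        proof
          assume "m1 \<in> Poly_Mapping.keys (Poly_Mapping.single t c * g $ b)"
          then obtain m2 where "m2 \<in> Poly_Mapping.keys (g $ b)" "m1 = t + m2"
            using keys_mult[of "Poly_Mapping.single t c" "g $ b"] by (auto split: if_splits)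
          then show ?thesis using g(2) by (simp add: m key lead_term_def add_left_mono)
        qed (use w(2) in \<open>auto simp: lead_term_def\<close>)
      qed
      ultimately show ?thesis using key(1) by (simp add: inj_eq order_less_le)
    qed
    ultimately show ?thesis by force
  qed
  with hom that show thesis unfolding w'_def by blast
qed

text \<open>Induction on the number of nonzero graded components: one component is subtracted at
  each step, and it lies in \<open>N\<close> by hypothesis.\<close>

lemma submod_generated_by_homogeneous:
  fixes M :: "('v :: finite, 'k :: comm_ring_1) mpoly vec set"
  assumes M: "\<And>w e. w \<in> M \<Longrightarrow> gcomp d e w \<in> M" "submod (length d) M"
    and N: "submod (length d) N" "\<And>w e. w \<in> M \<Longrightarrow> hvec d e w \<Longrightarrow> w \<in> N"
  shows "M \<subseteq> N"
proof
  fix w assume "w \<in> M"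
  let ?D = "\<lambda>w. {e. gcomp d e w \<noteq> 0\<^sub>v (length d)}"
  have fin: "finite (?D w)" for w :: "('v, 'k) mpoly vec"
  proof (rule finite_subset)
    show "?D w \<subseteq> (\<Union>b<length d. (\<lambda>m. mono_deg m + d ! b) ` Poly_Mapping.keys (w $ b))"
    proof
      fix e assume "e \<in> ?D w"
      then obtain b where b: "b < length d" "gcomp d e w $ b \<noteq> 0"
        by (auto simp: vec_eq_iff)
      then obtain m where "Poly_Mapping.lookup (gcomp d e w $ b) m \<noteq> 0"
        by (auto simp: poly_mapping_eq_iff fun_eq_iff)
      then have "m \<in> Poly_Mapping.keys (w $ b)" "e = mono_deg m + d ! b"
        using b by (auto simp: lookup_gcomp when_def in_keys_iff split: if_splits)
      then show "e \<in> (\<Union>b<length d. (\<lambda>m. mono_deg m + d ! b) ` Poly_Mapping.keys (w $ b))"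
        using b(1) by blast
    qed
  qed auto
  show "w \<in> N"
    using \<open>w \<in> M\<close>
  proof (induction "card (?D w)" arbitrary: w rule: less_induct)
    case less
    have w: "w \<in> carrier_vec (length d)" using less.prems submodD(1)[OF M(2)] by simp
    show ?case
    proof (cases "?D w = {}")
      case True
      have "w = 0\<^sub>v (length d)"
      proof (rule vec_lookup_eqI[OF w])
        fix b and m :: "'v \<Rightarrow>\<^sub>0 nat" assume b: "b < length d"
        have "gcomp d (mono_deg m + d ! b) w = 0\<^sub>v (length d)" using True by auto
        then have "Poly_Mapping.lookup (gcomp d (mono_deg m + d ! b) w $ b) m = 0"
          using b by simp
        then show "Poly_Mapping.lookup (w $ b) m = Poly_Mapping.lookup (0\<^sub>v (length d) $ b) m"
          using b by (simp add: lookup_gcomp)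
      qed simp
      then show ?thesis using submodD(2)[OF N(1)] by simp
    next
      case False
      then obtain e where e: "e \<in> ?D w" by auto
      let ?w = "w - gcomp d e w"
      have "gcomp d e' ?w = (if e' = e then 0\<^sub>v (length d) else gcomp d e' w)" for e'
        using w by (intro vec_lookup_eqI[of _ "length d"])
          (auto simp: lookup_gcomp lookup_minus when_def)
      then have "?D ?w = ?D w - {e}" by auto
      then have "card (?D ?w) < card (?D w)" using e fin[of w] by (metis card_Diff1_less)
      moreover have "?w \<in> M" using less.prems M submodD(5)[OF M(2)] by simp
      ultimately have "?w \<in> N" using less.hyps by blast
      moreover have "gcomp d e w \<in> N" using N(2) M(1) less.prems hvec_gcomp by blast
      ultimately have "?w + gcomp d e w \<in> N" using submodD(3)[OF N(1)] by blast
      also have "?w + gcomp d e w = w" using w by (intro eq_vecI) auto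
      finally show ?thesis .
    qed
  qed
qed

text \<open>Hilbert's basis theorem by leading terms. Dickson's lemma gives, for each position,
  finitely many leading monomials of homogeneous elements of \<open>M\<close> that divide all
  others, and \<open>G\<close> consists of elements realising them. Division by \<open>G\<close>
  puts every homogeneous element into any submodule containing \<open>G\<close>.\<close>

lemma graded_submod_finitely_generated:
  fixes M :: "('v :: finite, 'k :: field) mpoly vec set"
  assumes M: "submod (length d) M" "\<And>w e. w \<in> M \<Longrightarrow> gcomp d e w \<in> M"
  shows "\<exists>G. finite G \<and> G \<subseteq> {w \<in> M. \<exists>e. hvec d e w} \<and>
           (\<forall>N. submod (length d) N \<and> G \<subseteq> N \<longrightarrow> M \<subseteq> N)"
proof -
  obtain key :: "('v \<Rightarrow>\<^sub>0 nat) \<Rightarrow> (nat \<Rightarrow>\<^sub>0 nat)" where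
    key: "inj key" "\<And>a b. key (a + b) = key a + key b"
    using monomial_key by blast
  let ?k = "length d"
  let ?L = "\<lambda>b. {m. \<exists>w\<in>M. (\<exists>e. hvec d e w) \<and> lead_term key ?k w b m}"
  define P where "P b T0 \<longleftrightarrow> finite T0 \<and> T0 \<subseteq> ?L b \<and> (\<forall>m\<in>?L b. \<exists>m0\<in>T0. \<exists>t. m = t + m0)" for b T0
  have "\<exists>T0. P b T0" for b
  proof -
    from dickson[of UNIV "Poly_Mapping.lookup ` ?L b"] obtain S where
      S: "finite S" "S \<subseteq> Poly_Mapping.lookup ` ?L b"
        "\<forall>t\<in>Poly_Mapping.lookup ` ?L b. \<exists>s\<in>S. \<forall>v. s v \<le> t v" by auto
    from finite_subset_image[OF S(1,2)] obtain T0 where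
      T0: "T0 \<subseteq> ?L b" "finite T0" "S = Poly_Mapping.lookup ` T0" by blast
    have "\<exists>m0\<in>T0. \<exists>t. m = t + m0" if "m \<in> ?L b" for m
    proof -
      from S(3) that T0(3) obtain m0 where m0: "m0 \<in> T0"
        "\<And>v. Poly_Mapping.lookup m0 v \<le> Poly_Mapping.lookup m v" by blast
      have "m = (m - m0) + m0"
        by (rule poly_mapping_eqI) (simp add: lookup_add lookup_minus m0)
      then show ?thesis using m0(1) by blast
    qed
    with T0(1,2) have "P b T0" unfolding P_def by simp
    then show ?thesis ..
  qed
  then obtain T where "\<And>b. P b (T b)" by metis
  then have T: "finite (T b)" "T b \<subseteq> ?L b" "m \<in> ?L b \<Longrightarrow> \<exists>m0\<in>T b. \<exists>t. m = t + m0" for b m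
    unfolding P_def by simp_all
  define Q where "Q x w \<longleftrightarrow> w \<in> M \<and> (\<exists>e. hvec d e w) \<and> lead_term key ?k w (fst x) (snd x)" for x w
  have "\<exists>w. Q x w" if "x \<in> Sigma {..<?k} T" for x
  proof -
    have "snd x \<in> T (fst x)" using that by auto
    then have "snd x \<in> ?L (fst x)" using T(2) by blast
    then show ?thesis unfolding Q_def by blast
  qed
  then obtain g where "\<And>x. x \<in> Sigma {..<?k} T \<Longrightarrow> Q x (g x)" by metis
  then have g: "g x \<in> M" "\<exists>e. hvec d e (g x)" "lead_term key ?k (g x) (fst x) (snd x)"
    if "x \<in> Sigma {..<?k} T" for x
    using that unfolding Q_def by simp_all
  let ?G = "g ` Sigma {..<?k} T"
  have "M \<subseteq> N" if N: "submod ?k N" "?G \<subseteq> N" for N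
  proof (rule submod_generated_by_homogeneous[OF M(2,1) N(1)])
    fix w e assume w: "w \<in> M" "hvec d e w"
    \<comment> \<open>Termination measure: the possible leading terms in degree \<open>e\<close>
      below \<open>(b, m)\<close>. Homogeneity keeps the remainder in degree \<open>e\<close>, where
      there are only finitely many.\<close>
    define Low where "Low b m = {x \<in> Sigma {..<?k} (\<lambda>b'. {m'. mono_deg m' + d ! b' = e}).
        fst x < b \<or> fst x = b \<and> key (snd x) < key m}" for b m
    have fin: "finite (Low b m)" for b m
    proof (rule finite_subset)
      show "Low b m \<subseteq> Sigma {..<?k} (\<lambda>b'. {m'. mono_deg m' = e - d ! b'})"
        unfolding Low_def by auto
    qed (auto intro: finite_mono_deg)
    have "lead_term key ?k w b m \<Longrightarrow> w \<in> N" for b m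
      using w
    proof (induction "card (Low b m)" arbitrary: w b m rule: less_induct)
      case less
      have b: "b < ?k" using less.prems by (simp add: lead_term_def)
      have "m \<in> ?L b" using less.prems by auto
      then obtain m0 t where m0: "m0 \<in> T b" "m = t + m0" using T(3) by blast
      have x: "(b, m0) \<in> Sigma {..<?k} T" using m0 b by auto
      then obtain e0 where gx: "g (b, m0) \<in> M" "hvec d e0 (g (b, m0))" "lead_term key ?k (g (b, m0)) b m0"
        using g[OF x] by auto
      from lead_term_reduce[OF key less.prems(3,1) gx(2,3) m0(2)] obtain c where
        c: "hvec d e (w - Poly_Mapping.single t c \<cdot>\<^sub>v g (b, m0))"
          "\<And>b1 m1. lead_term key ?k (w - Poly_Mapping.single t c \<cdot>\<^sub>v g (b, m0)) b1 m1 \<Longrightarrow>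
             b1 < b \<or> b1 = b \<and> key m1 < key m" by blast
      let ?w' = "w - Poly_Mapping.single t c \<cdot>\<^sub>v g (b, m0)"
      have w'M: "?w' \<in> M"
        using less.prems gx submodD(4,5)[OF M(1)] by blast
      then have car: "?w' \<in> carrier_vec ?k" using submodD(1)[OF M(1)] by blast
      have "?w' \<in> N"
      proof (cases "?w' = 0\<^sub>v ?k")
        case True
        then show ?thesis using submodD(2)[OF N(1)] by metis
      next
        case False
        then obtain b1 m1 where l: "lead_term key ?k ?w' b1 m1" using ex_lead_term[OF car] by blast
        have lt: "b1 < b \<or> b1 = b \<and> key m1 < key m" using c(2)[OF l] .
        have "Low b1 m1 \<subseteq> Low b m" using lt unfolding Low_def by auto
        moreover have "(b1, m1) \<in> Low b m" "(b1, m1) \<notin> Low b1 m1"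
          using lt l c(1) unfolding Low_def by (auto simp: hvec_def lead_term_def)
        ultimately have "card (Low b1 m1) < card (Low b m)"
          by (intro psubset_card_mono fin) auto
        from less.hyps[OF this l w'M c(1)] show ?thesis .
      qed
      moreover have "Poly_Mapping.single t c \<cdot>\<^sub>v g (b, m0) \<in> N"
        using N(2) x submodD(4)[OF N(1)] by blast
      ultimately have "?w' + Poly_Mapping.single t c \<cdot>\<^sub>v g (b, m0) \<in> N"
        using submodD(3)[OF N(1)] by blast
      also have "?w' + Poly_Mapping.single t c \<cdot>\<^sub>v g (b, m0) = w"
        using submodD(1)[OF M(1) less.prems(2)] submodD(1)[OF M(1) gx(1)] by (intro eq_vecI) auto
      finally show ?case .
    qed
    moreover have "w \<in> carrier_vec ?k" using w submodD(1)[OF M(1)] by blast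
    ultimately show "w \<in> N" using ex_lead_term[of w ?k key] submodD(2)[OF N(1)] by metis
  qed
  moreover have "finite ?G" using T(1) by (intro finite_imageI finite_SigmaI) auto
  moreover have "?G \<subseteq> {w \<in> M. \<exists>e. hvec d e w}" using g(1,2) by auto
  ultimately show ?thesis by (intro exI[of _ ?G]) simp
qed

section \<open>Minimal graded free resolutions\<close>

lemma mult_mat_vec_unit:
  fixes A :: "'a :: comm_ring_1 mat"
  assumes "A \<in> carrier_mat k l" "j < l"
  shows "A *\<^sub>v unit_vec l j = col A j"
  using assms by (intro eq_vecI) auto

text \<open>Minimality is obtained from a homogeneous generating list of least length: a kernel
  vector with a constant term in some entry would write one generator through the others. This is
  graded Nakayama in elementary form.\<close>

lemma minimal_graded_cover:
  fixes M :: "('v :: finite, 'k :: field) mpoly vec set"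
  assumes M: "submod (length d) M" "\<And>w e. w \<in> M \<Longrightarrow> gcomp d e w \<in> M"
  obtains d' A where "graded_mat d d' A" "{A *\<^sub>v u | u. u \<in> carrier_vec (length d')} = M"
    "\<And>u b. u \<in> mat_kernel A \<Longrightarrow> b < length d' \<Longrightarrow> Poly_Mapping.lookup (u $ b) 0 = 0"
proof -
  let ?k = "length d"
  \<comment> \<open>A degree is stored with each vector, since a zero vector does not determine
    one.\<close>
  define good where "good gl \<longleftrightarrow> (\<forall>p\<in>set gl. snd p \<in> M \<and> hvec d (fst p) (snd p)) \<and>
     (\<forall>N. submod ?k N \<longrightarrow> (\<forall>p\<in>set gl. snd p \<in> N) \<longrightarrow> M \<subseteq> N)" for gl :: "(nat \<times> ('v, 'k) mpoly vec) list"
  have "\<exists>gl. good gl"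
  proof -
    obtain G where G: "finite G" "G \<subseteq> {w \<in> M. \<exists>e. hvec d e w}"
      "\<forall>N. submod ?k N \<and> G \<subseteq> N \<longrightarrow> M \<subseteq> N"
      using graded_submod_finitely_generated[OF M] by blast
    obtain gs where gs: "set gs = G" using finite_list[OF G(1)] by blast
    have "good (map (\<lambda>g. (SOME e. hvec d e g, g)) gs)"
      using G(2,3) unfolding good_def gs[symmetric]
      by (auto intro: someI_ex)
    then show ?thesis by blast
  qed
  then obtain gl where gl: "good gl" and min: "\<And>gl'. good gl' \<Longrightarrow> length gl \<le> length gl'"
    using ex_has_least_nat[of good _ length] by blast
  let ?l = "length gl"
  define d' where "d' = map fst gl"
  define A where "A = mat_of_cols ?k (map snd gl)"
  have len: "length d' = ?l" by (simp add: d'_def)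
  have car: "A \<in> carrier_mat ?k ?l"
    unfolding A_def by (metis length_map mat_of_cols_carrier(1))
  have glj: "snd (gl ! j) \<in> M" "hvec d (fst (gl ! j)) (snd (gl ! j))" if "j < ?l" for j
    using gl that unfolding good_def by auto
  have colA: "col A j = snd (gl ! j)" if "j < ?l" for j
    using that glj[OF that] by (auto simp: A_def hvec_def)
  have gr: "graded_mat d d' A"
    unfolding graded_mat_def
  proof (intro conjI allI impI ballI)
    show "A \<in> carrier_mat ?k (length d')" using car len by simp
    fix a b m assume *: "a < ?k" "b < length d'" "m \<in> Poly_Mapping.keys (A $$ (a, b))"
    then have "A $$ (a, b) = snd (gl ! b) $ a" using len by (simp add: A_def mat_of_cols_index)
    then show "mono_deg m + d ! a = d' ! b"
      using * len glj[of b] by (simp add: hvec_def d'_def)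
  qed
  have im: "{A *\<^sub>v u | u. u \<in> carrier_vec ?l} = M"
  proof
    have "A *\<^sub>v u \<in> M" if u: "u \<in> carrier_vec ?l" for u
      by (rule mult_mat_vec_in_submod[OF car u M(1)]) (simp add: colA glj(1) submodD(4)[OF M(1)])
    then show "{A *\<^sub>v u | u. u \<in> carrier_vec ?l} \<subseteq> M" by blast
    have "snd (gl ! j) \<in> {A *\<^sub>v u | u. u \<in> carrier_vec ?l}" if "j < ?l" for j
    proof -
      have "snd (gl ! j) = A *\<^sub>v unit_vec ?l j"
        using mult_mat_vec_unit[OF car that] colA[OF that] by simp
      then show ?thesis using unit_vec_carrier by blast
    qed
    then have "\<forall>p\<in>set gl. snd p \<in> {A *\<^sub>v u | u. u \<in> carrier_vec ?l}"
      unfolding all_set_conv_all_nth by blast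
    then show "M \<subseteq> {A *\<^sub>v u | u. u \<in> carrier_vec ?l}"
      using gl submod_image[OF car] unfolding good_def by blast
  qed
  have ker: "Poly_Mapping.lookup (u $ b) 0 = 0" if u: "u \<in> mat_kernel A" and b: "b < ?l" for u b
  proof (rule ccontr)
    define c where "c = Poly_Mapping.lookup (u $ b) 0"
    assume "Poly_Mapping.lookup (u $ b) 0 \<noteq> 0"
    then have c: "c \<noteq> 0" by (simp add: c_def)
    have uc: "u \<in> carrier_vec ?l" "A *\<^sub>v u = 0\<^sub>v ?k"
      using u car by (auto simp: mat_kernel_def)
    \<comment> \<open>The component in degree \<open>d' ! b\<close> is again a relation, and its
      entry \<open>b\<close> is exactly the constant \<open>c\<close>, which is invertible.\<close>
    define u1 where "u1 = gcomp d' (d' ! b) u"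
    have u1: "u1 \<in> carrier_vec ?l" by (simp add: u1_def len[symmetric])
    have "A *\<^sub>v u1 = gcomp d (d' ! b) (A *\<^sub>v u)"
      unfolding u1_def using gcomp_mult_mat_vec[OF gr] uc(1) len by simp
    also have "\<dots> = 0\<^sub>v ?k" unfolding uc(2) by (intro eq_vecI) (auto simp: gcomp_def)
    finally have Au1: "A *\<^sub>v u1 = 0\<^sub>v ?k" .
    have "u1 $ b = hcomp 0 (u $ b)" using b len by (simp add: u1_def gcomp_def)
    also have "\<dots> = Poly_Mapping.single 0 c"
      using homogeneous_hcomp[of 0 "u $ b"] unfolding homogeneous_zero_iff
      by (simp add: lookup_hcomp c_def)
    finally have u1b: "u1 $ b = Poly_Mapping.single 0 c" .
    \<comment> \<open>After scaling, the relation has entry \<open>1\<close> at \<open>b\<close>;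
      \<open>v\<close> holds its other coefficients, so column \<open>b\<close> equals minus
      \<open>A\<close> applied to \<open>v\<close>.\<close>
    define v where "v = Poly_Mapping.single 0 (inverse c) \<cdot>\<^sub>v u1 - unit_vec ?l b"
    have v: "v \<in> carrier_vec ?l" using u1 by (simp add: v_def)
    have vb: "v $ b = 0" using b u1 u1b c by (simp add: v_def mult_single)
    have "A *\<^sub>v v + A *\<^sub>v unit_vec ?l b = A *\<^sub>v (v + unit_vec ?l b)"
      using mult_add_distrib_mat_vec[OF car v] by simp
    also have "v + unit_vec ?l b = Poly_Mapping.single 0 (inverse c) \<cdot>\<^sub>v u1"
      using u1 by (intro eq_vecI) (auto simp: v_def)
    also have "A *\<^sub>v \<dots> = 0\<^sub>v ?k"
      using mult_mat_vec_smult[OF car u1] Au1 by auto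
    finally have sum0: "A *\<^sub>v v + col A b = 0\<^sub>v ?k" using mult_mat_vec_unit[OF car b] by simp
    \<comment> \<open>Dropping generator \<open>b\<close> leaves a generating list, against the
      least length.\<close>
    define gl' where "gl' = take b gl @ drop (Suc b) gl"
    have mem: "gl ! j \<in> set gl'" if "j < ?l" "j \<noteq> b" for j
    proof (cases "j < b")
      case True
      then have "gl ! j = take b gl ! j" "j < length (take b gl)" using that by auto
      then show ?thesis unfolding gl'_def by (metis Un_iff nth_mem set_append)
    next
      case False
      then have "gl ! j = drop (Suc b) gl ! (j - Suc b)" "j - Suc b < length (drop (Suc b) gl)"
        using that by auto
      then show ?thesis unfolding gl'_def by (metis Un_iff nth_mem set_append)
    qed
    have "good gl'"
      unfolding good_def
    proof (intro conjI allI impI)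
      have "set gl' \<subseteq> set gl"
        unfolding gl'_def using set_take_subset[of b gl] set_drop_subset[of "Suc b" gl] by simp
      then show "\<forall>p\<in>set gl'. snd p \<in> M \<and> hvec d (fst p) (snd p)"
        using gl unfolding good_def by blast
      fix N assume N: "submod ?k N" "\<forall>p\<in>set gl'. snd p \<in> N"
      have colN: "col A j \<in> N" if "j < ?l" "j \<noteq> b" for j
        using N(2) mem[OF that] colA[OF that(1)] by simp
      have "A *\<^sub>v v \<in> N"
      proof (rule mult_mat_vec_in_submod[OF car v N(1)])
        fix j assume j: "j < ?l"
        show "v $ j \<cdot>\<^sub>v col A j \<in> N"
        proof (cases "j = b")
          case True
          have "v $ j \<cdot>\<^sub>v col A j = 0\<^sub>v ?k" using True vb car by (intro eq_vecI) auto
          then show ?thesis using submodD(2)[OF N(1)] by simp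
        qed (use colN[OF j] submodD(4)[OF N(1)] in blast)
      qed
      then have "(-1) \<cdot>\<^sub>v (A *\<^sub>v v) \<in> N" by (rule submodD(4)[OF N(1)])
      also have "(-1) \<cdot>\<^sub>v (A *\<^sub>v v) = col A b"
      proof (rule eq_vecI)
        fix i assume "i < dim_vec (col A b)"
        then have i: "i < ?k" using car by simp
        then have "(A *\<^sub>v v + col A b) $ i = 0" using sum0 by simp
        then show "((-1) \<cdot>\<^sub>v (A *\<^sub>v v)) $ i = col A b $ i"
          using i car by (simp add: add_eq_0_iff2)
      qed (use car in simp)
      finally have "col A b \<in> N" .
      then have "\<forall>j<?l. snd (gl ! j) \<in> N" using colN colA by metis
      then have "\<forall>p\<in>set gl. snd p \<in> N" by (metis in_set_conv_nth)
      then show "M \<subseteq> N" using gl N(1) unfolding good_def by blast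
    qed
    from min[OF this] show False using b by (simp add: gl'_def)
  qed
  show thesis
    using that[of d' A] gr im ker unfolding len by blast
qed

lemma gcomp_kernel:
  assumes A: "graded_mat d d' A" and u: "u \<in> mat_kernel A"
  shows "gcomp d' e u \<in> mat_kernel A"
proof -
  have "A \<in> carrier_mat (length d) (length d')" using A by (simp add: graded_mat_def)
  moreover have "gcomp d e (0\<^sub>v (length d)) = 0\<^sub>v (length d)"
    by (intro eq_vecI) (auto simp: gcomp_def)
  ultimately show ?thesis
    using gcomp_mult_mat_vec[OF A, of u e, symmetric] u by (simp add: mat_kernel_def)
qed

text \<open>Covers of successive kernels are spliced together. The columns of each matrix lie in the
  kernel of the preceding one, so the absence of constant terms in kernel vectors is exactly the
  minimality of the next matrix; for the first matrix it comes from the hypothesis on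
  \<open>I\<close>.\<close>

lemma minimal_graded_free_resolution_exists:
  fixes I :: "('v :: finite, 'k :: field) mpoly set"
  assumes I: "is_ideal I" "\<And>f e. f \<in> I \<Longrightarrow> hcomp e f \<in> I" "\<And>f. f \<in> I \<Longrightarrow> Poly_Mapping.lookup f 0 = 0"
  shows "\<exists>d A. minimal_graded_free_resolution I d A"
proof -
  define P where "P n x \<longleftrightarrow> (case x of (d, A, d') \<Rightarrow> graded_mat d d' A \<and>
      (\<forall>a<length d. \<forall>b<length d'. Poly_Mapping.lookup (A $$ (a, b)) 0 = 0) \<and>
      (\<forall>u\<in>mat_kernel A. \<forall>b<length d'. Poly_Mapping.lookup (u $ b) 0 = 0) \<and>
      (n = 0 \<longrightarrow> d = [0] \<and> {(A *\<^sub>v w) $ 0 | w. w \<in> carrier_vec (length d')} = I))"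
    for n :: nat and x :: "nat list \<times> ('v, 'k) mpoly mat \<times> nat list"
  define Q where "Q n x y \<longleftrightarrow> (case (x, y) of ((d, A, d'), (e, B, e')) \<Rightarrow> e = d' \<and>
      mat_kernel A = {B *\<^sub>v w | w. w \<in> carrier_vec (length e')})"
    for n :: nat and x y :: "nat list \<times> ('v, 'k) mpoly mat \<times> nat list"
  have entries: "Poly_Mapping.lookup (A $$ (a, b)) 0 = 0"
    if A: "graded_mat d d' A" and im: "{A *\<^sub>v u | u. u \<in> carrier_vec (length d')} = M"
      and M: "\<And>u b. u \<in> M \<Longrightarrow> b < length d \<Longrightarrow> Poly_Mapping.lookup (u $ b) 0 = 0"
      and ab: "a < length d" "b < length d'" for d d' M and A :: "('v, 'k) mpoly mat" and a b
  proof -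
    have car: "A \<in> carrier_mat (length d) (length d')" using A by (simp add: graded_mat_def)
    have "A *\<^sub>v unit_vec (length d') b \<in> M" using im by auto
    from M[OF this ab(1)] show ?thesis
      unfolding mult_mat_vec_unit[OF car ab(2)] using car ab by simp
  qed
  have "\<exists>f. \<forall>n. P n (f n) \<and> Q n (f n) (f (Suc n))"
  proof (rule dependent_nat_choice)
    let ?M = "{vec 1 (\<lambda>_. f) | f. f \<in> I}"
    have M1: "submod (length [0 :: nat]) ?M"
      unfolding submod_def
    proof (intro conjI ballI allI)
      show "0\<^sub>v (length [0 :: nat]) \<in> ?M"
        using is_idealD(1)[OF I(1)] by (auto intro!: exI[of _ 0])
    next
      fix u v assume "u \<in> ?M" "v \<in> ?M"
      then obtain f g where "u = vec 1 (\<lambda>_. f)" "v = vec 1 (\<lambda>_. g)" "f \<in> I" "g \<in> I" by auto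
      then show "u + v \<in> ?M" using is_idealD(2)[OF I(1)] by (auto intro!: exI[of _ "f + g"])
    next
      fix u r assume "u \<in> ?M"
      then obtain f where "u = vec 1 (\<lambda>_. f)" "f \<in> I" by auto
      then show "r \<cdot>\<^sub>v u \<in> ?M" using is_idealD(3)[OF I(1)] by (auto intro!: exI[of _ "r * f"])
    qed auto
    have M2: "gcomp [0] e w \<in> ?M" if "w \<in> ?M" for w e
    proof -
      obtain f where f: "w = vec 1 (\<lambda>_. f)" "f \<in> I" using \<open>w \<in> ?M\<close> by auto
      then have "gcomp [0] e w = vec 1 (\<lambda>_. hcomp e f)" by (auto simp: gcomp_def)
      then show ?thesis using I(2)[OF f(2), of e] by auto
    qed
    obtain d' A where A: "graded_mat [0] d' A" "{A *\<^sub>v u | u. u \<in> carrier_vec (length d')} = ?M"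
      "\<And>u b. u \<in> mat_kernel A \<Longrightarrow> b < length d' \<Longrightarrow> Poly_Mapping.lookup (u $ b) 0 = 0"
      by (rule minimal_graded_cover[OF M1], erule M2, rule that)
    have "Poly_Mapping.lookup (A $$ (a, b)) 0 = 0" if "a < length [0 :: nat]" "b < length d'" for a b
      using that by (intro entries[OF A(1,2)]) (auto simp: I(3))
    moreover have "{(A *\<^sub>v w) $ 0 | w. w \<in> carrier_vec (length d')} = (\<lambda>u. u $ 0) ` ?M"
      unfolding A(2)[symmetric] by auto
    moreover have "(\<lambda>u. u $ 0) ` ?M = I" by force
    ultimately show "\<exists>x. P 0 x"
      using A(1,3) unfolding P_def by (intro exI[of _ "([0], A, d')"]) auto
  next
    fix x n assume "P n x"
    obtain d A d' where x: "x = (d, A, d')" by (cases x)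
    have A: "graded_mat d d' A" "\<And>u b. u \<in> mat_kernel A \<Longrightarrow> b < length d' \<Longrightarrow> Poly_Mapping.lookup (u $ b) 0 = 0"
      using \<open>P n x\<close> unfolding x P_def by auto
    have car: "A \<in> carrier_mat (length d) (length d')" using A by (simp add: graded_mat_def)
    obtain e B where B: "graded_mat d' e B" "{B *\<^sub>v u | u. u \<in> carrier_vec (length e)} = mat_kernel A"
      "\<And>u b. u \<in> mat_kernel B \<Longrightarrow> b < length e \<Longrightarrow> Poly_Mapping.lookup (u $ b) 0 = 0"
      by (rule minimal_graded_cover[OF submod_kernel[OF car]], erule gcomp_kernel[OF A(1)], rule that)
    have "Poly_Mapping.lookup (B $$ (a, b)) 0 = 0" if "a < length d'" "b < length e" for a b
      using that by (intro entries[OF B(1,2)]) (auto simp: A(2))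
    then show "\<exists>y. P (Suc n) y \<and> Q n x y"
      using B unfolding P_def Q_def x by (intro exI[of _ "(d', B, e)"]) auto
  qed
  then obtain f where f: "\<And>n. P n (f n)" "\<And>n. Q n (f n) (f (Suc n))" by blast
  define d where "d i = fst (f i)" for i
  define A where "A i = fst (snd (f i))" for i
  have nxt: "snd (snd (f i)) = d (Suc i)" for i
    using f(2)[of i] unfolding Q_def d_def by (auto split: prod.splits)
  have fi: "f i = (d i, A i, d (Suc i))" for i
    by (simp add: d_def A_def nxt[symmetric, unfolded d_def])
  have "minimal_graded_free_resolution I d A"
    unfolding minimal_graded_free_resolution_def
    using f(1) f(2) unfolding P_def Q_def fi graded_mat_def by auto
  then show ?thesis by blast
qed

section \<open>Ideals generated by linear forms\<close>

text \<open>\<open>b' = b + (x)\<close> with \<open>x\<close> a nonzerodivisor modulo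
  \<open>b\<close>: one step of a regular sequence.\<close>

definition ideal_step :: "'a :: comm_ring_1 set \<Rightarrow> 'a \<Rightarrow> 'a set \<Rightarrow> bool" where
  "ideal_step b x b' \<longleftrightarrow> is_ideal b \<and> (\<forall>f. f \<in> b' \<longleftrightarrow> (\<exists>u. f - x * u \<in> b)) \<and> (\<forall>u. x * u \<in> b \<longrightarrow> u \<in> b)"

lemma ideal_stepD:
  assumes "ideal_step b x b'"
  shows "is_ideal b" "f \<in> b' \<longleftrightarrow> (\<exists>u. f - x * u \<in> b)" "x * u \<in> b \<Longrightarrow> u \<in> b"
  using assms unfolding ideal_step_def by blast+

lemma ideal_step_is_ideal:
  assumes "ideal_step b x b'"
  shows "is_ideal b'"
proof -
  note b = ideal_stepD[OF assms]
  show ?thesis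
    unfolding is_ideal_def
  proof (intro conjI ballI allI)
    show "0 \<in> b'" unfolding b(2) using is_idealD(1)[OF b(1)] by (intro exI[of _ 0]) simp
  next
    fix f g assume "f \<in> b'" "g \<in> b'"
    then obtain u v where "f - x * u \<in> b" "g - x * v \<in> b" unfolding b(2) by blast
    from is_idealD(2)[OF b(1) this] show "f + g \<in> b'"
      unfolding b(2) by (intro exI[of _ "u + v"]) (simp add: algebra_simps)
  next
    fix f r assume "f \<in> b'"
    then obtain u where "f - x * u \<in> b" unfolding b(2) by blast
    from is_idealD(3)[OF b(1) this, of r] show "r * f \<in> b'"
      unfolding b(2) by (intro exI[of _ "r * u"]) (simp add: algebra_simps)
  qed
qed

definition kill_subst :: "('v \<Rightarrow> 'i) \<Rightarrow> ('i \<Rightarrow> 'v) \<Rightarrow> 'i set \<Rightarrow> 'v \<Rightarrow> ('v, 'k :: comm_ring_1) mpoly" where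
  "kill_subst idx rep Z v = (if idx v \<in> Z then mvar (rep (idx v)) else 0)"

text \<open>One encoding serves every ideal of linear forms that occurs: the zero ideal, the ideal
  of all variables, the linear section, and the prime generated by the \<open>x_v - y_v\<close>. As
  the kernel of a map into a polynomial ring, it is prime over a domain.\<close>

definition lin_ideal :: "('v \<Rightarrow> 'i) \<Rightarrow> ('i \<Rightarrow> 'v) \<Rightarrow> 'i set \<Rightarrow> ('v, 'k :: comm_ring_1) mpoly set" where
  "lin_ideal idx rep Z = {f. subst (kill_subst idx rep Z) f = 0}"

lemma mvar_nonzero [simp]: "(mvar v :: ('v, 'k :: comm_ring_1) mpoly) \<noteq> 0"
proof
  assume "(mvar v :: ('v, 'k) mpoly) = 0"
  then have "Poly_Mapping.lookup (mvar v :: ('v, 'k) mpoly) (Poly_Mapping.single v 1) = 0" by simp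
  then show False by (simp add: mvar_def)
qed

lemma is_ideal_lin_ideal: "is_ideal (lin_ideal idx rep Z)"
  unfolding lin_ideal_def by (rule is_ideal_subst_kernel)

lemma subst_kill_subst_idem:
  fixes f :: "('v, 'k :: comm_ring_1) mpoly"
  assumes "\<And>k. k \<in> Z \<Longrightarrow> idx (rep k) = k"
  shows "subst (kill_subst idx rep Z) (subst (kill_subst idx rep Z) f) = subst (kill_subst idx rep Z) f"
proof -
  have "subst (kill_subst idx rep Z) (kill_subst idx rep Z v) = (kill_subst idx rep Z v :: ('v, 'k) mpoly)" for v
    using assms by (simp add: kill_subst_def)
  then show ?thesis by (simp add: subst_subst)
qed

lemma lin_ideal_prime:
  fixes f g :: "('v :: finite, 'k :: idom) mpoly"
  assumes "f * g \<in> lin_ideal idx rep Z"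
  shows "f \<in> lin_ideal idx rep Z \<or> g \<in> lin_ideal idx rep Z"
  using assms unfolding lin_ideal_def by (auto simp: subst_mult dest: mpoly_no_zero_divisors)

lemma lin_ideal_empty: "lin_ideal idx rep {} = {f :: ('v, 'k :: comm_ring_1) mpoly. Poly_Mapping.lookup f 0 = 0}"
proof -
  have "kill_subst idx rep {} = (\<lambda>_ :: 'v. 0 :: ('v, 'k) mpoly)"
    by (simp add: kill_subst_def fun_eq_iff)
  moreover have "Poly_Mapping.single 0 c = (0 :: ('v, 'k) mpoly) \<longleftrightarrow> c = 0" for c :: 'k
    by (metis lookup_single_eq lookup_zero single_zero)
  ultimately show ?thesis by (simp add: lin_ideal_def subst_kill)
qed

text \<open>Modulo the smaller ideal the ring is a polynomial ring in the representatives, where a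
  polynomial vanishing at \<open>x = 0\<close> is a multiple of \<open>x\<close>, and
  \<open>x\<close> can be cancelled.\<close>

lemma ideal_step_lin_ideal:
  fixes idx :: "'v :: finite \<Rightarrow> 'i"
  assumes inj: "\<And>k. k \<in> Z \<Longrightarrow> idx (rep k) = k" and k: "k \<in> Z"
  shows "ideal_step (lin_ideal idx rep Z :: ('v, 'k :: idom) mpoly set) (mvar (rep k)) (lin_ideal idx rep (Z - {k}))"
proof -
  let ?x = "mvar (rep k) :: ('v, 'k) mpoly"
  let ?t = "subst (kill_subst idx rep Z) :: ('v, 'k) mpoly \<Rightarrow> ('v, 'k) mpoly"
  let ?h = "\<lambda>v. if v = rep k then 0 else mvar v :: ('v, 'k) mpoly"
  have "subst ?h (kill_subst idx rep Z v) = kill_subst idx rep (Z - {k}) v" for v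
    using k by (auto simp: kill_subst_def) (metis inj)
  then have comp: "subst (kill_subst idx rep (Z - {k})) f = subst ?h (?t f)" for f
    by (simp add: subst_subst)
  have tx: "kill_subst idx rep Z (rep k) = ?x" using inj k by (simp add: kill_subst_def)
  have mult: "\<exists>u. g = ?x * u" if "subst ?h g = 0" for g
  proof -
    \<comment> \<open>Each variable is congruent to its image modulo \<open>x\<close>, hence so is
      \<open>g\<close>, whose image is zero.\<close>
    have "is_ideal {g. ?x dvd g}"
      by (simp add: is_ideal_def)
    moreover have "mvar v - ?h v \<in> {g. ?x dvd g}" for v
      by simp
    ultimately have "g - subst ?h g \<in> {g. ?x dvd g}" by (rule diff_subst_in_ideal)
    then have "?x dvd g" using that by simp
    then show ?thesis by (auto elim: dvdE)
  qed
  have "f \<in> lin_ideal idx rep (Z - {k}) \<longleftrightarrow> (\<exists>u. f - ?x * u \<in> lin_ideal idx rep Z)" for f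
  proof
    assume "f \<in> lin_ideal idx rep (Z - {k})"
    then have "subst ?h (?t f) = 0" by (simp add: lin_ideal_def comp)
    then obtain u where u: "?t f = ?x * u" using mult by blast
    have "?t (?t f) = ?t f" using inj by (rule subst_kill_subst_idem)
    then have "?x * ?t u = ?x * u" using u tx by (simp add: subst_mult)
    then have "?t (f - ?x * u) = 0" using u tx by (simp add: subst_diff subst_mult)
    then show "\<exists>u. f - ?x * u \<in> lin_ideal idx rep Z" by (auto simp: lin_ideal_def)
  next
    assume "\<exists>u. f - ?x * u \<in> lin_ideal idx rep Z"
    then obtain u where "?t f = ?x * ?t u"
      by (auto simp: lin_ideal_def subst_diff subst_mult tx)
    then have "subst ?h (?t f) = 0" by (simp add: subst_mult)
    then show "f \<in> lin_ideal idx rep (Z - {k})" by (simp add: lin_ideal_def comp)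
  qed
  moreover have "u \<in> lin_ideal idx rep Z" if "?x * u \<in> lin_ideal idx rep Z" for u
  proof -
    have "?x * ?t u = 0" using that by (simp add: lin_ideal_def subst_mult tx)
    then show ?thesis using mpoly_no_zero_divisors[of ?x "?t u"] by (simp add: lin_ideal_def)
  qed
  ultimately show ?thesis
    unfolding ideal_step_def using is_ideal_lin_ideal by blast
qed

subsection \<open>Vectors with entries in an ideal\<close>

definition vec_in :: "'a set \<Rightarrow> 'a vec \<Rightarrow> bool" where
  "vec_in b w \<longleftrightarrow> (\<forall>i<dim_vec w. w $ i \<in> b)"

lemma vec_in_mult_mat_vec:
  assumes b: "is_ideal b" and A: "A \<in> carrier_mat k l" and w: "w \<in> carrier_vec l" "vec_in b w"
  shows "vec_in b (A *\<^sub>v w)"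
  unfolding vec_in_def
proof (intro allI impI)
  fix i assume "i < dim_vec (A *\<^sub>v w)"
  then have i: "i < k" using A by simp
  show "(A *\<^sub>v w) $ i \<in> b"
    unfolding index_mult_mat_vec_sum[OF A w(1) i]
    by (intro is_ideal_sum[OF b] is_idealD(3)[OF b]) (use w in \<open>auto simp: vec_in_def\<close>)
qed

lemma vec_in_add:
  assumes "is_ideal b" "u \<in> carrier_vec k" "v \<in> carrier_vec k" "vec_in b u" "vec_in b v"
  shows "vec_in b (u + v)"
  using assms(2-5) is_idealD(2)[OF assms(1)] by (simp add: vec_in_def)

lemma vec_in_smult: "is_ideal b \<Longrightarrow> vec_in b u \<Longrightarrow> vec_in b (r \<cdot>\<^sub>v u)"
  using is_idealD(3)[of b] by (simp add: vec_in_def)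

lemma vec_in_step_cancel: "ideal_step b x b' \<Longrightarrow> vec_in b (x \<cdot>\<^sub>v u) \<Longrightarrow> vec_in b u"
  using ideal_stepD(3)[of b x b'] by (simp add: vec_in_def)

lemma vec_in_step:
  assumes "ideal_step b x b'" "w \<in> carrier_vec k"
  shows "vec_in b' w \<longleftrightarrow> (\<exists>u\<in>carrier_vec k. vec_in b (w - x \<cdot>\<^sub>v u))"
proof
  assume "vec_in b' w"
  then have "\<exists>u. w $ i - x * u \<in> b" if "i < k" for i
    using that assms(2) unfolding vec_in_def ideal_stepD(2)[OF assms(1)] by auto
  then obtain u where "\<And>i. i < k \<Longrightarrow> w $ i - x * u i \<in> b" by metis
  then have "vec_in b (w - x \<cdot>\<^sub>v vec k u)" using assms(2) by (simp add: vec_in_def)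
  then show "\<exists>u\<in>carrier_vec k. vec_in b (w - x \<cdot>\<^sub>v u)" by (intro bexI[of _ "vec k u"]) simp_all
next
  assume "\<exists>u\<in>carrier_vec k. vec_in b (w - x \<cdot>\<^sub>v u)"
  then show "vec_in b' w"
    using assms(2) unfolding vec_in_def ideal_stepD(2)[OF assms(1)] by auto
qed

lemma mult_mat_vec_diff:
  fixes A :: "'a :: comm_ring_1 mat"
  assumes A: "A \<in> carrier_mat k l" and "u \<in> carrier_vec l" "v \<in> carrier_vec l"
  shows "A *\<^sub>v (u - v) = A *\<^sub>v u - A *\<^sub>v v"
proof -
  have "u - v = u + (-1) \<cdot>\<^sub>v v" using assms by auto
  then have "A *\<^sub>v (u - v) = A *\<^sub>v u + (-1) \<cdot>\<^sub>v (A *\<^sub>v v)"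
    using assms by (simp add: mult_add_distrib_mat_vec[OF A] mult_mat_vec_smult[OF A])
  then show ?thesis using A by auto
qed

lemma hvec_mult_mat_vec:
  assumes A: "graded_mat d d' A" and u: "hvec d' e u"
  shows "hvec d e (A *\<^sub>v u)"
proof -
  have u': "u \<in> carrier_vec (length d')" using u by (simp add: hvec_def)
  then have "gcomp d' e u = u" using u hvec_iff_gcomp by blast
  then have "gcomp d e (A *\<^sub>v u) = A *\<^sub>v u" using gcomp_mult_mat_vec[OF A u', of e] by simp
  then show ?thesis by (metis hvec_gcomp)
qed

lemma submod_unit_vecs:
  assumes "submod k M" "\<And>j. j < k \<Longrightarrow> unit_vec k j \<in> M" "w \<in> carrier_vec k"
  shows "w \<in> M"
proof -
  have "1\<^sub>m k *\<^sub>v w \<in> M"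
    by (rule mult_mat_vec_in_submod[OF one_carrier_mat assms(3,1)])
      (use assms(2) submodD(4)[OF assms(1)] in auto)
  then show ?thesis using assms(3) by simp
qed

section \<open>Properties of minimal graded free resolutions\<close>

locale graded_resolution =
  fixes I :: "('v :: finite, 'k :: field) mpoly set"
    and d :: "nat \<Rightarrow> nat list" and A :: "nat \<Rightarrow> ('v, 'k) mpoly mat"
  assumes resolution: "minimal_graded_free_resolution I d A"
begin

lemmas resolution_conditions = resolution[unfolded minimal_graded_free_resolution_def]

lemma A_carrier: "A i \<in> carrier_mat (length (d i)) (length (d (Suc i)))"
  using resolution_conditions[THEN conjunct1] by simp

lemma d_0: "d 0 = [0]"
  using resolution_conditions[THEN conjunct2, THEN conjunct1] .

lemma A_graded: "graded_mat (d i) (d (Suc i)) (A i)"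
  using resolution_conditions[THEN conjunct2, THEN conjunct2, THEN conjunct1] A_carrier
  unfolding graded_mat_def by simp

lemma A_minimal:
  "a < length (d i) \<Longrightarrow> b < length (d (Suc i)) \<Longrightarrow> Poly_Mapping.lookup (A i $$ (a, b)) 0 = 0"
  using resolution_conditions[THEN conjunct2, THEN conjunct2, THEN conjunct2, THEN conjunct1] by simp

lemma I_eq: "I = {(A 0 *\<^sub>v w) $ 0 | w. w \<in> carrier_vec (length (d 1))}"
  using resolution_conditions[THEN conjunct2, THEN conjunct2, THEN conjunct2, THEN conjunct2, THEN conjunct1]
  by (rule sym)

lemma kernel_eq: "mat_kernel (A i) = {A (Suc i) *\<^sub>v w | w. w \<in> carrier_vec (length (d (Suc (Suc i))))}"
  using resolution_conditions[THEN conjunct2, THEN conjunct2, THEN conjunct2, THEN conjunct2, THEN conjunct2]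
  by (rule spec)

lemma mult_A_carrier [simp]: "A i *\<^sub>v w \<in> carrier_vec (length (d i))"
  using A_carrier[of i] by (intro carrier_vecI) simp

lemma A_A: "w \<in> carrier_vec (length (d (Suc (Suc i)))) \<Longrightarrow> A i *\<^sub>v (A (Suc i) *\<^sub>v w) = 0\<^sub>v (length (d i))"
  using kernel_eq[of i] A_carrier[of i] by (auto simp: mat_kernel_def)

lemma exact:
  "w \<in> carrier_vec (length (d (Suc i))) \<Longrightarrow> A i *\<^sub>v w = 0\<^sub>v (length (d i)) \<Longrightarrow>
     \<exists>u\<in>carrier_vec (length (d (Suc (Suc i)))). w = A (Suc i) *\<^sub>v u"
proof -
  assume "w \<in> carrier_vec (length (d (Suc i)))" "A i *\<^sub>v w = 0\<^sub>v (length (d i))"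
  then have "w \<in> mat_kernel (A i)" using A_carrier[of i] by (auto simp: mat_kernel_def)
  then show ?thesis unfolding kernel_eq by blast
qed

text \<open>
  Killing the variables one at a time: each step loses exactness in one homological degree.
\<close>

lemma exact_modulo_variables:
  assumes "finite V" "card V \<le> i" "w \<in> carrier_vec (length (d (Suc i)))"
    and "vec_in (lin_ideal id id (- V)) (A i *\<^sub>v w)"
  shows "\<exists>u\<in>carrier_vec (length (d (Suc (Suc i)))). vec_in (lin_ideal id id (- V)) (w - A (Suc i) *\<^sub>v u)"
  using assms
proof (induction V arbitrary: i w rule: finite_induct)
  case empty
  have "lin_ideal id id (- {}) = {0 :: ('v, 'k) mpoly}"
  proof -
    have "kill_subst id id UNIV = (mvar :: 'v \<Rightarrow> ('v, 'k) mpoly)"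
      by (simp add: kill_subst_def fun_eq_iff)
    then show ?thesis by (simp add: lin_ideal_def)
  qed
  then have zero: "vec_in (lin_ideal id id (- {})) u \<longleftrightarrow> u = 0\<^sub>v k" if "u \<in> carrier_vec k" for u :: "('v, 'k) mpoly vec" and k
    using that by (auto simp add: vec_in_def vec_eq_iff)
  have "A i *\<^sub>v w = 0\<^sub>v (length (d i))" using zero[OF mult_A_carrier] empty.prems(3) by blast
  from exact[OF empty.prems(2) this] obtain u where
    u: "u \<in> carrier_vec (length (d (Suc (Suc i))))" "w = A (Suc i) *\<^sub>v u" by blast
  have eq: "w - A (Suc i) *\<^sub>v u = 0\<^sub>v (length (d (Suc i)))" using u(2) empty.prems(2) by auto
  have "vec_in (lin_ideal id id (- {})) (0\<^sub>v (length (d (Suc i))) :: ('v, 'k) mpoly vec)"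
    using zero[OF zero_carrier_vec] by blast
  then have "vec_in (lin_ideal id id (- {})) (w - A (Suc i) *\<^sub>v u)" by (simp only: eq)
  then show ?case using u(1) by (rule bexI)
next
  case (insert x V)
  let ?b = "lin_ideal id id (- V) :: ('v, 'k) mpoly set"
  let ?F = "\<lambda>i. carrier_vec (length (d i)) :: ('v, 'k) mpoly vec set"
  have step: "ideal_step ?b (mvar x) (lin_ideal id id (- insert x V))"
  proof -
    have eq: "- insert x V = - V - {x}" by auto
    have "ideal_step ?b (mvar (id x)) (lin_ideal id id (- V - {x}))"
      by (rule ideal_step_lin_ideal) (use insert.hyps(2) in auto)
    then show ?thesis by (simp only: eq id_apply)
  qed
  have b: "is_ideal ?b" by (rule is_ideal_lin_ideal)
  obtain j where i: "i = Suc j" and j: "card V \<le> j"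
    using insert.prems(1) insert.hyps by (cases i) auto
  have w: "w \<in> ?F (Suc i)" by (rule insert.prems(2))
  \<comment> \<open>The long exact sequence of multiplication by \<open>x\<close>, by hand. Write
    \<open>A i w = x u\<close> modulo \<open>?b\<close>; applying \<open>A j\<close> and cancelling
    \<open>x\<close> makes \<open>u\<close> a cycle, hence a boundary \<open>A i u1\<close>. Then
    \<open>w - x u1\<close> is a cycle modulo \<open>?b\<close>, and the induction hypothesis in
    degree \<open>i\<close> applies to it.\<close>
  from iffD1[OF vec_in_step[OF step mult_A_carrier] insert.prems(3)]
  obtain u where u: "u \<in> ?F i" "vec_in ?b (A i *\<^sub>v w - mvar x \<cdot>\<^sub>v u)" by (elim bexE)
  have "A i *\<^sub>v w - mvar x \<cdot>\<^sub>v u \<in> ?F (Suc j)"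
    using u(1) mult_A_carrier[of "Suc j" w] unfolding i by simp
  then have "vec_in ?b (A j *\<^sub>v (A i *\<^sub>v w - mvar x \<cdot>\<^sub>v u))"
    using u(2) by (rule vec_in_mult_mat_vec[OF b A_carrier])
  also have "A j *\<^sub>v (A i *\<^sub>v w - mvar x \<cdot>\<^sub>v u) = A j *\<^sub>v (A i *\<^sub>v w) - A j *\<^sub>v (mvar x \<cdot>\<^sub>v u)"
    using u(1) unfolding i by (intro mult_mat_vec_diff[OF A_carrier]) auto
  also have "\<dots> = (- 1) \<cdot>\<^sub>v (mvar x \<cdot>\<^sub>v (A j *\<^sub>v u))"
    using A_A[of w j] w u(1) mult_mat_vec_smult[OF A_carrier, of u j] A_carrier[of j] unfolding i by auto
  finally have "vec_in ?b ((- 1) \<cdot>\<^sub>v ((- 1) \<cdot>\<^sub>v (mvar x \<cdot>\<^sub>v (A j *\<^sub>v u))))"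
    by (rule vec_in_smult[OF b])
  then have "vec_in ?b (mvar x \<cdot>\<^sub>v (A j *\<^sub>v u))"
    by (simp add: smult_smult_assoc)
  then have Au: "vec_in ?b (A j *\<^sub>v u)"
    by (rule vec_in_step_cancel[OF step])
  have "u \<in> ?F (Suc j)" using u(1) i by simp
  from insert.IH[OF j this Au] obtain u1 where
    u1: "u1 \<in> ?F (Suc i)" "vec_in ?b (u - A i *\<^sub>v u1)" unfolding i by (elim bexE)
  have "vec_in ?b ((A i *\<^sub>v w - mvar x \<cdot>\<^sub>v u) + mvar x \<cdot>\<^sub>v (u - A i *\<^sub>v u1))"
    using u u1 by (intro vec_in_add[OF b, of _ "length (d i)"] vec_in_smult[OF b]) auto
  also have "(A i *\<^sub>v w - mvar x \<cdot>\<^sub>v u) + mvar x \<cdot>\<^sub>v (u - A i *\<^sub>v u1) = A i *\<^sub>v (w - mvar x \<cdot>\<^sub>v u1)"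
    using w u1(1) u(1) A_carrier[of i]
    by (subst mult_mat_vec_diff[OF A_carrier]) (auto simp: mult_mat_vec_smult[OF A_carrier] algebra_simps)
  finally have Aw: "vec_in ?b (A i *\<^sub>v (w - mvar x \<cdot>\<^sub>v u1))" .
  have "card V \<le> i" using j i by simp
  moreover have "w - mvar x \<cdot>\<^sub>v u1 \<in> ?F (Suc i)" using w u1(1) by simp
  ultimately have "\<exists>u\<in>?F (Suc (Suc i)). vec_in ?b ((w - mvar x \<cdot>\<^sub>v u1) - A (Suc i) *\<^sub>v u)"
    using Aw by (rule insert.IH)
  then obtain u2 where u2: "u2 \<in> ?F (Suc (Suc i))" "vec_in ?b ((w - mvar x \<cdot>\<^sub>v u1) - A (Suc i) *\<^sub>v u2)"
    by (elim bexE)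
  have "(w - mvar x \<cdot>\<^sub>v u1) - A (Suc i) *\<^sub>v u2 = (w - A (Suc i) *\<^sub>v u2) - mvar x \<cdot>\<^sub>v u1"
    using w u1(1) A_carrier[of "Suc i"] by auto
  with u2(2) have "vec_in ?b ((w - A (Suc i) *\<^sub>v u2) - mvar x \<cdot>\<^sub>v u1)" by (simp only:)
  with u1(1) have ex: "\<exists>u\<in>?F (Suc i). vec_in ?b ((w - A (Suc i) *\<^sub>v u2) - mvar x \<cdot>\<^sub>v u)" by (rule bexI[rotated])
  have "w - A (Suc i) *\<^sub>v u2 \<in> ?F (Suc i)"
    by (rule minus_carrier_vec[OF w mult_A_carrier])
  from iffD2[OF vec_in_step[OF step this] ex] show ?case using u2(1) by (rule bexI)
qed

text \<open>Hilbert's syzygy bound. With all variables killed, exactness persists in these degrees,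
  while minimality makes every map zero modulo the variables. A basis vector would be a cycle, hence
  a boundary, hence have no constant term.\<close>

lemma length_le:
  assumes "card (UNIV :: 'v set) < i"
  shows "d i = []"
proof (rule ccontr)
  assume "d i \<noteq> []"
  obtain j where i: "i = Suc j" and j: "card (UNIV :: 'v set) \<le> j" using assms by (cases i) auto
  let ?m = "lin_ideal id id {} :: ('v, 'k) mpoly set"
  have m: "?m = {f. Poly_Mapping.lookup f 0 = 0}" by (simp add: lin_ideal_empty)
  have min: "vec_in ?m (A n *\<^sub>v w)" if w: "w \<in> carrier_vec (length (d (Suc n)))" for n w
    unfolding vec_in_def
  proof (intro allI impI)
    fix a assume "a < dim_vec (A n *\<^sub>v w)"
    then have a: "a < length (d n)" using A_carrier[of n] by simp
    show "(A n *\<^sub>v w) $ a \<in> ?m"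
      unfolding index_mult_mat_vec_sum[OF A_carrier w a]
      by (rule is_ideal_sum[OF is_ideal_lin_ideal], rule is_idealD(4)[OF is_ideal_lin_ideal])
        (simp add: m A_minimal a)
  qed
  let ?w = "unit_vec (length (d (Suc j))) 0 :: ('v, 'k) mpoly vec"
  have "vec_in ?m (A j *\<^sub>v ?w)" by (rule min) simp
  from exact_modulo_variables[OF finite_UNIV j unit_vec_carrier, unfolded Compl_UNIV_eq, OF this] obtain u where
    u: "u \<in> carrier_vec (length (d (Suc (Suc j))))" "vec_in ?m (?w - A (Suc j) *\<^sub>v u)" by blast
  have "vec_in ?m ((?w - A (Suc j) *\<^sub>v u) + A (Suc j) *\<^sub>v u)"
    by (rule vec_in_add[OF is_ideal_lin_ideal minus_carrier_vec[OF unit_vec_carrier mult_A_carrier]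
          mult_A_carrier u(2) min[OF u(1)]])
  also have "(?w - A (Suc j) *\<^sub>v u) + A (Suc j) *\<^sub>v u = ?w" using A_carrier[of "Suc j"] by auto
  finally have w: "vec_in ?m ?w" .
  have l: "0 < length (d (Suc j))" using \<open>d i \<noteq> []\<close> i by simp
  with w have "?w $ 0 \<in> ?m" unfolding vec_in_def index_unit_vec(3) by blast
  then show False using l unfolding m by simp
qed

end

section \<open>Null-homotopies and a generator of prescribed degree\<close>

definition linear_on :: "nat \<Rightarrow> nat \<Rightarrow> ('a :: comm_ring_1 vec \<Rightarrow> 'a vec) \<Rightarrow> bool" where
  "linear_on k l F \<longleftrightarrow> (\<forall>u\<in>carrier_vec k. F u \<in> carrier_vec l) \<and>
     (\<forall>u\<in>carrier_vec k. \<forall>v\<in>carrier_vec k. F (u + v) = F u + F v) \<and>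
     (\<forall>u\<in>carrier_vec k. \<forall>r. F (r \<cdot>\<^sub>v u) = r \<cdot>\<^sub>v F u)"

lemma linear_on_mult_mat_vec: "A \<in> carrier_mat l k \<Longrightarrow> linear_on k l ((*\<^sub>v) A)"
  by (simp add: linear_on_def mult_add_distrib_mat_vec[of A l k] mult_mat_vec_smult[of A l k])

lemma linear_on_compose: "linear_on k l F \<Longrightarrow> linear_on l n G \<Longrightarrow> linear_on k n (\<lambda>w. G (F w))"
  by (simp add: linear_on_def)

lemma linear_on_smult: "linear_on k k ((\<cdot>\<^sub>v) f)"
  by (auto simp: linear_on_def smult_add_distrib_vec smult_smult_assoc mult.commute)

lemma linear_on_diff:
  assumes "linear_on k l F" "linear_on k l G"
  shows "linear_on k l (\<lambda>w. F w - G w)"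
  unfolding linear_on_def
proof (intro conjI ballI allI)
  fix u v :: "'a vec" and r assume "u \<in> carrier_vec k"
  then have u: "F u \<in> carrier_vec l" "G u \<in> carrier_vec l" "F (r \<cdot>\<^sub>v u) = r \<cdot>\<^sub>v F u" "G (r \<cdot>\<^sub>v u) = r \<cdot>\<^sub>v G u"
    using assms unfolding linear_on_def by blast+
  show "F u - G u \<in> carrier_vec l" using u by simp
  show "F (r \<cdot>\<^sub>v u) - G (r \<cdot>\<^sub>v u) = r \<cdot>\<^sub>v (F u - G u)"
    unfolding u(3,4) using u(1,2) by (intro eq_vecI) (auto simp: right_diff_distrib)
  assume "v \<in> carrier_vec k"
  with \<open>u \<in> carrier_vec k\<close> have v: "F v \<in> carrier_vec l" "G v \<in> carrier_vec l"
    "F (u + v) = F u + F v" "G (u + v) = G u + G v"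
    using assms unfolding linear_on_def by blast+
  show "F (u + v) - G (u + v) = (F u - G u) + (F v - G v)"
    unfolding v(3,4) using u(1,2) v(1,2) by (intro eq_vecI) auto
qed

lemma linear_on_eqI:
  assumes F: "linear_on k l F" and G: "linear_on k l G"
    and units: "\<And>j. j < k \<Longrightarrow> F (unit_vec k j) = G (unit_vec k j)" and w: "w \<in> carrier_vec k"
  shows "F w = G w"
proof -
  have zero: "F (0\<^sub>v k) = 0\<^sub>v l" if "linear_on k l F" for F :: "'a vec \<Rightarrow> 'a vec"
  proof -
    have "F (0\<^sub>v k) \<in> carrier_vec l" "F (0 \<cdot>\<^sub>v 0\<^sub>v k) = 0 \<cdot>\<^sub>v F (0\<^sub>v k)"
      using that by (auto simp: linear_on_def)
    moreover have "0 \<cdot>\<^sub>v 0\<^sub>v k = (0\<^sub>v k :: 'a vec)" by auto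
    moreover have "0 \<cdot>\<^sub>v u = 0\<^sub>v l" if "u \<in> carrier_vec l" for u :: "'a vec"
      using that by (intro eq_vecI) auto
    ultimately show ?thesis by simp
  qed
  have "submod k {u \<in> carrier_vec k. F u = G u}"
    unfolding submod_def using F G zero[OF F] zero[OF G] by (auto simp: linear_on_def)
  from submod_unit_vecs[OF this _ w] units show ?thesis by simp
qed

context graded_resolution
begin

lemma homogeneous_lift:
  assumes y: "hvec (d i) e y" and im: "y \<in> {A i *\<^sub>v u | u. u \<in> carrier_vec (length (d (Suc i)))}"
  shows "\<exists>h. hvec (d (Suc i)) e h \<and> A i *\<^sub>v h = y"
proof -
  obtain u where u: "u \<in> carrier_vec (length (d (Suc i)))" "y = A i *\<^sub>v u" using im by blast
  have "A i *\<^sub>v gcomp (d (Suc i)) e u = gcomp (d i) e (A i *\<^sub>v u)"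
    using gcomp_mult_mat_vec[OF A_graded u(1)] by simp
  also have "\<dots> = y"
    unfolding u(2)[symmetric] using y hvec_iff_gcomp[of y "d i" e] by (simp add: hvec_def)
  finally show ?thesis using hvec_gcomp by blast
qed

lemma homogeneous_lift_columns:
  assumes "\<And>b. b < length e \<Longrightarrow> hvec (d i) (e ! b) (Y b)"
    and "\<And>b. b < length e \<Longrightarrow> Y b \<in> {A i *\<^sub>v u | u. u \<in> carrier_vec (length (d (Suc i)))}"
  shows "\<exists>H. graded_mat (d (Suc i)) e H \<and> (\<forall>b<length e. A i *\<^sub>v (H *\<^sub>v unit_vec (length e) b) = Y b)"
proof -
  have "\<exists>h. hvec (d (Suc i)) (e ! b) h \<and> A i *\<^sub>v h = Y b" if "b < length e" for b
    by (rule homogeneous_lift[OF assms(1,2)[OF that]])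
  then obtain h where h: "\<And>b. b < length e \<Longrightarrow> hvec (d (Suc i)) (e ! b) (h b)"
    "\<And>b. b < length e \<Longrightarrow> A i *\<^sub>v h b = Y b" by metis
  define H where "H = mat (length (d (Suc i))) (length e) (\<lambda>(a, b). h b $ a)"
  have H: "H \<in> carrier_mat (length (d (Suc i))) (length e)" by (simp add: H_def)
  have col: "col H b = h b" if "b < length e" for b
    using that h(1)[OF that] by (auto simp: H_def hvec_def)
  have "graded_mat (d (Suc i)) e H"
    unfolding graded_mat_def
  proof (intro conjI H allI impI ballI)
    fix a b m assume "a < length (d (Suc i))" "b < length e" "m \<in> Poly_Mapping.keys (H $$ (a, b))"
    then show "mono_deg m + d (Suc i) ! a = e ! b"
      using h(1)[of b] by (simp add: H_def hvec_def)
  qed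
  moreover have "A i *\<^sub>v (H *\<^sub>v unit_vec (length e) b) = Y b" if "b < length e" for b
    using that by (simp add: mult_mat_vec_unit[OF H] col h(2))
  ultimately show ?thesis by blast
qed

lemma hvec_unit_vec: "b < length e \<Longrightarrow> hvec e (e ! b) (unit_vec (length e) b :: ('v, 'k) mpoly vec)"
  by (auto simp: hvec_def)

text \<open>Multiplication by \<open>f\<close> is zero on \<open>R/I\<close>, so on the resolution
  it is null-homotopic; the homotopy is built degree by degree from the images of basis vectors.
  Homogeneous lifts are chosen, so each \<open>H i\<close> raises degrees by
  \<open>s\<close>.\<close>

lemma null_homotopy:
  assumes f: "f \<in> I" "homogeneous s f"
  obtains H where "\<And>i. graded_mat (d (Suc i)) (map ((+) s) (d i)) (H i)"
    and "\<And>w. w \<in> carrier_vec (length (d 0)) \<Longrightarrow> A 0 *\<^sub>v (H 0 *\<^sub>v w) = f \<cdot>\<^sub>v w"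
    and "\<And>i w. w \<in> carrier_vec (length (d (Suc i))) \<Longrightarrow>
           A (Suc i) *\<^sub>v (H (Suc i) *\<^sub>v w) = f \<cdot>\<^sub>v w - H i *\<^sub>v (A i *\<^sub>v w)"
proof -
  let ?F = "\<lambda>i. carrier_vec (length (d i)) :: ('v, 'k) mpoly vec set"
  let ?e = "\<lambda>i. map ((+) s) (d i)"
  \<comment> \<open>The middle condition makes \<open>f w - H (A i w)\<close> a cycle, and exactness
    then supplies the next \<open>H\<close>. At \<open>i = 0\<close> the lift exists because
    \<open>f\<close> lies in the image of \<open>A 0\<close>.\<close>
  define P where "P i H \<longleftrightarrow> graded_mat (d (Suc i)) (?e i) H \<and>
      (\<forall>w\<in>?F (Suc i). A i *\<^sub>v (H *\<^sub>v (A i *\<^sub>v w)) = f \<cdot>\<^sub>v (A i *\<^sub>v w)) \<and>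
      (i = 0 \<longrightarrow> (\<forall>w\<in>?F 0. A 0 *\<^sub>v (H *\<^sub>v w) = f \<cdot>\<^sub>v w))" for i H
  define Q where "Q i H H' \<longleftrightarrow>
      (\<forall>w\<in>?F (Suc i). A (Suc i) *\<^sub>v (H' *\<^sub>v w) = f \<cdot>\<^sub>v w - H *\<^sub>v (A i *\<^sub>v w))" for i H H'
  have car: "H \<in> carrier_mat (length (d (Suc i))) (length (d i))" if "graded_mat (d (Suc i)) (?e i) H" for i H
    using that by (simp add: graded_mat_def)
  have "\<exists>H. \<forall>i. P i (H i) \<and> Q i (H i) (H (Suc i))"
  proof (rule dependent_nat_choice)
    have "\<exists>H. graded_mat (d (Suc 0)) (?e 0) H \<and>
        (\<forall>b<length (?e 0). A 0 *\<^sub>v (H *\<^sub>v unit_vec (length (?e 0)) b) = f \<cdot>\<^sub>v unit_vec (length (d 0)) b)"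
    proof (rule homogeneous_lift_columns)
      fix b assume "b < length (?e 0)"
      then have b: "b < length (d 0)" by simp
      show "hvec (d 0) (?e 0 ! b) (f \<cdot>\<^sub>v unit_vec (length (d 0)) b)"
        using hvec_smult[OF f(2) hvec_unit_vec[OF b]] b by simp
      obtain u where u: "u \<in> ?F (Suc 0)" "f = (A 0 *\<^sub>v u) $ 0"
        using f(1) unfolding I_eq by auto
      have "f \<cdot>\<^sub>v unit_vec (length (d 0)) b = A 0 *\<^sub>v u"
        using b A_carrier[of 0] u(2) by (intro eq_vecI) (auto simp: d_0 simp del: index_mult_mat_vec)
      then show "f \<cdot>\<^sub>v unit_vec (length (d 0)) b \<in> {A 0 *\<^sub>v u | u. u \<in> ?F (Suc 0)}"
        using u(1) by blast
    qed
    then obtain H where H: "graded_mat (d (Suc 0)) (?e 0) H"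
      "\<And>b. b < length (d 0) \<Longrightarrow> A 0 *\<^sub>v (H *\<^sub>v unit_vec (length (d 0)) b) = f \<cdot>\<^sub>v unit_vec (length (d 0)) b"
      by auto
    note Hc = car[OF H(1)]
    have "A 0 *\<^sub>v (H *\<^sub>v w) = f \<cdot>\<^sub>v w" if "w \<in> ?F 0" for w
      using linear_on_compose[OF linear_on_mult_mat_vec[OF Hc] linear_on_mult_mat_vec[OF A_carrier]]
        linear_on_smult H(2) that by (rule linear_on_eqI)
    then have "P 0 H" unfolding P_def using H(1) mult_A_carrier by blast
    then show "\<exists>H. P 0 H" ..
  next
    fix H i assume P: "P i H"
    have H: "graded_mat (d (Suc i)) (?e i) H" using P unfolding P_def by simp
    note Hc = car[OF H]
    have HAA: "A i *\<^sub>v (H *\<^sub>v (A i *\<^sub>v w)) = f \<cdot>\<^sub>v (A i *\<^sub>v w)" if "w \<in> ?F (Suc i)" for w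
      using P that unfolding P_def by blast
    define Y where "Y w = f \<cdot>\<^sub>v w - H *\<^sub>v (A i *\<^sub>v w)" for w
    have HA: "H *\<^sub>v (A i *\<^sub>v w) \<in> ?F (Suc i)" for w
      using mult_mat_vec_carrier[OF Hc mult_A_carrier] .
    have "\<exists>H'. graded_mat (d (Suc (Suc i))) (?e (Suc i)) H' \<and>
        (\<forall>b<length (?e (Suc i)). A (Suc i) *\<^sub>v (H' *\<^sub>v unit_vec (length (?e (Suc i))) b) =
           Y (unit_vec (length (d (Suc i))) b))"
    proof (rule homogeneous_lift_columns)
      fix b assume "b < length (?e (Suc i))"
      then have b: "b < length (d (Suc i))" by simp
      let ?u = "unit_vec (length (d (Suc i))) b :: ('v, 'k) mpoly vec"
      have "hvec (d i) (d (Suc i) ! b) (A i *\<^sub>v ?u)"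
        by (rule hvec_mult_mat_vec[OF A_graded hvec_unit_vec[OF b]])
      then have "hvec (?e i) (s + d (Suc i) ! b) (A i *\<^sub>v ?u)"
        by (auto simp: hvec_def add.left_commute[of _ s])
      then have "hvec (d (Suc i)) (s + d (Suc i) ! b) (H *\<^sub>v (A i *\<^sub>v ?u))"
        by (rule hvec_mult_mat_vec[OF H])
      then show "hvec (d (Suc i)) (?e (Suc i) ! b) (Y ?u)"
        unfolding Y_def using hvec_diff[OF hvec_smult[OF f(2) hvec_unit_vec[OF b]]] b by simp
      have u: "?u \<in> ?F (Suc i)" by simp
      have "A i *\<^sub>v Y ?u = A i *\<^sub>v (f \<cdot>\<^sub>v ?u) - A i *\<^sub>v (H *\<^sub>v (A i *\<^sub>v ?u))"
        unfolding Y_def by (rule mult_mat_vec_diff[OF A_carrier _ HA]) simp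
      also have "\<dots> = f \<cdot>\<^sub>v (A i *\<^sub>v ?u) - f \<cdot>\<^sub>v (A i *\<^sub>v ?u)"
        unfolding HAA[OF u] mult_mat_vec_smult[OF A_carrier u] ..
      also have "\<dots> = 0\<^sub>v (length (d i))"
        using mult_A_carrier[of i ?u] by (intro minus_cancel_vec) simp
      finally have z: "A i *\<^sub>v Y ?u = 0\<^sub>v (length (d i))" .
      have "Y ?u \<in> ?F (Suc i)"
        unfolding Y_def by (rule minus_carrier_vec[OF _ HA]) simp
      from exact[OF this z] show "Y ?u \<in> {A (Suc i) *\<^sub>v u | u. u \<in> ?F (Suc (Suc i))}" by blast
    qed
    then obtain H' where H': "graded_mat (d (Suc (Suc i))) (?e (Suc i)) H'"
      "\<And>b. b < length (d (Suc i)) \<Longrightarrow> A (Suc i) *\<^sub>v (H' *\<^sub>v unit_vec (length (d (Suc i))) b) =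
           Y (unit_vec (length (d (Suc i))) b)" by auto
    note Hc' = car[OF H'(1)]
    have Y: "linear_on (length (d (Suc i))) (length (d (Suc i))) Y"
      unfolding Y_def
      by (intro linear_on_diff linear_on_smult linear_on_compose[OF _ linear_on_mult_mat_vec[OF Hc]]
          linear_on_mult_mat_vec A_carrier)
    have Q: "A (Suc i) *\<^sub>v (H' *\<^sub>v w) = Y w" if "w \<in> ?F (Suc i)" for w
      using linear_on_compose[OF linear_on_mult_mat_vec[OF Hc'] linear_on_mult_mat_vec[OF A_carrier]]
        Y H'(2) that by (rule linear_on_eqI)
    have "Q i H H'" unfolding Q_def using Q unfolding Y_def by blast
    moreover have "A (Suc i) *\<^sub>v (H' *\<^sub>v (A (Suc i) *\<^sub>v w)) = f \<cdot>\<^sub>v (A (Suc i) *\<^sub>v w)"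
      if w: "w \<in> ?F (Suc (Suc i))" for w
    proof -
      have "Y (A (Suc i) *\<^sub>v w) = f \<cdot>\<^sub>v (A (Suc i) *\<^sub>v w) - H *\<^sub>v 0\<^sub>v (length (d i))"
        unfolding Y_def A_A[OF w] ..
      also have "\<dots> = f \<cdot>\<^sub>v (A (Suc i) *\<^sub>v w)"
        using Hc A_carrier[of "Suc i"] by (intro eq_vecI) auto
      finally show ?thesis using Q[OF mult_A_carrier] by simp
    qed
    ultimately show "\<exists>H'. P (Suc i) H' \<and> Q i H H'"
      unfolding P_def using H'(1) by blast
  qed
  then obtain H where H: "\<And>i. P i (H i)" "\<And>i. Q i (H i) (H (Suc i))" by blast
  show thesis
  proof (rule that)
    show "graded_mat (d (Suc i)) (?e i) (H i)" for i using H(1)[of i] unfolding P_def by simp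
    show "A 0 *\<^sub>v (H 0 *\<^sub>v w) = f \<cdot>\<^sub>v w" if "w \<in> ?F 0" for w
      using H(1)[of 0] that unfolding P_def by simp
    show "A (Suc i) *\<^sub>v (H (Suc i) *\<^sub>v w) = f \<cdot>\<^sub>v w - H i *\<^sub>v (A i *\<^sub>v w)" if "w \<in> ?F (Suc i)" for i w
      using H(2)[of i] that unfolding Q_def by simp
  qed
qed

text \<open>Applying the null-homotopies of \<open>f 0, ..., f (n - 1)\<close> in turn to
  \<open>1\<close> gives an element of degree \<open>n * s\<close> in the \<open>n\<close>-th
  module. An entry outside \<open>b n\<close> has a constant term, which forces a basis element of
  that degree. That such an entry exists is checked by descending the chain
  \<open>b n, ..., b 0\<close>, each step cancelling the factor \<open>x k\<close> of
  \<open>f k\<close> and collecting \<open>c k\<close>.\<close>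

lemma generator_of_degree:
  fixes f x c :: "nat \<Rightarrow> ('v, 'k) mpoly"
  assumes f: "\<And>k. k < n \<Longrightarrow> f k \<in> I" "\<And>k. k < n \<Longrightarrow> homogeneous s (f k)"
    and step: "\<And>k. k < n \<Longrightarrow> ideal_step (b k) (x k) (b (Suc k))"
    and cong: "\<And>k. k < n \<Longrightarrow> f k - x k * c k \<in> b k"
    and const: "{g. Poly_Mapping.lookup g 0 = 0} \<subseteq> b n"
    and nonmem: "\<And>g. g \<in> I \<Longrightarrow> (\<Prod>k<n. c k) - g \<notin> b 0"
  shows "n * s \<in> set (d n)"
proof -
  let ?F = "\<lambda>i. carrier_vec (length (d i)) :: ('v, 'k) mpoly vec set"
  \<comment> \<open>\<open>w\<close> is a cycle modulo \<open>b k\<close> (no condition in degree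
    \<open>0\<close>), and any multiple \<open>D w\<close> that is a boundary modulo
    \<open>b k\<close> forces \<open>D c_0 ... c_(k-1)\<close> into \<open>I + b 0\<close>. The free
    multiplier \<open>D\<close> carries the induction, because each descent replaces it by
    \<open>D * c k\<close>.\<close>
  define P where "P k w \<longleftrightarrow> hvec (d k) (k * s) w \<and> (\<forall>i. k = Suc i \<longrightarrow> vec_in (b k) (A i *\<^sub>v w)) \<and>
      (\<forall>D. \<forall>u\<in>?F (Suc k). vec_in (b k) (D \<cdot>\<^sub>v w - A k *\<^sub>v u) \<longrightarrow> (\<exists>g\<in>I. D * (\<Prod>t<k. c t) - g \<in> b 0))"
    for k w
  have "\<exists>w. P k w" if "k \<le> n" for k
    using that
  proof (induction k)
    case 0
    let ?w = "unit_vec 1 0 :: ('v, 'k) mpoly vec"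
    have "\<exists>g\<in>I. D * (\<Prod>t<0. c t) - g \<in> b 0"
      if u: "u \<in> ?F (Suc 0)" "vec_in (b 0) (D \<cdot>\<^sub>v ?w - A 0 *\<^sub>v u)" for D u
    proof -
      have "(A 0 *\<^sub>v u) $ 0 \<in> I" using u(1) unfolding I_eq by auto
      moreover have "D - (A 0 *\<^sub>v u) $ 0 \<in> b 0"
        using u(2) A_carrier[of 0] by (auto simp: vec_in_def d_0 simp del: index_mult_mat_vec)
      ultimately show ?thesis by (intro bexI[of _ "(A 0 *\<^sub>v u) $ 0"]) simp_all
    qed
    moreover have "hvec (d 0) (0 * s) ?w" by (auto simp: hvec_def d_0)
    ultimately have "P 0 ?w" unfolding P_def by blast
    then show ?case ..
  next
    case (Suc k)
    then have k: "k < n" by simp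
    from Suc obtain w where Pw: "P k w" by (auto simp: Suc_le_eq)
    then have w: "hvec (d k) (k * s) w" "\<And>i. k = Suc i \<Longrightarrow> vec_in (b k) (A i *\<^sub>v w)"
      unfolding P_def by simp_all
    have D: "\<exists>g\<in>I. D * (\<Prod>t<k. c t) - g \<in> b 0"
      if "u \<in> ?F (Suc k)" "vec_in (b k) (D \<cdot>\<^sub>v w - A k *\<^sub>v u)" for D u
      using Pw that unfolding P_def by blast
    have wc: "w \<in> ?F k" using w(1) by (simp add: hvec_def)
    obtain H where H: "\<And>i. graded_mat (d (Suc i)) (map ((+) s) (d i)) (H i)"
      "\<And>w. w \<in> ?F 0 \<Longrightarrow> A 0 *\<^sub>v (H 0 *\<^sub>v w) = f k \<cdot>\<^sub>v w"
      "\<And>i w. w \<in> ?F (Suc i) \<Longrightarrow> A (Suc i) *\<^sub>v (H (Suc i) *\<^sub>v w) = f k \<cdot>\<^sub>v w - H i *\<^sub>v (A i *\<^sub>v w)"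
      by (rule null_homotopy[OF f(1)[OF k] f(2)[OF k]]) (rule that)
    have Hc: "H i \<in> carrier_mat (length (d (Suc i))) (length (d i))" for i
      using H(1)[of i] by (simp add: graded_mat_def)
    note b = ideal_stepD(1)[OF step[OF k]] and b' = ideal_step_is_ideal[OF step[OF k]]
    have bb': "y \<in> b (Suc k)" if "y \<in> b k" for y
      unfolding ideal_stepD(2)[OF step[OF k]] using that by (intro exI[of _ 0]) simp
    define w' where "w' = H k *\<^sub>v w"
    have w'c: "w' \<in> ?F (Suc k)" unfolding w'_def using mult_mat_vec_carrier[OF Hc wc] .
    \<comment> \<open>\<open>R\<close> is the correction term \<open>H i (A i w)\<close> of the
      homotopy; its entries are in \<open>b k\<close> because \<open>w\<close> is a cycle there. In
      degree \<open>0\<close> there is no preceding homotopy, and \<open>R = 0\<close>.\<close>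
    obtain R where R: "R \<in> ?F k" "vec_in (b k) R" "A k *\<^sub>v w' = f k \<cdot>\<^sub>v w - R"
    proof (cases k)
      case 0
      have "A k *\<^sub>v w' = f k \<cdot>\<^sub>v w - 0\<^sub>v (length (d k))"
        using H(2)[of w] wc unfolding w'_def 0 by auto
      then show thesis
        using that[of "0\<^sub>v (length (d k))"] is_idealD(1)[OF b] by (auto simp: vec_in_def)
    next
      case (Suc i)
      have "H i *\<^sub>v (A i *\<^sub>v w) \<in> ?F k"
        unfolding Suc by (rule mult_mat_vec_carrier[OF Hc mult_A_carrier])
      moreover have "vec_in (b k) (H i *\<^sub>v (A i *\<^sub>v w))"
        by (rule vec_in_mult_mat_vec[OF b Hc mult_A_carrier w(2)[OF Suc]])
      moreover have "A k *\<^sub>v w' = f k \<cdot>\<^sub>v w - H i *\<^sub>v (A i *\<^sub>v w)"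
        using H(3)[of w i] wc unfolding w'_def Suc by simp
      ultimately show thesis by (rule that)
    qed
    have Aw': "(A k *\<^sub>v w') $ a = f k * w $ a - R $ a" if "a < length (d k)" for a
      unfolding R(3) using that R(1) wc by simp
    have fk: "f k \<in> b (Suc k)"
      unfolding ideal_stepD(2)[OF step[OF k]] using cong[OF k] by blast
    have "hvec (map ((+) s) (d k)) (s + k * s) w"
      using w(1) by (auto simp: hvec_def add.left_commute[of _ s])
    then have hom: "hvec (d (Suc k)) (Suc k * s) w'"
      unfolding w'_def using hvec_mult_mat_vec[OF H(1)] by simp
    have cyc: "vec_in (b (Suc k)) (A k *\<^sub>v w')"
      unfolding vec_in_def
    proof (intro allI impI)
      fix a assume "a < dim_vec (A k *\<^sub>v w')"
      then have a: "a < length (d k)" using A_carrier[of k] by simp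
      have "R $ a \<in> b (Suc k)" using R(1,2) a by (intro bb') (simp add: vec_in_def)
      then show "(A k *\<^sub>v w') $ a \<in> b (Suc k)"
        unfolding Aw'[OF a] by (rule is_idealD(6)[OF b' is_idealD(4)[OF b' fk]])
    qed
    have "\<exists>g\<in>I. D' * (\<Prod>t<Suc k. c t) - g \<in> b 0"
      if u: "u \<in> ?F (Suc (Suc k))" "vec_in (b (Suc k)) (D' \<cdot>\<^sub>v w' - A (Suc k) *\<^sub>v u)" for D' u
    proof -
      have car: "D' \<cdot>\<^sub>v w' - A (Suc k) *\<^sub>v u \<in> ?F (Suc k)"
        by (rule minus_carrier_vec[OF smult_carrier_vec[THEN iffD2, OF w'c] mult_A_carrier])
      from iffD1[OF vec_in_step[OF step[OF k] car] u(2)] obtain v where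
        v: "v \<in> ?F (Suc k)" "vec_in (b k) (D' \<cdot>\<^sub>v w' - A (Suc k) *\<^sub>v u - x k \<cdot>\<^sub>v v)" by (elim bexE)
      have xv: "x k \<cdot>\<^sub>v v \<in> ?F (Suc k)" using v(1) by simp
      have "A k *\<^sub>v (D' \<cdot>\<^sub>v w' - A (Suc k) *\<^sub>v u - x k \<cdot>\<^sub>v v) =
          A k *\<^sub>v (D' \<cdot>\<^sub>v w') - A k *\<^sub>v (A (Suc k) *\<^sub>v u) - A k *\<^sub>v (x k \<cdot>\<^sub>v v)"
        using mult_mat_vec_diff[OF A_carrier car xv]
          mult_mat_vec_diff[OF A_carrier smult_carrier_vec[THEN iffD2, OF w'c] mult_A_carrier] by simp
      also have "\<dots> = D' \<cdot>\<^sub>v (A k *\<^sub>v w') - 0\<^sub>v (length (d k)) - x k \<cdot>\<^sub>v (A k *\<^sub>v v)"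
        unfolding A_A[OF u(1)] mult_mat_vec_smult[OF A_carrier w'c] mult_mat_vec_smult[OF A_carrier v(1)] ..
      finally have eq: "A k *\<^sub>v (D' \<cdot>\<^sub>v w' - A (Suc k) *\<^sub>v u - x k \<cdot>\<^sub>v v) =
          D' \<cdot>\<^sub>v (A k *\<^sub>v w') - 0\<^sub>v (length (d k)) - x k \<cdot>\<^sub>v (A k *\<^sub>v v)" .
      have "vec_in (b k) (A k *\<^sub>v (D' \<cdot>\<^sub>v w' - A (Suc k) *\<^sub>v u - x k \<cdot>\<^sub>v v))"
        by (rule vec_in_mult_mat_vec[OF b A_carrier minus_carrier_vec[OF car xv] v(2)])
      then have m: "D' * (A k *\<^sub>v w') $ a - x k * (A k *\<^sub>v v) $ a \<in> b k" if "a < length (d k)" for a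
        using that A_carrier[of k] unfolding eq vec_in_def by (auto simp del: index_mult_mat_vec)
      \<comment> \<open>Replacing \<open>f k\<close> by \<open>x k * c k\<close> and dropping
        \<open>R\<close> turns the boundary relation into a multiple of \<open>x k\<close>, which
        cancels modulo \<open>b k\<close>.\<close>
      have "vec_in (b k) ((D' * c k) \<cdot>\<^sub>v w - A k *\<^sub>v v)"
        unfolding vec_in_def
      proof (intro allI impI)
        fix a assume "a < dim_vec ((D' * c k) \<cdot>\<^sub>v w - A k *\<^sub>v v)"
        then have a: "a < length (d k)" using A_carrier[of k] by simp
        have "R $ a \<in> b k" using R(1,2) a by (simp add: vec_in_def)
        then have "D' * (A k *\<^sub>v w') $ a - x k * (A k *\<^sub>v v) $ a - (f k - x k * c k) * (D' * w $ a) + D' * R $ a \<in> b k"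
          by (intro is_idealD(2)[OF b] is_idealD(6)[OF b m[OF a]] is_idealD(4)[OF b cong[OF k]] is_idealD(3)[OF b])
        also have "D' * (A k *\<^sub>v w') $ a - x k * (A k *\<^sub>v v) $ a - (f k - x k * c k) * (D' * w $ a) + D' * R $ a =
            x k * (D' * c k * w $ a - (A k *\<^sub>v v) $ a)"
          unfolding Aw'[OF a] by (simp add: algebra_simps del: index_mult_mat_vec)
        finally have "D' * c k * w $ a - (A k *\<^sub>v v) $ a \<in> b k"
          by (rule ideal_stepD(3)[OF step[OF k]])
        then show "((D' * c k) \<cdot>\<^sub>v w - A k *\<^sub>v v) $ a \<in> b k"
          using a wc A_carrier[of k] by (simp del: index_mult_mat_vec)
      qed
      from D[OF v(1) this] show ?thesis by (simp add: mult_ac)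
    qed
    then have "P (Suc k) w'" unfolding P_def using hom cyc by blast
    then show ?case ..
  qed
  from this[of n] obtain w where Pw: "P n w" by auto
  then have w: "hvec (d n) (n * s) w" unfolding P_def by simp
  have D: "\<exists>g\<in>I. D * (\<Prod>t<n. c t) - g \<in> b 0"
    if "u \<in> ?F (Suc n)" "vec_in (b n) (D \<cdot>\<^sub>v w - A n *\<^sub>v u)" for D u
    using Pw that unfolding P_def by blast
  have wc: "w \<in> ?F n" using w by (simp add: hvec_def)
  \<comment> \<open>With \<open>D = 1\<close> and the zero vector as bounding element,
    \<open>w\<close> in \<open>b n\<close> would put the product of the \<open>c t\<close> into
    \<open>I + b 0\<close>.\<close>
  have "\<not> vec_in (b n) w"
  proof
    assume "vec_in (b n) w"
    moreover have "1 \<cdot>\<^sub>v w - A n *\<^sub>v 0\<^sub>v (length (d (Suc n))) = w"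
      using wc A_carrier[of n] by (intro eq_vecI) auto
    ultimately have "\<exists>g\<in>I. 1 * (\<Prod>t<n. c t) - g \<in> b 0"
      by (intro D[of "0\<^sub>v (length (d (Suc n)))"]) simp_all
    then show False using nonmem by simp
  qed
  then obtain a where a: "a < length (d n)" "w $ a \<notin> b n"
    using wc by (auto simp: vec_in_def)
  \<comment> \<open>A constant term has degree \<open>0\<close>, so homogeneity of \<open>w\<close>
    reads off the degree of the basis element.\<close>
  then have "0 \<in> Poly_Mapping.keys (w $ a)" using const by (auto simp: in_keys_iff)
  then have "mono_deg (0 :: 'v \<Rightarrow>\<^sub>0 nat) + d n ! a = n * s" using w a(1) unfolding hvec_def by blast
  then have "d n ! a = n * s" by simp
  then show ?thesis using a(1) nth_mem by metis
qed

end

text \<open>The resolution behind \<open>graded_betti\<close> is picked by choice, so membership is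
  assumed for all minimal resolutions. \<open>length_le\<close> makes the set of differences finite,
  which turns \<open>Max\<close> into an upper bound for it.\<close>

lemma regularity_ge:
  fixes I :: "('v :: finite, 'k :: field) mpoly set"
  assumes ex: "\<exists>d A. minimal_graded_free_resolution I d A"
    and mem: "\<And>d A. minimal_graded_free_resolution I d A \<Longrightarrow> j \<in> set (d i)"
  shows "int j - int i \<le> regularity I"
proof -
  define d where "d = (SOME d. \<exists>A. minimal_graded_free_resolution I d A)"
  have "\<exists>A. minimal_graded_free_resolution I d A"
    unfolding d_def using ex by (rule someI_ex)
  then obtain A where A: "minimal_graded_free_resolution I d A" ..
  interpret graded_resolution I d A by unfold_locales (rule A)
  have nz: "graded_betti I i j \<noteq> 0 \<longleftrightarrow> j \<in> set (d i)" for i j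
    by (simp add: graded_betti_def d_def[symmetric] count_list_0_iff)
  let ?S = "{int j - int i | i j. graded_betti I i j \<noteq> 0}"
  have "?S \<subseteq> (\<Union>i\<in>{..card (UNIV :: 'v set)}. (\<lambda>j. int j - int i) ` set (d i))"
  proof
    fix r assume "r \<in> ?S"
    then obtain i j where r: "r = int j - int i" "j \<in> set (d i)" unfolding nz by blast
    then have "i \<le> card (UNIV :: 'v set)" using length_le[of i] by (cases "i \<le> card (UNIV :: 'v set)") auto
    then show "r \<in> (\<Union>i\<in>{..card (UNIV :: 'v set)}. (\<lambda>j. int j - int i) ` set (d i))"
      using r by blast
  qed
  then have "finite ?S" by (rule finite_subset) auto
  moreover have "int j - int i \<in> ?S" using mem[OF A] nz[of i j] by blast
  ultimately show ?thesis unfolding regularity_def by (rule Max_ge)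
qed

section \<open>A chip-firing functional\<close>

text \<open>
  A monomial in variables \<open>a\<^sub>k\<close> (\<open>k \<in> Z\<close>) is a distribution of chips on \<open>Z\<close>, and rewriting
  \<open>a\<^sub>k\<^sup>2\<close> to \<open>a\<^sub>k\<^sub>-\<^sub>1 a\<^sub>k\<^sub>+\<^sub>1\<close> fires the site \<open>k\<close>. The predicate below holds for the distributions that
  stabilise to one chip on each site without a chip leaving \<open>Z\<close>.
\<close>

inductive stabilizes :: "(nat \<Rightarrow> 'm :: comm_monoid_add) \<Rightarrow> nat set \<Rightarrow> 'm \<Rightarrow> bool"
  for e :: "nat \<Rightarrow> 'm" and Z :: "nat set"
where
  base: "stabilizes e Z (\<Sum>k\<in>Z. e k)"
| fire: "stabilizes e Z (m + e k + e (Suc (Suc k))) \<Longrightarrow> k \<in> Z \<Longrightarrow> Suc k \<in> Z \<Longrightarrow> Suc (Suc k) \<in> Z \<Longrightarrow>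
    stabilizes e Z (m + e (Suc k) + e (Suc k))"

text \<open>Abelian property of chip firing: a site with two chips may be fired first. If a
  stabilising sequence starts at another site, that move leaves two chips on \<open>k\<close>, and
  the two firings commute. In the base case no site has two chips.\<close>

lemma stabilizes_fire_inversion:
  fixes rep :: "nat \<Rightarrow> 'v"
  defines "e \<equiv> \<lambda>k. Poly_Mapping.single (rep k) (1 :: nat)"
  assumes Z: "finite Z" "inj_on rep Z" and k: "k \<in> Z"
    and st: "stabilizes e Z (m + e k + e k)"
  shows "\<exists>j. k = Suc j \<and> j \<in> Z \<and> Suc k \<in> Z \<and> stabilizes e Z (m + e j + e (Suc k))"
proof -
  have lk: "Poly_Mapping.lookup (e l) (rep k) = (if l = k then 1 else 0)" if "l \<in> Z" for l
    using Z(2) k that by (auto simp: e_def lookup_single when_def inj_on_def)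
  have "\<exists>j. k = Suc j \<and> j \<in> Z \<and> Suc k \<in> Z \<and> stabilizes e Z (m + e j + e (Suc k))"
    if "stabilizes e Z M" "M = m + e k + e k" for M m
    using that
  proof (induction arbitrary: m rule: stabilizes.induct)
    case base
    have "Poly_Mapping.lookup (\<Sum>k\<in>Z. e k) (rep k) = (\<Sum>l\<in>Z. if l = k then 1 else 0)"
      unfolding lookup_sum by (intro sum.cong refl lk)
    also have "\<dots> = 1" using Z(1) k by simp
    finally show ?case using lk[OF k] unfolding base by (simp add: lookup_add)
  next
    case (fire m' l)
    show ?case
    proof (cases "Suc l = k")
      case True
      then have "m' = m" using fire.prems by simp
      then show ?thesis using True fire.hyps by (intro exI[of _ l]) simp
    next
      case False
      have "Poly_Mapping.lookup (m' + e (Suc l) + e (Suc l)) (rep k) \<ge> 2"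
        unfolding fire.prems using lk[OF k] by (simp add: lookup_add)
      then have ge: "Poly_Mapping.lookup m' (rep k) \<ge> 2"
        using lk[OF fire.hyps(3)] False by (simp add: lookup_add)
      define m2 where "m2 = m' - e k - e k"
      have m': "m' = m2 + e k + e k"
        by (rule poly_mapping_eqI)
          (use ge in \<open>auto simp: m2_def lookup_add lookup_minus e_def lookup_single when_def\<close>)
      have "m + (e k + e k) = (m2 + e (Suc l) + e (Suc l)) + (e k + e k)"
        using fire.prems unfolding m' by (simp add: ac_simps)
      then have m: "m = m2 + e (Suc l) + e (Suc l)" by (rule add_right_imp_eq)
      have "m' + e l + e (Suc (Suc l)) = (m2 + e l + e (Suc (Suc l))) + e k + e k"
        unfolding m' by (simp add: ac_simps)
      \<comment> \<open>The induction hypothesis fires \<open>k\<close> after \<open>Suc l\<close>;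
        undoing the firing of \<open>Suc l\<close> gives the state in which only \<open>k\<close>
        has fired.\<close>
      from fire.IH[OF this] obtain j where j: "k = Suc j" "j \<in> Z" "Suc k \<in> Z"
        "stabilizes e Z (m2 + e l + e (Suc (Suc l)) + e j + e (Suc k))" by blast
      have "m2 + e l + e (Suc (Suc l)) + e j + e (Suc k) = (m2 + e j + e (Suc k)) + e l + e (Suc (Suc l))"
        by (simp add: ac_simps)
      with j(4) have "stabilizes e Z ((m2 + e j + e (Suc k)) + e (Suc l) + e (Suc l))"
        by (intro stabilizes.fire fire.hyps) simp
      also have "(m2 + e j + e (Suc k)) + e (Suc l) + e (Suc l) = m + e j + e (Suc k)"
        unfolding m by (simp add: ac_simps)
      finally show ?thesis using j by blast
    qed
  qed
  from this[OF st refl] show ?thesis .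
qed

definition coeff_sum :: "('m \<Rightarrow> bool) \<Rightarrow> ('m \<Rightarrow>\<^sub>0 'k :: comm_ring_1) \<Rightarrow> 'k" where
  "coeff_sum P f = (\<Sum>m\<in>Poly_Mapping.keys f. Poly_Mapping.lookup f m when P m)"

lemma coeff_sum_superset:
  "finite S \<Longrightarrow> Poly_Mapping.keys f \<subseteq> S \<Longrightarrow> coeff_sum P f = (\<Sum>m\<in>S. Poly_Mapping.lookup f m when P m)"
  unfolding coeff_sum_def by (rule sum.mono_neutral_left) (auto simp: in_keys_iff)

lemma coeff_sum_add: "coeff_sum P (f + g) = coeff_sum P f + coeff_sum P g"
proof -
  let ?S = "Poly_Mapping.keys f \<union> Poly_Mapping.keys g"
  have *: "coeff_sum P (f + g) = (\<Sum>m\<in>?S. Poly_Mapping.lookup (f + g) m when P m)"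
    "coeff_sum P f = (\<Sum>m\<in>?S. Poly_Mapping.lookup f m when P m)"
    "coeff_sum P g = (\<Sum>m\<in>?S. Poly_Mapping.lookup g m when P m)"
    using keys_add[of f g] by (auto intro!: coeff_sum_superset)
  show ?thesis unfolding * sum.distrib[symmetric] by (rule sum.cong) (auto simp: lookup_add when_def)
qed

lemma coeff_sum_zero [simp]: "coeff_sum P 0 = 0"
  by (simp add: coeff_sum_def)

lemma coeff_sum_diff: "coeff_sum P (f - g) = coeff_sum P f - coeff_sum P g"
  using coeff_sum_add[of P "f - g" g] by simp

lemma coeff_sum_single: "coeff_sum P (Poly_Mapping.single m c) = (c when P m)"
  by (subst coeff_sum_superset[of "{m}"]) auto

lemma coeff_sum_binomial:
  fixes h :: "('v, 'k :: comm_ring_1) mpoly"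
  assumes "\<And>m. P (m + a) \<longleftrightarrow> P (m + b)"
  shows "coeff_sum P (h * (Poly_Mapping.single a 1 - Poly_Mapping.single b 1)) = 0"
  by (induction h rule: poly_mapping_single_induct)
    (simp_all add: distrib_right right_diff_distrib coeff_sum_add coeff_sum_diff mult_single
      coeff_sum_single assms)

lemma coeff_sum_monomial:
  fixes h :: "('v, 'k :: comm_ring_1) mpoly"
  assumes "\<And>m. \<not> P (m + a)"
  shows "coeff_sum P (h * Poly_Mapping.single a 1) = 0"
  by (induction h rule: poly_mapping_single_induct)
    (simp_all add: distrib_right coeff_sum_add mult_single coeff_sum_single assms)

text \<open>The functional that sums the coefficients of stabilising monomials takes the value
  \<open>1\<close> on the product of all \<open>a k\<close>. It vanishes on multiples of a binomial,
  since by the abelian property both terms of the binomial times a monomial stabilise or neither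
  does.\<close>

lemma firing_ideal:
  fixes rep :: "nat \<Rightarrow> 'v"
  assumes Z: "finite Z" "inj_on rep Z" "0 \<notin> Z"
  defines "a \<equiv> \<lambda>k. if k \<in> Z then mvar (rep k) else (0 :: ('v, 'k :: field) mpoly)"
  obtains N where "is_ideal N" "(\<Prod>k\<in>Z. a k) \<notin> N"
    "\<And>j. Suc j \<in> Z \<Longrightarrow> a (Suc j) * a (Suc j) - a j * a (Suc (Suc j)) \<in> N"
proof -
  define e where "e k = Poly_Mapping.single (rep k) (1 :: nat)" for k
  note inversion = stabilizes_fire_inversion[OF Z(1,2), folded e_def]
  let ?P = "stabilizes e Z"
  \<comment> \<open>The largest ideal contained in the kernel of the functional.\<close>
  define N where "N = {f :: ('v, 'k) mpoly. \<forall>h. coeff_sum ?P (h * f) = 0}"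
  have ae: "a k = Poly_Mapping.single (e k) 1" if "k \<in> Z" for k
    using that by (simp add: a_def mvar_def e_def)
  have N: "is_ideal N"
    unfolding is_ideal_def N_def by (auto simp: distrib_left coeff_sum_add mult.assoc[symmetric])
  have prod: "(\<Prod>k\<in>S. a k) = Poly_Mapping.single (\<Sum>k\<in>S. e k) 1" if "S \<subseteq> Z" for S
    using finite_subset[OF that Z(1)] that
    by (induction S rule: finite_induct) (simp_all add: ae mult_single)
  have "coeff_sum ?P (1 * (\<Prod>k\<in>Z. a k)) = 1"
    by (simp add: prod coeff_sum_single stabilizes.base)
  then have "(\<Prod>k\<in>Z. a k) \<notin> N"
    unfolding N_def mem_Collect_eq by (metis zero_neq_one)
  moreover have "a (Suc j) * a (Suc j) - a j * a (Suc (Suc j)) \<in> N" if j: "Suc j \<in> Z" for j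
  proof (cases "j \<in> Z \<and> Suc (Suc j) \<in> Z")
    case True
    have "?P (m + (e (Suc j) + e (Suc j))) \<longleftrightarrow> ?P (m + (e j + e (Suc (Suc j))))" for m
      using inversion[OF j, of m] stabilizes.fire[of e Z m j] True j by (auto simp: add.assoc)
    then show ?thesis
      unfolding N_def using True j by (simp add: ae mult_single coeff_sum_binomial)
  next
    case False
    \<comment> \<open>A neighbour outside \<open>Z\<close> is zero, so only the square is left.
      Firing would push a chip out of \<open>Z\<close>, so no stabilising distribution has two chips
      on this site.\<close>
    have "\<not> ?P (m + (e (Suc j) + e (Suc j)))" for m
      using inversion[OF j, of m] False by (auto simp: add.assoc)
    moreover have "a j * a (Suc (Suc j)) = 0" using False by (auto simp: a_def)
    ultimately show ?thesis
      unfolding N_def using j by (simp add: ae mult_single coeff_sum_monomial)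
  qed
  ultimately show thesis using that N by blast
qed

section \<open>Parity binomial edge ideals\<close>

definition edge_poly :: "'n \<Rightarrow> 'n \<Rightarrow> ('n + 'n, 'k :: comm_ring_1) mpoly" where
  "edge_poly i j = mvar (Inl i) * mvar (Inl j) - mvar (Inr i) * mvar (Inr j)"

lemma edge_poly_commute: "edge_poly i j = edge_poly j i"
  by (simp add: edge_poly_def mult.commute)

lemma parity_edge_ideal_eq: "parity_edge_ideal E = genideal ring_of_type_algebra {edge_poly i j | i j. {i, j} \<in> E}"
  by (simp add: parity_edge_ideal_def edge_poly_def)

lemma is_ideal_parity_edge_ideal: "is_ideal (parity_edge_ideal E)"
  unfolding parity_edge_ideal_eq by (rule is_ideal_genideal)

lemma edge_poly_in_parity_edge_ideal: "{i, j} \<in> E \<Longrightarrow> edge_poly i j \<in> parity_edge_ideal E"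
  unfolding parity_edge_ideal_eq by (rule subsetD[OF genideal_type_algebra_subset]) blast

lemma parity_edge_ideal_subset:
  "is_ideal N \<Longrightarrow> (\<And>i j. {i, j} \<in> E \<Longrightarrow> edge_poly i j \<in> N) \<Longrightarrow> parity_edge_ideal E \<subseteq> N"
  unfolding parity_edge_ideal_eq by (rule genideal_type_algebra_minimal) auto

lemma homogeneous_edge_poly: "homogeneous 2 (edge_poly i j)"
  unfolding edge_poly_def
  using homogeneous_mult[OF homogeneous_mvar homogeneous_mvar]
  by (intro homogeneous_diff) (simp_all add: numeral_2_eq_2)

lemma hcomp_parity_edge_ideal:
  fixes f :: "('n + 'n, 'k :: comm_ring_1) mpoly"
  assumes "f \<in> parity_edge_ideal E"
  shows "hcomp e f \<in> parity_edge_ideal E"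
proof -
  let ?I = "parity_edge_ideal E :: ('n + 'n, 'k) mpoly set"
  have "is_ideal ?I" by (rule is_ideal_parity_edge_ideal)
  note I = is_idealD[OF this]
  let ?N = "{f. \<forall>e. hcomp e f \<in> ?I}"
  have "hcomp e (r * f) \<in> ?I" if "\<And>e. hcomp e f \<in> ?I" for e r f
  proof (induction r rule: poly_mapping_single_induct)
    case zero
    show ?case using I(1) by simp
  next
    case (add m c r)
    have "hcomp e (Poly_Mapping.single m c * f) \<in> ?I"
      unfolding hcomp_single_mult using I(1) I(3)[OF that] by simp
    then show ?case using I(2)[OF _ add] by (simp add: distrib_right hcomp_add)
  qed
  then have "is_ideal ?N"
    unfolding is_ideal_def using I(1,2) by (simp add: hcomp_add)
  moreover have "edge_poly i j \<in> ?N" if "{i, j} \<in> E" for i j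
    using edge_poly_in_parity_edge_ideal[OF that] I(1)
    by (simp add: hcomp_homogeneous[OF homogeneous_edge_poly] when_def)
  ultimately have "?I \<subseteq> ?N" by (rule parity_edge_ideal_subset)
  then show ?thesis using assms by blast
qed

lemma lookup_zero_parity_edge_ideal:
  fixes f :: "('n + 'n, 'k :: comm_ring_1) mpoly"
  assumes "f \<in> parity_edge_ideal E"
  shows "Poly_Mapping.lookup f 0 = 0"
proof -
  have "parity_edge_ideal E \<subseteq> (lin_ideal id id {} :: ('n + 'n, 'k) mpoly set)"
    by (rule parity_edge_ideal_subset[OF is_ideal_lin_ideal])
      (simp add: lin_ideal_def edge_poly_def subst_diff subst_mult kill_subst_def)
  then show ?thesis using assms unfolding lin_ideal_empty by blast
qed

lemma parity_edge_ideal_resolution_exists: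
  "\<exists>d A. minimal_graded_free_resolution (parity_edge_ideal E :: ('n :: finite + 'n, 'k :: field) mpoly set) d A"
  by (rule minimal_graded_free_resolution_exists)
    (simp_all add: is_ideal_parity_edge_ideal hcomp_parity_edge_ideal lookup_zero_parity_edge_ideal)

text \<open>
  After \<open>x\<close> and \<open>y\<close> are swapped at every second vertex, the binomial of an edge \<open>{v\<^sub>k\<^sub>-\<^sub>1, v\<^sub>k}\<close> of a path becomes a
  \<open>2\<close>-minor, and the linear section that identifies the two entries on its diagonal, both called
  \<open>a\<^sub>k\<close>, turns it into \<open>a\<^sub>k\<^sup>2 - a\<^sub>k\<^sub>-\<^sub>1 a\<^sub>k\<^sub>+\<^sub>1\<close>. The variables of \<open>z\<close> are sent to \<open>0\<close>.
\<close>

lemma regularity_ge_card_edges: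
  fixes E :: "'n :: finite set set"
  assumes vs: "distinct vs" "z \<notin> set vs"
    and Z: "Z \<subseteq> {1..<length vs}"
    and edge: "\<And>k. k \<in> Z \<Longrightarrow> {vs ! (k - 1), vs ! k} \<in> E"
    and cover: "\<And>i j. {i, j} \<in> E \<Longrightarrow> i = z \<or> j = z \<or> (\<exists>k\<in>Z. {i, j} = {vs ! (k - 1), vs ! k})"
  shows "int (card Z) \<le> regularity (parity_edge_ideal E :: ('n + 'n, 'k :: field) mpoly set)"
proof -
  let ?I = "parity_edge_ideal E :: ('n + 'n, 'k) mpoly set"
  define pos where "pos v = (THE k. k < length vs \<and> vs ! k = v)" for v
  have pos: "pos (vs ! k) = k" if "k < length vs" for k
    unfolding pos_def using that vs(1) by (intro the_equality) (auto simp: nth_eq_iff_index_eq)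
  have vz: "vs ! k \<noteq> z" if "k < length vs" for k
    using that vs(2) nth_mem by metis
  \<comment> \<open>Position \<open>p\<close> carries the indices \<open>p\<close> and
    \<open>p + 1\<close>, with \<open>x\<close> and \<open>y\<close> exchanged according to parity;
    the edge at \<open>k\<close> thus has index \<open>k\<close> twice in one term and
    \<open>k - 1\<close>, \<open>k + 1\<close> in the other. Index \<open>0\<close> is not in
    \<open>Z\<close>, so the variables of \<open>z\<close> vanish.\<close>
  define ix where "ix c v = (if v = z then 0 else if even (pos v) = c then Suc (pos v) else pos v)" for c v
  define idx :: "'n + 'n \<Rightarrow> nat" where "idx = case_sum (ix True) (ix False)"
  define rep where "rep k = (if odd k then Inl (vs ! k) else Inr (vs ! k))" for k
  have idx: "idx (Inl (vs ! k)) = (if even k then Suc k else k)"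
    "idx (Inr (vs ! k)) = (if even k then k else Suc k)" if "k < length vs" for k
    using that pos vz by (simp_all add: idx_def ix_def)
  have idxz: "idx (Inl z) = 0" "idx (Inr z) = 0" by (simp_all add: idx_def ix_def)
  have Zk: "0 < k" "k < length vs" "k - 1 < length vs" if "k \<in> Z" for k
    using subsetD[OF Z that] by auto
  have "0 \<notin> Z" using Zk(1) by blast
  have "finite Z" using Z by (rule finite_subset) simp
  have idx_rep: "idx (rep k) = k" if "k \<in> Z" for k
    using idx[OF Zk(2)[OF that]] by (simp add: rep_def)
  then have "inj_on rep Z" by (rule inj_on_inverseI)
  define a where "a Y k = (if k \<in> Y then mvar (rep k) else 0 :: ('n + 'n, 'k) mpoly)" for Y k
  have kill: "kill_subst idx rep Y v = a Y (idx v)" for Y v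
    by (simp add: kill_subst_def a_def)
  \<comment> \<open>For even \<open>k\<close> the square comes from the \<open>y\<close> variables,
    hence the sign.\<close>
  define f where "f k = (if odd k then edge_poly (vs ! (k - 1)) (vs ! k)
      else - edge_poly (vs ! (k - 1)) (vs ! k) :: ('n + 'n, 'k) mpoly)" for k
  have subst_f: "subst (kill_subst idx rep Y) (f k) = a Y k * a Y k - a Y (k - 1) * a Y (Suc k)"
    if k: "k \<in> Z" for k Y
  proof -
    obtain j where j: "k = Suc j" using Zk(1)[OF k] by (cases k) auto
    show ?thesis
      using idx[of j] idx[of "Suc j"] Zk(2,3)[OF k] unfolding j
      by (auto simp: f_def edge_poly_def subst_diff subst_uminus subst_mult kill mult.commute)
  qed
  have f_I: "f k \<in> ?I" and f_hom: "homogeneous 2 (f k)" if "k \<in> Z" for k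
  proof -
    have e: "edge_poly (vs ! (k - 1)) (vs ! k) \<in> ?I"
      by (rule edge_poly_in_parity_edge_ideal[OF edge[OF that]])
    then show "f k \<in> ?I"
      unfolding f_def using is_idealD(5)[OF is_ideal_parity_edge_ideal e] by simp
    show "homogeneous 2 (f k)"
      unfolding f_def by (simp add: homogeneous_edge_poly homogeneous_uminus)
  qed
  obtain N where N: "is_ideal N" "(\<Prod>k\<in>Z. a Z k) \<notin> N"
    "\<And>j. Suc j \<in> Z \<Longrightarrow> a Z (Suc j) * a Z (Suc j) - a Z j * a Z (Suc (Suc j)) \<in> N"
    by (rule firing_ideal[OF \<open>finite Z\<close> \<open>inj_on rep Z\<close> \<open>0 \<notin> Z\<close>]) (rule that[unfolded a_def])
  have subst_f_N: "subst (kill_subst idx rep Z) (f k) \<in> N" if k: "k \<in> Z" for k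
  proof -
    obtain j where j: "k = Suc j" using Zk(1)[OF k] by (cases k) auto
    show ?thesis unfolding subst_f[OF k] using N(3)[of j] k j by simp
  qed
  \<comment> \<open>Edges at \<open>z\<close> are sent to zero, all others to a firing binomial up
    to sign.\<close>
  have "?I \<subseteq> {g. subst (kill_subst idx rep Z) g \<in> N}"
  proof (rule parity_edge_ideal_subset)
    show "is_ideal {g. subst (kill_subst idx rep Z) g \<in> N}"
      unfolding is_ideal_def using is_idealD[OF N(1)] by (simp add: subst_add subst_mult)
    fix i j assume "{i, j} \<in> E"
    from cover[OF this] consider "i = z \<or> j = z" | k where "k \<in> Z" "{i, j} = {vs ! (k - 1), vs ! k}" by blast
    then have "subst (kill_subst idx rep Z) (edge_poly i j) \<in> N"
    proof cases
      case 1
      then have "subst (kill_subst idx rep Z) (edge_poly i j) = (0 :: ('n + 'n, 'k) mpoly)"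
        using \<open>0 \<notin> Z\<close> by (auto simp: edge_poly_def subst_diff subst_mult kill idxz a_def)
      then show ?thesis using is_idealD(1)[OF N(1)] by simp
    next
      case (2 k)
      have "edge_poly i j = (edge_poly (vs ! (k - 1)) (vs ! k) :: ('n + 'n, 'k) mpoly)"
        using 2(2) by (auto simp: doubleton_eq_iff edge_poly_commute)
      then have "edge_poly i j = f k \<or> edge_poly i j = - f k" by (simp add: f_def)
      then show ?thesis
        using subst_f_N[OF 2(1)] is_idealD(5)[OF N(1) subst_f_N[OF 2(1)]] by (auto simp: subst_uminus)
    qed
    then show "edge_poly i j \<in> {g. subst (kill_subst idx rep Z) g \<in> N}" by simp
  qed
  then have I_N: "subst (kill_subst idx rep Z) g \<in> N" if "g \<in> ?I" for g using that by blast
  define ks where "ks = sorted_list_of_set Z"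
  define n where "n = card Z"
  have ks: "sorted ks" "distinct ks" "set ks = Z" "length ks = n"
    using \<open>finite Z\<close> by (simp_all add: ks_def n_def)
  have ksZ: "ks ! t \<in> Z" if "t < n" for t using ks nth_mem that by metis
  \<comment> \<open>Indices are killed in increasing order: when \<open>a_k\<close> has its turn,
    \<open>a_(k-1)\<close> is already zero and \<open>f k\<close> is congruent to the square of
    \<open>a_k\<close>. So both factors \<open>x\<close> and \<open>c\<close> are that
    variable.\<close>
  define Y where "Y t = Z - set (take t ks)" for t
  define b where "b t = (lin_ideal idx rep (Y t) :: ('n + 'n, 'k) mpoly set)" for t
  have set_take: "set (take t ks) = (!) ks ` {..<t}" if "t \<le> n" for t
    using nth_image[of t ks] that ks(4) by (simp add: lessThan_atLeast0)
  have kY: "ks ! t \<in> Y t" if "t < n" for t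
  proof -
    have "ks ! t \<noteq> ks ! s" if "s < t" for s
      using that \<open>t < n\<close> ks(2,4) by (simp add: nth_eq_iff_index_eq)
    then show ?thesis unfolding Y_def using ksZ[OF that] set_take[of t] that by auto
  qed
  have Y_Suc: "Y (Suc t) = Y t - {ks ! t}" if "t < n" for t
    unfolding Y_def using that ks(4) by (auto simp: take_Suc_conv_app_nth)
  have pred: "ks ! t - 1 \<notin> Y t" if t: "t < n" for t
  proof
    assume "ks ! t - 1 \<in> Y t"
    then obtain s where s: "s < n" "ks ! t - 1 = ks ! s" "ks ! t - 1 \<notin> set (take t ks)"
      unfolding Y_def using ks(3,4) by (metis DiffE in_set_conv_nth)
    have "t \<le> s" using s(2,3) set_take[of t] t by force
    then have "ks ! t \<le> ks ! s" using sorted_nth_mono[OF ks(1)] s(1) ks(4) by simp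
    then show False using s(2) Zk(1)[OF ksZ[OF t]] by simp
  qed
  have mem: "n * 2 \<in> set (d n)" if res: "minimal_graded_free_resolution ?I d A" for d A
  proof -
    interpret graded_resolution ?I d A by unfold_locales (rule res)
    show ?thesis
    proof (rule generator_of_degree)
      fix t assume t: "t < n"
      let ?x = "mvar (rep (ks ! t)) :: ('n + 'n, 'k) mpoly"
      show "f (ks ! t) \<in> ?I" "homogeneous 2 (f (ks ! t))"
        using f_I f_hom ksZ[OF t] by blast+
      show "ideal_step (b t) ?x (b (Suc t))"
        unfolding b_def Y_Suc[OF t]
        by (rule ideal_step_lin_ideal) (use idx_rep kY[OF t] in \<open>auto simp: Y_def\<close>)
      have "subst (kill_subst idx rep (Y t)) ?x = ?x"
        using kY[OF t] idx_rep[OF ksZ[OF t]] by (simp add: kill a_def)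
      moreover have "a (Y t) (ks ! t) = ?x" "a (Y t) (ks ! t - 1) = 0"
        using kY[OF t] pred[OF t] by (simp_all add: a_def)
      ultimately show "f (ks ! t) - ?x * ?x \<in> b t"
        unfolding b_def lin_ideal_def mem_Collect_eq subst_diff subst_mult subst_f[OF ksZ[OF t]] by simp
    next
      have "Y n = {}" unfolding Y_def using ks(3,4) by simp
      then show "{g. Poly_Mapping.lookup g 0 = 0} \<subseteq> b n"
        unfolding b_def by (simp add: lin_ideal_empty)
    next
      fix g assume g: "g \<in> ?I"
      have "(\<Prod>t<n. mvar (rep (ks ! t))) = (\<Prod>k\<in>Z. mvar (rep k) :: ('n + 'n, 'k) mpoly)"
        by (rule prod.reindex_bij_betw[OF bij_betw_nth]) (simp_all add: ks)
      moreover have "subst (kill_subst idx rep Z) (\<Prod>k\<in>Z. mvar (rep k)) = (\<Prod>k\<in>Z. a Z k)"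
        unfolding subst_prod by (rule prod.cong) (simp_all add: kill idx_rep)
      ultimately have "subst (kill_subst idx rep Z) ((\<Prod>t<n. mvar (rep (ks ! t))) - g) =
          (\<Prod>k\<in>Z. a Z k) - subst (kill_subst idx rep Z) g"
        by (simp add: subst_diff)
      also have "\<dots> \<noteq> 0" using N(2) I_N[OF g] by auto
      finally show "(\<Prod>t<n. mvar (rep (ks ! t))) - g \<notin> b 0"
        by (simp add: b_def Y_def lin_ideal_def)
    qed
  qed
  have "int (n * 2) - int n \<le> regularity ?I"
    by (rule regularity_ge[OF parity_edge_ideal_resolution_exists mem])
  then show ?thesis by (simp add: n_def)
qed

section \<open>The v-number\<close>

text \<open>Explicit ideal combinations. The third one reaches the neighbour \<open>x4\<close> of
  \<open>x1\<close> on the attached path without an extra factor \<open>x1\<close>, which keeps the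
  degree of \<open>f\<close> down to \<open>n - 3\<close>; the second lets the same product serve
  all three vertices.\<close>

lemma triangle_annihilator:
  fixes x1 x2 x3 x4 :: "'a :: comm_ring_1"
  assumes N: "is_ideal N" and e12: "x1 * x2 - y1 * y2 \<in> N" and e13: "x1 * x3 - y1 * y3 \<in> N"
    and e23: "x2 * x3 - y2 * y3 \<in> N"
  shows "(x1 - y1) * ((x1 + y1) * x2 * x3) \<in> N"
    and "(x1 + y1) * x2 * x3 - (x2 + y2) * x1 * x3 \<in> N"
    and "x1 * x4 - y1 * y4 \<in> N \<Longrightarrow> (x4 - y4) * ((x1 + y1) * x2 * x3) \<in> N"
proof -
  note N = is_idealD[OF N]
  have "(x1 - y1) * ((x1 + y1) * x2 * x3) =
      (x1 * x3) * (x1 * x2 - y1 * y2) + (y1 * y2) * (x1 * x3 - y1 * y3) - (y1 * y1) * (x2 * x3 - y2 * y3)"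
    by (simp add: algebra_simps)
  then show "(x1 - y1) * ((x1 + y1) * x2 * x3) \<in> N"
    using N(6)[OF N(2)[OF N(3)[OF e12] N(3)[OF e13]] N(3)[OF e23]] by simp
  have "(x1 + y1) * x2 * x3 - (x2 + y2) * x1 * x3 = y1 * (x2 * x3 - y2 * y3) - y2 * (x1 * x3 - y1 * y3)"
    by (simp add: algebra_simps)
  then show "(x1 + y1) * x2 * x3 - (x2 + y2) * x1 * x3 \<in> N"
    using N(6)[OF N(3)[OF e23] N(3)[OF e13]] by simp
  assume e14: "x1 * x4 - y1 * y4 \<in> N"
  have "(x4 - y4) * ((x1 + y1) * x2 * x3) = (x3 * (x2 + y2)) * (x1 * x4 - y1 * y4) -
      (y4 * x3) * (x1 * x2 - y1 * y2) - (x4 * y2) * (x1 * x3 - y1 * y3) + (x4 * y1) * (x2 * x3 - y2 * y3)"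
    by (simp add: algebra_simps)
  then show "(x4 - y4) * ((x1 + y1) * x2 * x3) \<in> N"
    using N(2)[OF N(6)[OF N(6)[OF N(3)[OF e14] N(3)[OF e12]] N(3)[OF e13]] N(3)[OF e23]] by simp
qed

text \<open>One edge passes annihilation on: \<open>x_k (x_(k+1) - y_(k+1))\<close> is the edge
  binomial minus \<open>y_(k+1) (x_k - y_k)\<close>. Each vertex passed costs a factor
  \<open>x_k\<close>. The induction starts at position \<open>1\<close>, so neither the triangle
  vertex nor the last vertex contributes a factor.\<close>

lemma path_annihilator:
  fixes f :: "('n + 'n, 'k :: comm_ring_1) mpoly"
  assumes N: "is_ideal N" and p: "distinct p"
    and edge: "\<And>k. Suc k < length p \<Longrightarrow> edge_poly (p ! k) (p ! Suc k) \<in> N"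
    and start: "(mvar (Inl (p ! 1)) - mvar (Inr (p ! 1))) * f \<in> N"
    and k: "Suc k < length p"
  shows "(mvar (Inl (p ! Suc k)) - mvar (Inr (p ! Suc k))) * ((\<Prod>v\<in>(!) p ` {1..k}. mvar (Inl v)) * f) \<in> N"
  using k
proof (induction k)
  case 0
  show ?case using start by simp
next
  case (Suc k)
  let ?x = "\<lambda>k. mvar (Inl (p ! k)) :: ('n + 'n, 'k) mpoly"
  let ?y = "\<lambda>k. mvar (Inr (p ! k)) :: ('n + 'n, 'k) mpoly"
  define R where "R = (\<Prod>v\<in>(!) p ` {1..k}. mvar (Inl v)) * f"
  have IH: "(?x (Suc k) - ?y (Suc k)) * R \<in> N" using Suc unfolding R_def by simp
  have e: "?x (Suc k) * ?x (Suc (Suc k)) - ?y (Suc k) * ?y (Suc (Suc k)) \<in> N"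
    using edge[of "Suc k"] Suc.prems by (simp add: edge_poly_def)
  have "p ! Suc k \<notin> (!) p ` {1..k}"
    using p Suc.prems by (auto simp: nth_eq_iff_index_eq)
  moreover have "{1..Suc k} = insert (Suc k) {1..k}" by auto
  ultimately have "(\<Prod>v\<in>(!) p ` {1..Suc k}. mvar (Inl v)) * f = ?x (Suc k) * R"
    by (simp add: R_def mult.assoc)
  moreover have "(?x (Suc (Suc k)) - ?y (Suc (Suc k))) * (?x (Suc k) * R) =
      R * (?x (Suc k) * ?x (Suc (Suc k)) - ?y (Suc k) * ?y (Suc (Suc k)))
      - ?y (Suc (Suc k)) * ((?x (Suc k) - ?y (Suc k)) * R)"
    by (simp add: algebra_simps)
  ultimately show ?case
    using is_idealD(6)[OF N is_idealD(3)[OF N e, of R] is_idealD(3)[OF N IH, of "?y (Suc (Suc k))"]] by simp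
qed

text \<open>Surplus factors in \<open>W\<close> are harmless, so one product over the inner vertices
  of all paths handles every vertex.\<close>

lemma path_prod_annihilator:
  fixes f :: "('n + 'n, 'k :: comm_ring_1) mpoly"
  assumes N: "is_ideal N" and p: "distinct p" "2 \<le> length p"
    and edge: "\<And>k. Suc k < length p \<Longrightarrow> edge_poly (p ! k) (p ! Suc k) \<in> N"
    and start: "(mvar (Inl (p ! 0)) - mvar (Inr (p ! 0))) * f \<in> N"
      "(mvar (Inl (p ! 1)) - mvar (Inr (p ! 1))) * f \<in> N"
    and W: "finite W" "set (butlast (tl p)) \<subseteq> W" and v: "v \<in> set p"
  shows "(mvar (Inl v) - mvar (Inr v)) * ((\<Prod>v\<in>W. mvar (Inl v)) * f) \<in> N"
proof -
  obtain k where k: "k < length p" "v = p ! k" using v by (auto simp: in_set_conv_nth)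
  show ?thesis
  proof (cases k)
    case 0
    then show ?thesis
      using is_idealD(3)[OF N start(1), of "\<Prod>v\<in>W. mvar (Inl v)"] k by (simp add: mult.left_commute)
  next
    case (Suc j)
    let ?S = "(!) p ` {1..j}"
    have "?S \<subseteq> set (butlast (tl p))"
    proof
      fix u assume "u \<in> ?S"
      then obtain i where i: "u = p ! i" "1 \<le> i" "i \<le> j" by auto
      then have "u = butlast (tl p) ! (i - 1)" "i - 1 < length (butlast (tl p))"
        using k(1) Suc by (simp_all add: nth_butlast nth_tl)
      then show "u \<in> set (butlast (tl p))" by simp
    qed
    with W(2) have "?S \<subseteq> W" by blast
    then have "(\<Prod>v\<in>W. mvar (Inl v)) = (\<Prod>v\<in>W - ?S. mvar (Inl v)) * (\<Prod>v\<in>?S. mvar (Inl v) :: ('n + 'n, 'k) mpoly)"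
      using W(1) by (rule prod.subset_diff)
    then have "(mvar (Inl v) - mvar (Inr v)) * ((\<Prod>v\<in>W. mvar (Inl v)) * f) =
        (\<Prod>v\<in>W - ?S. mvar (Inl v)) * ((mvar (Inl v) - mvar (Inr v)) * ((\<Prod>v\<in>?S. mvar (Inl v)) * f))"
      by (simp only: mult_ac)
    then show ?thesis
      using is_idealD(3)[OF N path_annihilator[OF N p(1) edge start(2), of j]] k Suc by simp
  qed
qed

lemma two_nonzero:
  assumes "CHAR('k :: field) \<noteq> 2"
  shows "(1 + 1 :: 'k) \<noteq> 0"
proof
  assume "(1 + 1 :: 'k) = 0"
  then have "of_nat 2 = (0 :: 'k)" by simp
  then have "CHAR('k) dvd 2" by (simp only: of_nat_eq_0_iff_char_dvd)
  then have "CHAR('k) \<le> 2" by (rule dvd_imp_le) simp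
  moreover have "CHAR('k) \<noteq> 0" using \<open>CHAR('k) dvd 2\<close> by (metis dvd_0_left_iff zero_neq_numeral)
  moreover have "CHAR('k) \<noteq> 1" by simp
  ultimately show False using assms by linarith
qed

text \<open>\<open>P\<close> is prime and contains \<open>I\<close>, so \<open>I : f\<close> lies in
  \<open>P\<close> as soon as \<open>f\<close> does not; modulo \<open>P\<close> the factor
  \<open>x_1 + y_1\<close> becomes \<open>2 x_1\<close>, which is where the characteristic enters.
  The reverse inclusion is checked on the generators \<open>x_v - y_v\<close>.\<close>

lemma v_number_le:
  fixes E :: "'n :: finite set set"
  assumes char: "CHAR('k :: field) \<noteq> 2"
    and len: "2 \<le> length p" "2 \<le> length q" "2 \<le> length r"
    and dist: "distinct (p @ q @ r)" "set (p @ q @ r) = UNIV"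
    and tri: "{hd p, hd q} \<in> E" "{hd q, hd r} \<in> E" "{hd p, hd r} \<in> E"
    and paths: "path_edges p \<subseteq> E" "path_edges q \<subseteq> E" "path_edges r \<subseteq> E"
  shows "v_number (parity_edge_ideal E :: ('n + 'n, 'k) mpoly set) \<le> length p + length q + length r - 3"
proof -
  let ?I = "parity_edge_ideal E :: ('n + 'n, 'k) mpoly set"
  let ?x = "\<lambda>v. mvar (Inl v) :: ('n + 'n, 'k) mpoly"
  let ?y = "\<lambda>v. mvar (Inr v) :: ('n + 'n, 'k) mpoly"
  define f0 where "f0 a b c = (?x a + ?y a) * ?x b * ?x c" for a b c
  define W where "W = set (butlast (tl p)) \<union> set (butlast (tl q)) \<union> set (butlast (tl r))"
  define f where "f = (\<Prod>v\<in>W. ?x v) * f0 (hd p) (hd q) (hd r)"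
  have I: "is_ideal ?I" by (rule is_ideal_parity_edge_ideal)
  have e: "?x i * ?x j - ?y i * ?y j \<in> ?I" if "{i, j} \<in> E" for i j
    using edge_poly_in_parity_edge_ideal[OF that] by (simp add: edge_poly_def)
  \<comment> \<open>Each path loses its triangle vertex and its leaf, so \<open>W\<close> has
    \<open>n - 6\<close> elements.\<close>
  have "card W = card (set (butlast (tl p) @ butlast (tl q) @ butlast (tl r)))"
    unfolding W_def by (simp add: Un_assoc)
  also have "\<dots> = length (butlast (tl p) @ butlast (tl q) @ butlast (tl r))"
  proof (rule distinct_card)
    have sub: "set (butlast (tl xs)) \<subseteq> set xs" for xs :: "'n list"
      by (cases xs) (auto dest: in_set_butlastD)
    show "distinct (butlast (tl p) @ butlast (tl q) @ butlast (tl r))"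
      using dist(1) sub[of p] sub[of q] sub[of r] by (auto simp: distinct_butlast distinct_tl)
  qed
  finally have "card W + 3 = length p + length q + length r - 3" using len by simp
  moreover have "homogeneous (card W + 3) f"
  proof -
    have "homogeneous (1 + 1 + 1) (f0 (hd p) (hd q) (hd r))"
      unfolding f0_def by (intro homogeneous_mult homogeneous_add homogeneous_mvar)
    moreover have "finite W" by (simp add: W_def)
    ultimately have "homogeneous (card W + (1 + 1 + 1)) f"
      unfolding f_def by (intro homogeneous_mult homogeneous_prod_mvar)
    then show ?thesis by (simp add: numeral_3_eq_3)
  qed
  ultimately have hom: "homogeneous (length p + length q + length r - 3) f" by simp
  \<comment> \<open>The index map identifies \<open>x_v\<close> with \<open>y_v\<close> and kills
    nothing: \<open>?P\<close> is the kernel of the map sending \<open>y_v\<close> to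
    \<open>x_v\<close>.\<close>
  let ?P = "lin_ideal (case_sum id id) Inl UNIV :: ('n + 'n, 'k) mpoly set"
  let ?t = "subst (kill_subst (case_sum id id) Inl UNIV) :: ('n + 'n, 'k) mpoly \<Rightarrow> ('n + 'n, 'k) mpoly"
  have t: "?t (?x v) = ?x v" "?t (?y v) = ?x v" for v by (simp_all add: kill_subst_def)
  have prime: "primeideal ?P ring_of_type_algebra"
  proof (rule primeideal_type_algebraI)
    show "is_ideal ?P" by (rule is_ideal_lin_ideal)
    show "1 \<notin> ?P" by (simp add: lin_ideal_def)
    show "a \<in> ?P \<or> b \<in> ?P" if "a * b \<in> ?P" for a b using that by (rule lin_ideal_prime)
  qed
  have "?I \<subseteq> ?P"
    by (rule parity_edge_ideal_subset[OF is_ideal_lin_ideal])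
      (simp add: lin_ideal_def edge_poly_def subst_diff subst_mult t del: subst_mvar)
  moreover have "f \<notin> ?P"
  proof
    assume "f \<in> ?P"
    then have "?t f = 0" by (simp add: lin_ideal_def)
    then have "(\<Prod>v\<in>W. ?x v) * ((?x (hd p) + ?x (hd p)) * ?x (hd q) * ?x (hd r)) = 0"
      unfolding f_def f0_def by (simp add: subst_mult subst_add subst_prod t del: subst_mvar)
    moreover have "(\<Prod>v\<in>S. ?x v) \<noteq> 0" for S
      by (induction S rule: infinite_finite_induct) (auto dest: mpoly_no_zero_divisors)
    moreover have "?x v + ?x v \<noteq> 0" for v
    proof -
      have "?x v + ?x v = Poly_Mapping.single (Poly_Mapping.single (Inl v) 1) (1 + 1)"
        unfolding mvar_def by (rule single_add[symmetric])
      then have "Poly_Mapping.lookup (?x v + ?x v) (Poly_Mapping.single (Inl v) 1) \<noteq> 0"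
        using two_nonzero[OF char] by (simp only: lookup_single_eq) simp
      then show ?thesis by (metis lookup_zero)
    qed
    ultimately show False using mpoly_no_zero_divisors mvar_nonzero by metis
  qed
  ultimately have sub1: "ideal_colon ?I f \<subseteq> ?P"
    unfolding ideal_colon_def using lin_ideal_prime by blast
  have f0_sym: "f0 a b c - f0 b a c \<in> ?I" "f0 a b c = f0 a c b"
    and f0_tri: "(?x a - ?y a) * f0 a b c \<in> ?I"
    and f0_leg: "{a, u} \<in> E \<Longrightarrow> (?x u - ?y u) * f0 a b c \<in> ?I"
    if "{a, b} \<in> E" "{b, c} \<in> E" "{a, c} \<in> E" for a b c u
    unfolding f0_def using triangle_annihilator[OF I e e e] e that
    by (blast, simp add: mult_ac, blast, blast)
  have leg: "(?x v - ?y v) * f \<in> ?I"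
    if s: "distinct s" "2 \<le> length s" "path_edges s \<subseteq> E" "set (butlast (tl s)) \<subseteq> W" "v \<in> set s"
      and t: "{hd s, b} \<in> E" "{b, c} \<in> E" "{hd s, c} \<in> E"
      and eq: "f0 (hd p) (hd q) (hd r) - f0 (hd s) b c \<in> ?I" for s b c v
  proof -
    have hd: "hd s = s ! 0" using s(2) by (intro hd_conv_nth) auto
    have edges: "{s ! k, s ! Suc k} \<in> E" if "Suc k < length s" for k
      using s(3) that unfolding path_edges_def by blast
    have "(?x v - ?y v) * ((\<Prod>v\<in>W. ?x v) * f0 (hd s) b c) \<in> ?I"
    proof (rule path_prod_annihilator[OF I s(1,2) _ _ _ _ s(4,5)])
      show "edge_poly (s ! k) (s ! Suc k) \<in> ?I" if "Suc k < length s" for k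
        by (rule edge_poly_in_parity_edge_ideal[OF edges[OF that]])
      show "(?x (s ! 0) - ?y (s ! 0)) * f0 (hd s) b c \<in> ?I"
        using f0_tri[OF t] by (simp only: hd)
      show "(?x (s ! 1) - ?y (s ! 1)) * f0 (hd s) b c \<in> ?I"
        using f0_leg[OF t, of "s ! 1"] edges[of 0] s(2) hd by simp
      show "finite W" by (simp add: W_def)
    qed
    \<comment> \<open>Modulo \<open>I\<close> the sum \<open>x + y\<close> may be moved to the
      triangle vertex of the current path.\<close>
    moreover have "(?x v - ?y v) * f = (?x v - ?y v) * ((\<Prod>v\<in>W. ?x v) * f0 (hd s) b c)
        + ((?x v - ?y v) * (\<Prod>v\<in>W. ?x v)) * (f0 (hd p) (hd q) (hd r) - f0 (hd s) b c)"
      by (simp add: f_def algebra_simps)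
    ultimately show ?thesis using is_idealD(2)[OF I _ is_idealD(3)[OF I eq]] by simp
  qed
  have tri': "{hd q, hd p} \<in> E" "{hd r, hd q} \<in> E" "{hd r, hd p} \<in> E"
    using tri by (simp_all add: insert_commute)
  have all: "(?x v - ?y v) * f \<in> ?I" for v
  proof -
    have "v \<in> set p \<or> v \<in> set q \<or> v \<in> set r" using dist(2) by auto
    then show ?thesis
    proof (elim disjE)
      assume "v \<in> set p"
      then show ?thesis
        using dist(1) len tri paths is_idealD(1)[OF I]
        by (intro leg[of p v "hd q" "hd r"]) (auto simp: W_def)
    next
      assume "v \<in> set q"
      then show ?thesis
        using dist(1) len tri tri' paths f0_sym(1)[OF tri(1,2,3)]
        by (intro leg[of q v "hd p" "hd r"]) (auto simp: W_def)
    next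
      assume "v \<in> set r"
      have "f0 (hd p) (hd r) (hd q) - f0 (hd r) (hd p) (hd q) \<in> ?I"
        by (rule f0_sym(1)[OF tri(3) tri'(2) tri(1)])
      then have "f0 (hd p) (hd q) (hd r) - f0 (hd r) (hd p) (hd q) \<in> ?I"
        unfolding f0_sym(2)[OF tri(3) tri'(2) tri(1)] .
      then show ?thesis
        using \<open>v \<in> set r\<close> dist(1) len tri tri' paths
        by (intro leg[of r v "hd p" "hd q"]) (auto simp: W_def)
    qed
  qed
  have "g \<in> ideal_colon ?I f" if "g \<in> ?P" for g
  proof -
    have "mvar v - kill_subst (case_sum id id) Inl UNIV v \<in> ideal_colon ?I f" for v
      using all is_idealD(1)[OF I] is_idealD(5)[OF I all]
      by (cases v) (simp_all add: kill_subst_def ideal_colon_def left_diff_distrib)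
    from diff_subst_in_ideal[OF is_ideal_colon[OF I] this, of g] that
    show ?thesis by (simp add: lin_ideal_def)
  qed
  with sub1 have "ideal_colon ?I f = ?P" by blast
  moreover from this prime have "?P \<in> associated_primes ?I"
    unfolding associated_primes_def by blast
  ultimately show ?thesis
    unfolding v_number_def using hom by (intro Least_le) blast
qed

section \<open>Path edges\<close>

lemma path_edges_simps [simp]:
  "path_edges [] = {}" "path_edges [x] = {}"
  "path_edges (x # y # ys) = insert {x, y} (path_edges (y # ys))"
proof -
  show "path_edges (x # y # ys) = insert {x, y} (path_edges (y # ys))"
  proof (intro equalityI subsetI)
    fix e assume "e \<in> path_edges (x # y # ys)"
    then obtain k where "e = {(x # y # ys) ! k, (x # y # ys) ! Suc k}" "Suc k < length (x # y # ys)"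
      unfolding path_edges_def by blast
    then show "e \<in> insert {x, y} (path_edges (y # ys))"
      by (cases k) (auto simp: path_edges_def)
  next
    fix e assume "e \<in> insert {x, y} (path_edges (y # ys))"
    then consider "e = {x, y}" | k where "e = {(y # ys) ! k, (y # ys) ! Suc k}" "Suc k < length (y # ys)"
      unfolding path_edges_def by blast
    then show "e \<in> path_edges (x # y # ys)"
    proof cases
      case 1
      then show ?thesis unfolding path_edges_def by (intro CollectI exI[of _ 0]) simp
    next
      case (2 k)
      then show ?thesis unfolding path_edges_def by (intro CollectI exI[of _ "Suc k"]) simp
    qed
  qed
qed (simp_all add: path_edges_def)

lemma path_edges_append:
  "p \<noteq> [] \<Longrightarrow> q \<noteq> [] \<Longrightarrow> path_edges (p @ q) = path_edges p \<union> path_edges q \<union> {{last p, hd q}}"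
proof (induction p rule: induct_list012)
  case (2 x)
  then show ?case by (cases q) auto
qed auto

lemma path_edges_rev: "path_edges (rev p) = path_edges p"
proof (induction p rule: induct_list012)
  case (3 x y zs)
  have "path_edges (rev (y # zs) @ [x]) = path_edges (rev (y # zs)) \<union> path_edges [x] \<union> {{last (rev (y # zs)), hd [x]}}"
    by (rule path_edges_append) simp_all
  then show ?case using 3(2) by (simp add: insert_commute)
qed simp_all

text \<open>Two paths share one vertex list. Index \<open>length s\<close> would join the last
  vertex of \<open>s\<close> to the first of \<open>t\<close> and is left out.\<close>

lemma path_edges_append_nth:
  "path_edges s \<union> path_edges t =
     {{(s @ t) ! (k - 1), (s @ t) ! k} | k. k \<in> {1..<length (s @ t)} - {length s}}"
proof (intro equalityI subsetI)
  fix e assume "e \<in> path_edges s \<union> path_edges t"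
  then consider k where "e = {s ! k, s ! Suc k}" "Suc k < length s"
    | k where "e = {t ! k, t ! Suc k}" "Suc k < length t"
    unfolding path_edges_def by blast
  then show "e \<in> {{(s @ t) ! (k - 1), (s @ t) ! k} | k. k \<in> {1..<length (s @ t)} - {length s}}"
  proof cases
    case (1 k)
    then show ?thesis by (intro CollectI exI[of _ "Suc k"]) (simp add: nth_append)
  next
    case (2 k)
    then show ?thesis by (intro CollectI exI[of _ "Suc (length s + k)"]) (simp add: nth_append)
  qed
next
  fix e assume "e \<in> {{(s @ t) ! (k - 1), (s @ t) ! k} | k. k \<in> {1..<length (s @ t)} - {length s}}"
  then obtain k where k: "e = {(s @ t) ! (k - 1), (s @ t) ! k}" "1 \<le> k" "k < length s + length t" "k \<noteq> length s"
    by auto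
  show "e \<in> path_edges s \<union> path_edges t"
  proof (cases "k < length s")
    case True
    obtain j where "k = Suc j" using k(2) by (cases k) auto
    then have "e = {s ! j, s ! Suc j}" "Suc j < length s"
      using k(1) True by (simp_all add: nth_append)
    then show ?thesis unfolding path_edges_def by blast
  next
    case False
    define j where "j = k - 1 - length s"
    have "k = Suc (length s + j)" using False k unfolding j_def by simp
    then have "e = {t ! j, t ! Suc j}" "Suc j < length t"
      using k by (simp_all add: nth_append)
    then show ?thesis unfolding path_edges_def by blast
  qed
qed

section \<open>Comparison of the two bounds\<close>

theorem proposition8p7:
  fixes E :: "'n :: finite set set"
  assumes "CHAR('k :: alg_closed_field) \<noteq> 2"
    and "triangle_with_paths E"
  shows "int (v_number (parity_edge_ideal E :: ('n + 'n, 'k) mpoly set))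
           \<le> regularity (parity_edge_ideal E :: ('n + 'n, 'k) mpoly set)"
proof -
  from assms(2) obtain p q r where len: "2 \<le> length p" "2 \<le> length q" "2 \<le> length r"
    and dist: "distinct (p @ q @ r)" "set (p @ q @ r) = UNIV"
    and E: "E = {{hd p, hd q}, {hd q, hd r}, {hd r, hd p}} \<union> path_edges p \<union> path_edges q \<union> path_edges r"
    unfolding triangle_with_paths_def by blast
  have v: "v_number (parity_edge_ideal E :: ('n + 'n, 'k) mpoly set) \<le> length p + length q + length r - 3"
    using E by (intro v_number_le[OF assms(1) len dist]) (auto simp: insert_commute)
  \<comment> \<open>The triangle vertex \<open>z\<close> of the third path is deleted. The edge
    between \<open>hd p\<close> and \<open>hd q\<close> joins the first two paths into
    \<open>rev p @ q\<close>; what remains of the third is \<open>y # t\<close>.\<close>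
  obtain z y t where r: "r = z # y # t"
    using len(3) by (cases r rule: remdups_adj.cases) auto
  define s where "s = rev p @ q"
  define Z where "Z = {1..<length (s @ y # t)} - {length s}"
  have ne: "p \<noteq> []" "q \<noteq> []" using len by auto
  have "path_edges s = path_edges p \<union> path_edges q \<union> {{hd p, hd q}}"
    unfolding s_def using ne by (simp add: path_edges_append path_edges_rev last_rev)
  then have E': "E = path_edges s \<union> path_edges (y # t) \<union> {{hd q, z}, {z, hd p}, {z, y}}"
    unfolding E r by auto
  have edges: "path_edges s \<union> path_edges (y # t) =
      {{(s @ y # t) ! (k - 1), (s @ y # t) ! k} | k. k \<in> Z}"
    unfolding Z_def by (rule path_edges_append_nth)
  have "int (card Z) \<le> regularity (parity_edge_ideal E :: ('n + 'n, 'k) mpoly set)"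
  proof (rule regularity_ge_card_edges[of "s @ y # t" z])
    show "distinct (s @ y # t)" "z \<notin> set (s @ y # t)"
      using dist(1) unfolding r s_def by auto
    show "Z \<subseteq> {1..<length (s @ y # t)}" unfolding Z_def by blast
    show "{(s @ y # t) ! (k - 1), (s @ y # t) ! k} \<in> E" if "k \<in> Z" for k
      using that edges unfolding E' by blast
    fix i j assume "{i, j} \<in> E"
    then have "z \<in> {i, j} \<or> {i, j} \<in> path_edges s \<union> path_edges (y # t)" unfolding E' by blast
    then show "i = z \<or> j = z \<or> (\<exists>k\<in>Z. {i, j} = {(s @ y # t) ! (k - 1), (s @ y # t) ! k})"
      unfolding edges by blast
  qed
  moreover have "card Z = length p + length q + length r - 3"
  proof -
    \<comment> \<open>The list has \<open>n - 1\<close> vertices, hence \<open>n - 2\<close>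
      consecutive pairs, and the pair at the junction is not counted.\<close>
    have "length s \<in> {1..<length (s @ y # t)}" using ne by (simp add: s_def Suc_le_eq)
    then have "card Z = length (s @ y # t) - 1 - 1" unfolding Z_def by simp
    then show ?thesis by (simp add: s_def r)
  qed
  ultimately show ?thesis using v by linarith
qed

end
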